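(* Let $\mathcal{C}$ be a skeletally small Krull-Schmidt additive category with split idempotents, and let $\mathcal{B}$ be a full additive subcategory of $\mathcal{C}$ with $\mathcal{B}=\mathrm{add}(\mathcal{B})$. Suppose we have the recollement of $\mathrm{Mod}(\mathcal{C})$ by $\mathrm{Mod}(\mathcal{C}/I_{\mathcal{B}})$ and $\mathrm{Mod}(\mathcal{B})$ given by the adjoint triples $$\left(\mathcal{C}/I_{\mathcal{B}}\otimes_{\mathcal{C}}-,\ \mathrm{res}_{\mathcal{C}},\ \mathcal{C}(\mathcal{C}/I_{\mathcal{B}},-)\right)\quad\text{and}\quad\left(\mathcal{C}\otimes_{\mathcal{B}}-,\ \mathrm{res}_{\mathcal{B}},\ \mathcal{B}(\mathcal{C},-)\right),$$ that $\mathcal{C}/I_{\mathcal{B}}\otimes_{\mathcal{C}}-:\mathrm{Mod}(\mathcal{C})\to\mathrm{Mod}(\mathcal{C}/I_{\mathcal{B}})$ is exact, and that $\mathcal{B}$ is a contravariantly finite subcategory of $\mathcal{C}$. Then there exists an equivalence of categories $$\Xi:\mathcal{C}\longrightarrow \begin{bmatrix}\mathcal{B}^{\perp_0} & 0\\ \overline{\mathrm{Hom}} & \mathcal{B}\end{bmatrix}.$$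
   Context: Modules: for a skeletally small preadditive category $\mathcal{A}$, $\mathrm{Mod}(\mathcal{A})$ is the category of additive covariant functors $\mathcal{A}\to\mathbf{Ab}$ and natural transformations. The tensor product $\otimes_{\mathcal{A}}:\mathrm{Mod}(\mathcal{A}^{op})\times\mathrm{Mod}(\mathcal{A})\to\mathbf{Ab}$ is the (unique up to isomorphism) functor which is right exact and preserves coproducts in each variable and satisfies $F\otimes_{\mathcal{A}}\mathcal{A}(A,-)=F(A)$ and $\mathcal{A}(-,A)\otimes_{\mathcal{A}}G=G(A)$. Krull-Schmidt: every object is a finite direct sum of objects with local endomorphism ring. Idempotents split: every idempotent endomorphism has a kernel. $\mathrm{add}(\mathcal{B})$ is the full subcategory of direct summands of finite direct sums of objects of $\mathcal{B}$. $\mathcal{B}$ is contravariantly finite in $\mathcal{C}$ if for every $C\in\mathcal{C}$ there is a morphism $f:B\to C$ with $B\in\mathcal{B}$ such that every morphism $f':B'\to C$ with $B'\in\mathcal{B}$ factors as $f'=fg$ for some $g:B'\to B$. Quotient: $I_{\mathcal{B}}(C,C')\subseteq\mathcal{C}(C,C')$ is the subgroup of morphisms factoring through an object of $\mathcal{B}$; it is a two-sided ideal. $\mathcal{C}/I_{\mathcal{B}}$ has the objects of $\mathcal{C}$ and morphisms $\mathcal{C}(C,C')/I_{\mathcal{B}}(C,C')$; $\pi:\mathcal{C}\to\mathcal{C}/I_{\mathcal{B}}$ is the projection. Functors: $\mathrm{res}_{\mathcal{C}}:\mathrm{Mod}(\mathcal{C}/I_{\mathcal{B}})\to\mathrm{Mod}(\mathcal{C})$,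 $F\mapsto F\circ\pi$; $(\mathcal{C}/I_{\mathcal{B}}\otimes_{\mathcal{C}}N)(C)=\frac{\mathcal{C}(-,C)}{I_{\mathcal{B}}(-,C)}\otimes_{\mathcal{C}}N$; $\mathcal{C}(\mathcal{C}/I_{\mathcal{B}},N)(C)=\mathrm{Hom}_{\mathrm{Mod}(\mathcal{C})}\left(\frac{\mathcal{C}(C,-)}{I_{\mathcal{B}}(C,-)},N\right)$; $\mathrm{res}_{\mathcal{B}}:\mathrm{Mod}(\mathcal{C})\to\mathrm{Mod}(\mathcal{B})$ is restriction; $(\mathcal{C}\otimes_{\mathcal{B}}N)(C)=\mathcal{C}(-,C)|_{\mathcal{B}}\otimes_{\mathcal{B}}N$; $\mathcal{B}(\mathcal{C},N)(C)=\mathrm{Hom}_{\mathrm{Mod}(\mathcal{B})}(\mathcal{C}(C,-)|_{\mathcal{B}},N)$. Recollement: for abelian categories $\mathcal{B}',\mathcal{A}',\mathcal{C}'$, additive functors $i_*:\mathcal{B}'\to\mathcal{A}'$, $i^*,i^!:\mathcal{A}'\to\mathcal{B}'$, $j^*:\mathcal{A}'\to\mathcal{C}'$, $j_!,j_*:\mathcal{C}'\to\mathcal{A}'$ such that $(i^*,i_*,i^!)$ and $(j_!,j^*,j_* )$ are adjoint triples, $\mathrm{Ker}(j^* )=\mathrm{Im}(i_* )$, and $i_*,j_!,j_*$ are fully faithful. Here $i_*=\mathrm{res}_{\mathcal{C}}$, $j^*=\mathrm{res}_{\mathcal{B}}$. $\mathcal{B}^{\perp_0}$ is the full subcategory of $\mathcal{C}$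 of objects $X$ with $\mathcal{C}(B,X)=0$ for all $B\in\mathcal{B}$. Triangular matrix category: for preadditive categories $\mathcal{T},\mathcal{U}$ and an additive functor $M:\mathcal{U}\otimes\mathcal{T}^{op}\to\mathbf{Ab}$ (the category $\mathcal{U}\otimes\mathcal{T}^{op}$ has pairs $(U,T)$ as objects and tensor products of Hom groups as morphisms), the category $\begin{bmatrix}\mathcal{T} & 0 \\ M & \mathcal{U}\end{bmatrix}$ has objects $\begin{bmatrix}T & 0 \\ M & U\end{bmatrix}$ with $T\in\mathcal{T}$, $U\in\mathcal{U}$; morphisms from $\begin{bmatrix}T & 0 \\ M & U\end{bmatrix}$ to $\begin{bmatrix}T' & 0 \\ M & U'\end{bmatrix}$ are matrices $\begin{bmatrix}t & 0 \\ m & u\end{bmatrix}$ with $t\in\mathcal{T}(T,T')$, $m\in M(U',T)$, $u\in\mathcal{U}(U,U')$; composition is $\begin{bmatrix}t_2 & 0 \\ m_2 & u_2\end{bmatrix}\circ\begin{bmatrix}t_1 & 0 \\ m_1 & u_1\end{bmatrix}=\begin{bmatrix}t_2t_1 & 0 \\ m_2\bullet t_1+u_2\bullet m_1 & u_2u_1\end{bmatrix}$ with $m_2\bullet t_1=M(1\otimes t_1^{op})(m_2)$, $u_2\bullet m_1=M(u_2\otimes1)(m_1)$. $\overline{\mathrm{Hom}}:\mathcal{B}\otimes(\mathcal{B}^{\perp_0})^{op}\to\mathbf{Ab}$ is the restriction of the Hom functor: $\overline{\mathrm{Hom}}(U,T)=\mathrm{Hom}_{\mathcal{C}}(T,U)$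 for $U\in\mathcal{B}$, $T\in\mathcal{B}^{\perp_0}$. *)

theory Defs
  imports "HOL-Algebra.Coset" "HOL-Algebra.Ring"
begin

section \<open>Preadditive categories\<close>

text \<open>
  The morphisms \<open>X \<rightarrow> Y\<close> form the carrier of an abelian group \<open>Hom C X Y\<close>.  Following the group
  theory library, this group is written multiplicatively, so that \<open>\<otimes>\<close> is the addition of
  morphisms and \<open>\<one>\<close> is the zero morphism.  Hom groups at different pairs of objects need not be
  disjoint, so composition carries its objects: \<open>Cmp C X Y Z g f\<close> is \<open>g \<circ> f\<close> for \<open>f : X \<rightarrow> Y\<close> and
  \<open>g : Y \<rightarrow> Z\<close>.
\<close>

record ('o, 'm) acat =
  Ob :: "'o set"
  Hom :: "'o \<Rightarrow> 'o \<Rightarrow> 'm monoid"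
  Idn :: "'o \<Rightarrow> 'm"
  Cmp :: "'o \<Rightarrow> 'o \<Rightarrow> 'o \<Rightarrow> 'm \<Rightarrow> 'm \<Rightarrow> 'm"

abbreviation arr :: "('o, 'm) acat \<Rightarrow> 'o \<Rightarrow> 'o \<Rightarrow> 'm set" where
  "arr C X Y \<equiv> carrier (Hom C X Y)"

abbreviation zero_arr :: "('o, 'm) acat \<Rightarrow> 'o \<Rightarrow> 'o \<Rightarrow> 'm" where
  "zero_arr C X Y \<equiv> \<one>\<^bsub>Hom C X Y\<^esub>"

locale preadditive =
  fixes C :: "('o, 'm) acat"
  assumes hom_group: "X \<in> Ob C \<Longrightarrow> Y \<in> Ob C \<Longrightarrow> comm_group (Hom C X Y)"
    and id_arr: "X \<in> Ob C \<Longrightarrow> Idn C X \<in> arr C X X"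
    and comp_arr: "\<lbrakk>X \<in> Ob C; Y \<in> Ob C; Z \<in> Ob C; f \<in> arr C X Y; g \<in> arr C Y Z\<rbrakk>
      \<Longrightarrow> Cmp C X Y Z g f \<in> arr C X Z"
    and comp_id_right: "\<lbrakk>X \<in> Ob C; Y \<in> Ob C; f \<in> arr C X Y\<rbrakk> \<Longrightarrow> Cmp C X X Y f (Idn C X) = f"
    and comp_id_left: "\<lbrakk>X \<in> Ob C; Y \<in> Ob C; f \<in> arr C X Y\<rbrakk> \<Longrightarrow> Cmp C X Y Y (Idn C Y) f = f"
    and comp_assoc: "\<lbrakk>W \<in> Ob C; X \<in> Ob C; Y \<in> Ob C; Z \<in> Ob C;
        f \<in> arr C W X; g \<in> arr C X Y; h \<in> arr C Y Z\<rbrakk>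
      \<Longrightarrow> Cmp C W Y Z h (Cmp C W X Y g f) = Cmp C W X Z (Cmp C X Y Z h g) f"
    and comp_add_right: "\<lbrakk>X \<in> Ob C; Y \<in> Ob C; Z \<in> Ob C; f \<in> arr C X Y; f' \<in> arr C X Y; g \<in> arr C Y Z\<rbrakk>
      \<Longrightarrow> Cmp C X Y Z g (f \<otimes>\<^bsub>Hom C X Y\<^esub> f')
        = Cmp C X Y Z g f \<otimes>\<^bsub>Hom C X Z\<^esub> Cmp C X Y Z g f'"
    and comp_add_left: "\<lbrakk>X \<in> Ob C; Y \<in> Ob C; Z \<in> Ob C; f \<in> arr C X Y; g \<in> arr C Y Z; g' \<in> arr C Y Z\<rbrakk>
      \<Longrightarrow> Cmp C X Y Z (g \<otimes>\<^bsub>Hom C Y Z\<^esub> g') f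
        = Cmp C X Y Z g f \<otimes>\<^bsub>Hom C X Z\<^esub> Cmp C X Y Z g' f"

definition op_cat :: "('o, 'm) acat \<Rightarrow> ('o, 'm) acat" where
  "op_cat C = \<lparr>Ob = Ob C, Hom = (\<lambda>X Y. Hom C Y X), Idn = Idn C,
    Cmp = (\<lambda>X Y Z g f. Cmp C Z Y X f g)\<rparr>"

definition full_sub :: "('o, 'm) acat \<Rightarrow> 'o set \<Rightarrow> ('o, 'm) acat" where
  "full_sub C S = C\<lparr>Ob := S\<rparr>"

definition prod_cat :: "('o, 'm) acat \<Rightarrow> ('p, 'n) acat \<Rightarrow> ('o \<times> 'p, 'm \<times> 'n) acat" where
  "prod_cat C D = \<lparr>Ob = Ob C \<times> Ob D,
    Hom = (\<lambda>(X, Y) (X', Y'). Hom C X X' \<times>\<times> Hom D Y Y'),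
    Idn = (\<lambda>(X, Y). (Idn C X, Idn D Y)),
    Cmp = (\<lambda>(X1, Y1) (X2, Y2) (X3, Y3) (g, g') (f, f'). (Cmp C X1 X2 X3 g f, Cmp D Y1 Y2 Y3 g' f'))\<rparr>"

definition is_iso :: "('o, 'm) acat \<Rightarrow> 'o \<Rightarrow> 'o \<Rightarrow> 'm \<Rightarrow> bool" where
  "is_iso C X Y f \<longleftrightarrow> f \<in> arr C X Y \<and> (\<exists>g \<in> arr C Y X.
     Cmp C X Y X g f = Idn C X \<and> Cmp C Y X Y f g = Idn C Y)"

definition isomorphic :: "('o, 'm) acat \<Rightarrow> 'o \<Rightarrow> 'o \<Rightarrow> bool" where
  "isomorphic C X Y \<longleftrightarrow> (\<exists>f. is_iso C X Y f)"

definition is_zero :: "('o, 'm) acat \<Rightarrow> 'o \<Rightarrow> bool" where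
  "is_zero C X \<longleftrightarrow> X \<in> Ob C \<and> (\<forall>Y \<in> Ob C. (\<exists>!f. f \<in> arr C X Y) \<and> (\<exists>!f. f \<in> arr C Y X))"

text \<open>\<open>X = A 0 \<oplus> \<dots> \<oplus> A (n - 1)\<close>; for \<open>n = 0\<close> this says that \<open>X\<close> is a zero object.\<close>

definition is_direct_sum :: "('o, 'm) acat \<Rightarrow> nat \<Rightarrow> (nat \<Rightarrow> 'o) \<Rightarrow> 'o \<Rightarrow> bool" where
  "is_direct_sum C n A X \<longleftrightarrow> X \<in> Ob C \<and> (\<forall>k<n. A k \<in> Ob C) \<and>
     (\<exists>i p. (\<forall>k<n. i k \<in> arr C (A k) X \<and> p k \<in> arr C X (A k)) \<and>
       (\<forall>k<n. \<forall>l<n. Cmp C (A k) X (A l) (p l) (i k) = (if k = l then Idn C (A k) else zero_arr C (A k) (A l))) \<and>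
       finprod (Hom C X X) (\<lambda>k. Cmp C X (A k) X (i k) (p k)) {..<n} = Idn C X)"

definition additive_cat :: "('o, 'm) acat \<Rightarrow> bool" where
  "additive_cat C \<longleftrightarrow> preadditive C \<and>
     (\<forall>n A. (\<forall>k<n. A k \<in> Ob C) \<longrightarrow> (\<exists>X. is_direct_sum C n A X))"

definition is_kernel :: "('o, 'm) acat \<Rightarrow> 'o \<Rightarrow> 'o \<Rightarrow> 'm \<Rightarrow> 'o \<Rightarrow> 'm \<Rightarrow> bool" where
  "is_kernel C X Y f K k \<longleftrightarrow> X \<in> Ob C \<and> Y \<in> Ob C \<and> f \<in> arr C X Y \<and> K \<in> Ob C \<and> k \<in> arr C K X \<and>
     Cmp C K X Y f k = zero_arr C K Y \<and>
     (\<forall>W \<in> Ob C. \<forall>h \<in> arr C W X. Cmp C W X Y f h = zero_arr C W Y \<longrightarrow>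
        (\<exists>!l. l \<in> arr C W K \<and> Cmp C W K X k l = h))"

definition is_cokernel :: "('o, 'm) acat \<Rightarrow> 'o \<Rightarrow> 'o \<Rightarrow> 'm \<Rightarrow> 'o \<Rightarrow> 'm \<Rightarrow> bool" where
  "is_cokernel C X Y f Q q \<longleftrightarrow> is_kernel (op_cat C) Y X f Q q"

definition is_mono :: "('o, 'm) acat \<Rightarrow> 'o \<Rightarrow> 'o \<Rightarrow> 'm \<Rightarrow> bool" where
  "is_mono C X Y f \<longleftrightarrow> f \<in> arr C X Y \<and> (\<forall>W \<in> Ob C. \<forall>g \<in> arr C W X. \<forall>h \<in> arr C W X.
     Cmp C W X Y f g = Cmp C W X Y f h \<longrightarrow> g = h)"

definition is_epi :: "('o, 'm) acat \<Rightarrow> 'o \<Rightarrow> 'o \<Rightarrow> 'm \<Rightarrow> bool" where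
  "is_epi C X Y f \<longleftrightarrow> is_mono (op_cat C) Y X f"

definition abelian_cat :: "('o, 'm) acat \<Rightarrow> bool" where
  "abelian_cat C \<longleftrightarrow> additive_cat C \<and>
     (\<forall>X \<in> Ob C. \<forall>Y \<in> Ob C. \<forall>f \<in> arr C X Y.
        (\<exists>K k. is_kernel C X Y f K k) \<and> (\<exists>Q q. is_cokernel C X Y f Q q) \<and>
        (is_mono C X Y f \<longrightarrow> (\<exists>Z g. is_kernel C Y Z g X f)) \<and>
        (is_epi C X Y f \<longrightarrow> (\<exists>Z g. is_cokernel C Z X g Y f)))"

definition short_exact :: "('o, 'm) acat \<Rightarrow> 'o \<Rightarrow> 'm \<Rightarrow> 'o \<Rightarrow> 'm \<Rightarrow> 'o \<Rightarrow> bool" where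
  "short_exact C X f Y g Z \<longleftrightarrow> is_kernel C Y Z g X f \<and> is_cokernel C X Y f Z g"

definition is_coproduct ::
  "('o, 'm) acat \<Rightarrow> 'i set \<Rightarrow> ('i \<Rightarrow> 'o) \<Rightarrow> 'o \<Rightarrow> ('i \<Rightarrow> 'm) \<Rightarrow> bool" where
  "is_coproduct C I X S \<iota> \<longleftrightarrow> S \<in> Ob C \<and> (\<forall>i\<in>I. X i \<in> Ob C \<and> \<iota> i \<in> arr C (X i) S) \<and>
     (\<forall>Z \<in> Ob C. \<forall>g. (\<forall>i\<in>I. g i \<in> arr C (X i) Z) \<longrightarrow>
        (\<exists>!h. h \<in> arr C S Z \<and> (\<forall>i\<in>I. Cmp C (X i) S Z h (\<iota> i) = g i)))"


section \<open>Functors\<close>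

record ('o, 'm, 'p, 'n) fctr =
  FOb :: "'o \<Rightarrow> 'p"
  FArr :: "'o \<Rightarrow> 'o \<Rightarrow> 'm \<Rightarrow> 'n"

locale cat_functor = dom: preadditive C + cod: preadditive D
  for C :: "('o, 'm) acat" and D :: "('p, 'n) acat" and F :: "('o, 'm, 'p, 'n) fctr" +
  assumes map_ob: "X \<in> Ob C \<Longrightarrow> FOb F X \<in> Ob D"
    and map_arr: "\<lbrakk>X \<in> Ob C; Y \<in> Ob C; f \<in> arr C X Y\<rbrakk> \<Longrightarrow> FArr F X Y f \<in> arr D (FOb F X) (FOb F Y)"
    and map_id: "X \<in> Ob C \<Longrightarrow> FArr F X X (Idn C X) = Idn D (FOb F X)"
    and map_comp: "\<lbrakk>X \<in> Ob C; Y \<in> Ob C; Z \<in> Ob C; f \<in> arr C X Y; g \<in> arr C Y Z\<rbrakk> \<Longrightarrow>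
      FArr F X Z (Cmp C X Y Z g f)
        = Cmp D (FOb F X) (FOb F Y) (FOb F Z) (FArr F Y Z g) (FArr F X Y f)"

locale additive_functor = cat_functor +
  assumes map_add: "\<lbrakk>X \<in> Ob C; Y \<in> Ob C\<rbrakk> \<Longrightarrow>
    FArr F X Y \<in> hom (Hom C X Y) (Hom D (FOb F X) (FOb F Y))"

definition id_fun :: "('o, 'm, 'o, 'm) fctr" where
  "id_fun = \<lparr>FOb = (\<lambda>X. X), FArr = (\<lambda>X Y f. f)\<rparr>"

definition fcomp ::
  "('p, 'n, 'q, 'r) fctr \<Rightarrow> ('o, 'm, 'p, 'n) fctr \<Rightarrow> ('o, 'm, 'q, 'r) fctr" where
  "fcomp G F = \<lparr>FOb = (\<lambda>X. FOb G (FOb F X)),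
    FArr = (\<lambda>X Y f. FArr G (FOb F X) (FOb F Y) (FArr F X Y f))\<rparr>"

definition op_fun :: "('o, 'm, 'p, 'n) fctr \<Rightarrow> ('o, 'm, 'p, 'n) fctr" where
  "op_fun F = \<lparr>FOb = FOb F, FArr = (\<lambda>X Y f. FArr F Y X f)\<rparr>"

definition prod_fun ::
  "('o, 'm, 'p, 'n) fctr \<Rightarrow> ('o2, 'm2, 'p2, 'n2) fctr \<Rightarrow> ('o \<times> 'o2, 'm \<times> 'm2, 'p \<times> 'p2, 'n \<times> 'n2) fctr" where
  "prod_fun F G = \<lparr>FOb = (\<lambda>(X, Y). (FOb F X, FOb G Y)),
    FArr = (\<lambda>(X, Y) (X', Y') (f, g). (FArr F X X' f, FArr G Y Y' g))\<rparr>"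

definition swap_fun :: "('o \<times> 'p, 'm \<times> 'n, 'p \<times> 'o, 'n \<times> 'm) fctr" where
  "swap_fun = \<lparr>FOb = (\<lambda>(X, Y). (Y, X)), FArr = (\<lambda>_ _ (f, g). (g, f))\<rparr>"

text \<open>Natural transformations are extensional on objects, so that equality of functions is equality.\<close>

definition nat_trans ::
  "('o, 'm) acat \<Rightarrow> ('p, 'n) acat \<Rightarrow> ('o, 'm, 'p, 'n) fctr \<Rightarrow> ('o, 'm, 'p, 'n) fctr \<Rightarrow> ('o \<Rightarrow> 'n) \<Rightarrow> bool" where
  "nat_trans C D F G \<eta> \<longleftrightarrow> \<eta> \<in> extensional (Ob C) \<and>
     (\<forall>X \<in> Ob C. \<eta> X \<in> arr D (FOb F X) (FOb G X)) \<and>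
     (\<forall>X \<in> Ob C. \<forall>Y \<in> Ob C. \<forall>f \<in> arr C X Y.
        Cmp D (FOb F X) (FOb F Y) (FOb G Y) (\<eta> Y) (FArr F X Y f)
          = Cmp D (FOb F X) (FOb G X) (FOb G Y) (FArr G X Y f) (\<eta> X))"

definition nat_iso ::
  "('o, 'm) acat \<Rightarrow> ('p, 'n) acat \<Rightarrow> ('o, 'm, 'p, 'n) fctr \<Rightarrow> ('o, 'm, 'p, 'n) fctr \<Rightarrow> bool" where
  "nat_iso C D F G \<longleftrightarrow>
     (\<exists>\<eta>. nat_trans C D F G \<eta> \<and> (\<forall>X \<in> Ob C. is_iso D (FOb F X) (FOb G X) (\<eta> X)))"

definition is_equivalence ::
  "('o, 'm) acat \<Rightarrow> ('p, 'n) acat \<Rightarrow> ('o, 'm, 'p, 'n) fctr \<Rightarrow> bool" where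
  "is_equivalence C D F \<longleftrightarrow> cat_functor C D F \<and>
     (\<exists>G. cat_functor D C G \<and> nat_iso C C (fcomp G F) id_fun \<and> nat_iso D D (fcomp F G) id_fun)"

definition fully_faithful ::
  "('o, 'm) acat \<Rightarrow> ('p, 'n) acat \<Rightarrow> ('o, 'm, 'p, 'n) fctr \<Rightarrow> bool" where
  "fully_faithful C D F \<longleftrightarrow>
     (\<forall>X \<in> Ob C. \<forall>Y \<in> Ob C. bij_betw (FArr F X Y) (arr C X Y) (arr D (FOb F X) (FOb F Y)))"

definition adjoint ::
  "('o, 'm) acat \<Rightarrow> ('p, 'n) acat \<Rightarrow> ('o, 'm, 'p, 'n) fctr \<Rightarrow> ('p, 'n, 'o, 'm) fctr \<Rightarrow> bool" where
  "adjoint A B L R \<longleftrightarrow>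
     (\<exists>\<phi>. (\<forall>X \<in> Ob A. \<forall>Y \<in> Ob B. bij_betw (\<phi> X Y) (arr B (FOb L X) Y) (arr A X (FOb R Y))) \<and>
        (\<forall>X \<in> Ob A. \<forall>X' \<in> Ob A. \<forall>Y \<in> Ob B. \<forall>Y' \<in> Ob B.
           \<forall>h \<in> arr A X' X. \<forall>f \<in> arr B (FOb L X) Y. \<forall>g \<in> arr B Y Y'.
             \<phi> X' Y' (Cmp B (FOb L X') Y Y' g (Cmp B (FOb L X') (FOb L X) Y f (FArr L X' X h)))
               = Cmp A X' (FOb R Y) (FOb R Y') (FArr R Y Y' g) (Cmp A X' X (FOb R Y) (\<phi> X Y f) h)))"

definition exact_functor ::
  "('o, 'm) acat \<Rightarrow> ('p, 'n) acat \<Rightarrow> ('o, 'm, 'p, 'n) fctr \<Rightarrow> bool" where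
  "exact_functor A B F \<longleftrightarrow> additive_functor A B F \<and>
     (\<forall>X f Y g Z. short_exact A X f Y g Z \<longrightarrow>
        short_exact B (FOb F X) (FArr F X Y f) (FOb F Y) (FArr F Y Z g) (FOb F Z))"

text \<open>In an abelian category, \<open>X \<rightarrow> Y \<rightarrow> Z \<rightarrow> 0\<close> is exact iff \<open>Y \<rightarrow> Z\<close> is a cokernel of \<open>X \<rightarrow> Y\<close>.\<close>

definition right_exact ::
  "('o, 'm) acat \<Rightarrow> ('p, 'n) acat \<Rightarrow> ('o, 'm, 'p, 'n) fctr \<Rightarrow> bool" where
  "right_exact A B F \<longleftrightarrow> additive_functor A B F \<and>
     (\<forall>X Y f Z g. is_cokernel A X Y f Z g \<longrightarrow>
        is_cokernel B (FOb F X) (FOb F Y) (FArr F X Y f) (FOb F Z) (FArr F Y Z g))"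

text \<open>
  The functors \<open>(i\<^sup>*, i\<^sub>*, i\<^sup>!)\<close> and \<open>(j\<^sub>!, j\<^sup>*, j\<^sub>*)\<close> are given in this order.  The image of
  \<open>i\<^sub>*\<close> is the essential image.
\<close>

definition recollement ::
  "('b, 'bm) acat \<Rightarrow> ('a, 'am) acat \<Rightarrow> ('c, 'cm) acat \<Rightarrow>
   ('a, 'am, 'b, 'bm) fctr \<Rightarrow> ('b, 'bm, 'a, 'am) fctr \<Rightarrow> ('a, 'am, 'b, 'bm) fctr \<Rightarrow>
   ('c, 'cm, 'a, 'am) fctr \<Rightarrow> ('a, 'am, 'c, 'cm) fctr \<Rightarrow> ('c, 'cm, 'a, 'am) fctr \<Rightarrow> bool" where
  "recollement B A C i_up i_low i_shriek j_shriek j_up j_low \<longleftrightarrow>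
     abelian_cat B \<and> abelian_cat A \<and> abelian_cat C \<and>
     additive_functor A B i_up \<and> additive_functor B A i_low \<and> additive_functor A B i_shriek \<and>
     additive_functor C A j_shriek \<and> additive_functor A C j_up \<and> additive_functor C A j_low \<and>
     adjoint A B i_up i_low \<and> adjoint B A i_low i_shriek \<and>
     adjoint C A j_shriek j_up \<and> adjoint A C j_up j_low \<and>
     (\<forall>M \<in> Ob A. is_zero C (FOb j_up M) \<longleftrightarrow> (\<exists>N \<in> Ob B. isomorphic A M (FOb i_low N))) \<and>
     fully_faithful B A i_low \<and> fully_faithful C A j_shriek \<and> fully_faithful C A j_low"


section \<open>Modules over a preadditive category\<close>

text \<open>
  The type \<open>'u\<close> is the universe from which the elements of abelian groups are taken.  Group
  homomorphisms are made extensional on the carrier of their domain.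
\<close>

definition Ab_cat :: "('u monoid, 'u \<Rightarrow> 'u) acat" where
  "Ab_cat = \<lparr>Ob = {G. comm_group G},
    Hom = (\<lambda>G H. \<lparr>carrier = hom G H \<inter> extensional (carrier G),
      mult = (\<lambda>h k. \<lambda>x\<in>carrier G. h x \<otimes>\<^bsub>H\<^esub> k x),
      one = (\<lambda>x\<in>carrier G. \<one>\<^bsub>H\<^esub>)\<rparr>),
    Idn = (\<lambda>G. \<lambda>x\<in>carrier G. x),
    Cmp = (\<lambda>G H K k h. compose (carrier G) k h)\<rparr>"

text \<open>The category of additive functors \<open>C \<rightarrow> D\<close> and natural transformations.\<close>

definition fun_cat ::
  "('o, 'm) acat \<Rightarrow> ('p, 'n) acat \<Rightarrow> (('o, 'm, 'p, 'n) fctr, 'o \<Rightarrow> 'n) acat" where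
  "fun_cat C D = \<lparr>Ob = {F. additive_functor C D F},
    Hom = (\<lambda>F G. \<lparr>carrier = {\<eta>. nat_trans C D F G \<eta>},
      mult = (\<lambda>\<eta> \<theta>. \<lambda>X\<in>Ob C. \<eta> X \<otimes>\<^bsub>Hom D (FOb F X) (FOb G X)\<^esub> \<theta> X),
      one = (\<lambda>X\<in>Ob C. zero_arr D (FOb F X) (FOb G X))\<rparr>),
    Idn = (\<lambda>F. \<lambda>X\<in>Ob C. Idn D (FOb F X)),
    Cmp = (\<lambda>F G H \<theta> \<eta>. \<lambda>X\<in>Ob C. Cmp D (FOb F X) (FOb G X) (FOb H X) (\<theta> X) (\<eta> X))\<rparr>"

type_synonym ('o, 'm, 'u) modl = "('o, 'm, 'u monoid, 'u \<Rightarrow> 'u) fctr"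

definition mod_cat :: "('o, 'm) acat \<Rightarrow> (('o, 'm, 'u) modl, 'o \<Rightarrow> 'u \<Rightarrow> 'u) acat" where
  "mod_cat C = fun_cat C Ab_cat"

text \<open>
  A set \<open>S\<close> is small relative to \<open>'u\<close> if \<open>|'u|\<close> to the power \<open>|S|\<close> is at most \<open>|'u|\<close>.  A category
  is skeletally small if the morphisms between representatives of the isomorphism classes form a
  small set.  All the modules occurring below then exist with values in \<open>'u\<close>: for example
  \<open>Hom\<^bsub>Mod(C)\<^esub>(M, N)\<close> embeds into the set of families of elements of \<open>'u\<close> indexed by a small set.
\<close>

definition small_set :: "'u itself \<Rightarrow> 'a set \<Rightarrow> bool" where
  "small_set _ S \<longleftrightarrow> (\<exists>e :: ('a \<Rightarrow> 'u) \<Rightarrow> 'u. inj_on e (S \<rightarrow>\<^sub>E UNIV))"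

definition skeletally_small :: "'u itself \<Rightarrow> ('o, 'm) acat \<Rightarrow> bool" where
  "skeletally_small U C \<longleftrightarrow> infinite (UNIV :: 'u set) \<and>
     (\<exists>S \<subseteq> Ob C. (\<forall>X \<in> Ob C. \<exists>Y \<in> S. isomorphic C X Y) \<and>
        small_set U {(X, Y, f). X \<in> S \<and> Y \<in> S \<and> f \<in> arr C X Y})"

text \<open>
  Hom groups and quotients of them do not literally have elements in \<open>'u\<close>, so they are replaced by
  isomorphic copies: \<open>resize\<close> is the functor from abelian groups with elements in \<open>'a\<close> to abelian
  groups with elements in \<open>'u\<close>, defined on those groups whose carrier embeds into \<open>'u\<close>.
\<close>

definition emb :: "'a monoid \<Rightarrow> 'a \<Rightarrow> 'u" where
  "emb G = (SOME e. inj_on e (carrier G))"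

definition unemb :: "'a monoid \<Rightarrow> 'u \<Rightarrow> 'a" where
  "unemb G = inv_into (carrier G) (emb G)"

definition small_copy :: "'a monoid \<Rightarrow> 'u monoid" where
  "small_copy G = \<lparr>carrier = emb G ` carrier G,
    mult = (\<lambda>x y. emb G (unemb G x \<otimes>\<^bsub>G\<^esub> unemb G y)),
    one = emb G \<one>\<^bsub>G\<^esub>\<rparr>"

definition resize :: "('a monoid, 'a \<Rightarrow> 'a, 'u monoid, 'u \<Rightarrow> 'u) fctr" where
  "resize = \<lparr>FOb = small_copy,
    FArr = (\<lambda>G H h. \<lambda>x\<in>carrier (small_copy G). emb H (h (unemb G x)))\<rparr>"

text \<open>The functor \<open>C(A, -)\<close> to abelian groups; \<open>C(-, A)\<close> is obtained from the opposite category.\<close>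

definition hom_fun :: "('o, 'm) acat \<Rightarrow> 'o \<Rightarrow> ('o, 'm, 'm monoid, 'm \<Rightarrow> 'm) fctr" where
  "hom_fun C A = \<lparr>FOb = (\<lambda>X. Hom C A X),
    FArr = (\<lambda>X Y f. \<lambda>g\<in>arr C A X. Cmp C A X Y f g)\<rparr>"

text \<open>
  The functor \<open>C\<^sup>o\<^sup>p \<rightarrow> Mod(C)\<close>, \<open>A \<mapsto> C(A, -)\<close>.  Applied to \<open>op_cat C\<close>, it is the functor
  \<open>C \<rightarrow> Mod(C\<^sup>o\<^sup>p)\<close>, \<open>A \<mapsto> C(-, A)\<close>.
\<close>

definition yoneda :: "('o, 'm) acat \<Rightarrow> ('o, 'm, ('o, 'm, 'u) modl, 'o \<Rightarrow> 'u \<Rightarrow> 'u) fctr" where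
  "yoneda C = \<lparr>FOb = (\<lambda>A. fcomp resize (hom_fun C A)),
    FArr = (\<lambda>A A' a. \<lambda>X\<in>Ob C.
      FArr resize (Hom C A X) (Hom C A' X) (\<lambda>g\<in>arr C A X. Cmp C A' A X g a))\<rparr>"


subsection \<open>The tensor product\<close>

text \<open>The functors \<open>T(F, -)\<close> and \<open>T(-, G)\<close> given by a functor \<open>T\<close> on \<open>prod_cat A B\<close>.\<close>

definition fix_left ::
  "('o, 'm) acat \<Rightarrow> ('o \<times> 'p, 'm \<times> 'n, 'q, 'r) fctr \<Rightarrow> 'o \<Rightarrow> ('p, 'n, 'q, 'r) fctr" where
  "fix_left A T F = \<lparr>FOb = (\<lambda>G. FOb T (F, G)),
    FArr = (\<lambda>G G' \<eta>. FArr T (F, G) (F, G') (Idn A F, \<eta>))\<rparr>"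

definition fix_right ::
  "('p, 'n) acat \<Rightarrow> ('o \<times> 'p, 'm \<times> 'n, 'q, 'r) fctr \<Rightarrow> 'p \<Rightarrow> ('o, 'm, 'q, 'r) fctr" where
  "fix_right B T G = \<lparr>FOb = (\<lambda>F. FOb T (F, G)),
    FArr = (\<lambda>F F' \<eta>. FArr T (F, G) (F', G) (\<eta>, Idn B G))\<rparr>"

text \<open>Coproducts in module categories are indexed by subsets of \<open>'u\<close>.\<close>

definition preserves_coproducts ::
  "('o, 'm) acat \<Rightarrow> ('o, 'm, 'u monoid, 'u \<Rightarrow> 'u) fctr \<Rightarrow> bool" where
  "preserves_coproducts A F \<longleftrightarrow> (\<forall>(I :: 'u set) X S \<iota>. is_coproduct A I X S \<iota> \<longrightarrow>
     is_coproduct Ab_cat I (\<lambda>i. FOb F (X i)) (FOb F S) (\<lambda>i. FArr F (X i) S (\<iota> i)))"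

text \<open>The evaluation functor \<open>(F, A) \<mapsto> F(A)\<close> on \<open>prod_cat (mod_cat C) C\<close>.\<close>

definition eval_fun ::
  "(('o, 'm, 'u) modl \<times> 'o, ('o \<Rightarrow> 'u \<Rightarrow> 'u) \<times> 'm, 'u monoid, 'u \<Rightarrow> 'u) fctr" where
  "eval_fun = \<lparr>FOb = (\<lambda>(F, A). FOb F A),
    FArr = (\<lambda>(F, A) (G, B) (\<eta>, a). Cmp Ab_cat (FOb F A) (FOb F B) (FOb G B) (\<eta> B) (FArr F A B a))\<rparr>"

type_synonym ('o, 'm, 'u) tensor =
  "(('o, 'm, 'u) modl \<times> ('o, 'm, 'u) modl, ('o \<Rightarrow> 'u \<Rightarrow> 'u) \<times> ('o \<Rightarrow> 'u \<Rightarrow> 'u), 'u monoid, 'u \<Rightarrow> 'u) fctr"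

text \<open>
  The last two conditions are \<open>T(F, C(A, -)) \<cong> F(A)\<close> and \<open>T(C(-, A), G) \<cong> G(A)\<close>, naturally in both
  variables.
\<close>

definition is_tensor :: "('o, 'm) acat \<Rightarrow> ('o, 'm, 'u) tensor \<Rightarrow> bool" where
  "is_tensor C T \<longleftrightarrow>
     cat_functor (prod_cat (mod_cat (op_cat C)) (mod_cat C)) Ab_cat T \<and>
     (\<forall>F \<in> Ob (mod_cat (op_cat C)).
        right_exact (mod_cat C) Ab_cat (fix_left (mod_cat (op_cat C)) T F) \<and>
        preserves_coproducts (mod_cat C) (fix_left (mod_cat (op_cat C)) T F)) \<and>
     (\<forall>G \<in> Ob (mod_cat C).
        right_exact (mod_cat (op_cat C)) Ab_cat (fix_right (mod_cat C) T G) \<and>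
        preserves_coproducts (mod_cat (op_cat C)) (fix_right (mod_cat C) T G)) \<and>
     nat_iso (prod_cat (mod_cat (op_cat C)) (op_cat C)) Ab_cat
       (fcomp T (prod_fun id_fun (yoneda C))) eval_fun \<and>
     nat_iso (prod_cat C (mod_cat C)) Ab_cat
       (fcomp T (prod_fun (yoneda (op_cat C)) id_fun)) (fcomp eval_fun swap_fun)"


subsection \<open>Restriction, induction and coinduction along a functor \<open>P : C \<rightarrow> D\<close>\<close>

definition res ::
  "('o, 'm) acat \<Rightarrow> ('o, 'm, 'p, 'n) fctr \<Rightarrow>
   (('p, 'n, 'u) modl, 'p \<Rightarrow> 'u \<Rightarrow> 'u, ('o, 'm, 'u) modl, 'o \<Rightarrow> 'u \<Rightarrow> 'u) fctr" where
  "res C P = \<lparr>FOb = (\<lambda>F. fcomp F P), FArr = (\<lambda>F G \<eta>. \<lambda>X\<in>Ob C. \<eta> (FOb P X))\<rparr>"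

text \<open>The functors \<open>Y \<mapsto> D(P-, Y)\<close>, \<open>D \<rightarrow> Mod(C\<^sup>o\<^sup>p)\<close>, and \<open>Y \<mapsto> D(Y, P-)\<close>, \<open>D\<^sup>o\<^sup>p \<rightarrow> Mod(C)\<close>.\<close>

definition right_bimod ::
  "('o, 'm) acat \<Rightarrow> ('p, 'n) acat \<Rightarrow> ('o, 'm, 'p, 'n) fctr \<Rightarrow>
   ('p, 'n, ('o, 'm, 'u) modl, 'o \<Rightarrow> 'u \<Rightarrow> 'u) fctr" where
  "right_bimod C D P = fcomp (res (op_cat C) (op_fun P)) (yoneda (op_cat D))"

definition left_bimod ::
  "('o, 'm) acat \<Rightarrow> ('p, 'n) acat \<Rightarrow> ('o, 'm, 'p, 'n) fctr \<Rightarrow>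
   ('p, 'n, ('o, 'm, 'u) modl, 'o \<Rightarrow> 'u \<Rightarrow> 'u) fctr" where
  "left_bimod C D P = fcomp (res C P) (yoneda D)"

text \<open>\<open>(D \<otimes>\<^sub>C N)(Y) = D(P-, Y) \<otimes>\<^sub>C N\<close>, where \<open>T\<close> is the tensor product over \<open>C\<close>.\<close>

definition induct_mod ::
  "('o, 'm, 'u) tensor \<Rightarrow> ('o, 'm) acat \<Rightarrow> ('p, 'n) acat \<Rightarrow> ('o, 'm, 'p, 'n) fctr \<Rightarrow>
   (('o, 'm, 'u) modl, 'o \<Rightarrow> 'u \<Rightarrow> 'u, ('p, 'n, 'u) modl, 'p \<Rightarrow> 'u \<Rightarrow> 'u) fctr" where
  "induct_mod T C D P =
    \<lparr>FOb = (\<lambda>N. fcomp (fix_right (mod_cat C) T N) (right_bimod C D P)),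
     FArr = (\<lambda>N N' \<eta>. \<lambda>Y\<in>Ob D.
       FArr (fix_left (mod_cat (op_cat C)) T (FOb (right_bimod C D P) Y)) N N' \<eta>)\<rparr>"

text \<open>\<open>C(D, N)(Y) = Hom\<^bsub>Mod(C)\<^esub>(D(Y, P-), N)\<close>.\<close>

definition coinduct_mod ::
  "('o, 'm) acat \<Rightarrow> ('p, 'n) acat \<Rightarrow> ('o, 'm, 'p, 'n) fctr \<Rightarrow>
   (('o, 'm, 'u) modl, 'o \<Rightarrow> 'u \<Rightarrow> 'u, ('p, 'n, 'u) modl, 'p \<Rightarrow> 'u \<Rightarrow> 'u) fctr" where
  "coinduct_mod C D P =
    \<lparr>FOb = (\<lambda>N. fcomp resize
       (fcomp (hom_fun (op_cat (mod_cat C)) N) (op_fun (left_bimod C D P)))),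
     FArr = (\<lambda>N N' \<eta>. \<lambda>Y\<in>Ob D. let M = FOb (left_bimod C D P) Y in
       FArr resize (Hom (mod_cat C) M N) (Hom (mod_cat C) M N')
         (\<lambda>\<alpha>\<in>arr (mod_cat C) M N. Cmp (mod_cat C) M N N' \<eta> \<alpha>))\<rparr>"


section \<open>Krull--Schmidt categories and subcategories\<close>

definition End_ring :: "('o, 'm) acat \<Rightarrow> 'o \<Rightarrow> 'm ring" where
  "End_ring C X = \<lparr>carrier = arr C X X, mult = Cmp C X X X, one = Idn C X,
    zero = zero_arr C X X, add = mult (Hom C X X)\<rparr>"

definition local_ring :: "('m, 'b) ring_scheme \<Rightarrow> bool" where
  "local_ring R \<longleftrightarrow> ring R \<and> \<one>\<^bsub>R\<^esub> \<noteq> \<zero>\<^bsub>R\<^esub> \<and>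
     (\<forall>a \<in> carrier R - Units R. \<forall>b \<in> carrier R - Units R. a \<oplus>\<^bsub>R\<^esub> b \<notin> Units R)"

definition krull_schmidt :: "('o, 'm) acat \<Rightarrow> bool" where
  "krull_schmidt C \<longleftrightarrow> (\<forall>X \<in> Ob C. \<exists>n A. is_direct_sum C n A X \<and> (\<forall>k<n. local_ring (End_ring C (A k))))"

definition idempotents_split :: "('o, 'm) acat \<Rightarrow> bool" where
  "idempotents_split C \<longleftrightarrow> (\<forall>X \<in> Ob C. \<forall>e \<in> arr C X X. Cmp C X X X e e = e \<longrightarrow>
     (\<exists>K k. is_kernel C X X e K k))"

definition direct_summand :: "('o, 'm) acat \<Rightarrow> 'o \<Rightarrow> 'o \<Rightarrow> bool" where
  "direct_summand C X Y \<longleftrightarrow> (\<exists>X'. is_direct_sum C 2 (\<lambda>k. if k = 0 then X else X') Y)"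

definition add_closure :: "('o, 'm) acat \<Rightarrow> 'o set \<Rightarrow> 'o set" where
  "add_closure C B = {X. \<exists>n A Y. (\<forall>k<n. A k \<in> B) \<and> is_direct_sum C n A Y \<and> direct_summand C X Y}"

definition contravariantly_finite :: "('o, 'm) acat \<Rightarrow> 'o set \<Rightarrow> bool" where
  "contravariantly_finite C B \<longleftrightarrow> (\<forall>X \<in> Ob C. \<exists>Y \<in> B. \<exists>f \<in> arr C Y X.
     \<forall>Y' \<in> B. \<forall>f' \<in> arr C Y' X. \<exists>g \<in> arr C Y' Y. f' = Cmp C Y' Y X f g)"

definition perp0 :: "('o, 'm) acat \<Rightarrow> 'o set \<Rightarrow> 'o set" where
  "perp0 C B = {X \<in> Ob C. \<forall>Y \<in> B. arr C Y X = {zero_arr C Y X}}"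

definition fact_ideal :: "('o, 'm) acat \<Rightarrow> 'o set \<Rightarrow> 'o \<Rightarrow> 'o \<Rightarrow> 'm set" where
  "fact_ideal C B X Y = {f \<in> arr C X Y. \<exists>Z \<in> B. \<exists>g \<in> arr C X Z. \<exists>h \<in> arr C Z Y. f = Cmp C X Z Y h g}"

text \<open>
  The quotient \<open>C/I\<^sub>B\<close>; its morphisms are cosets.  The composite of two cosets is the common coset
  of the composites of their elements.
\<close>

definition quot_cat :: "('o, 'm) acat \<Rightarrow> 'o set \<Rightarrow> ('o, 'm set) acat" where
  "quot_cat C B = \<lparr>Ob = Ob C,
    Hom = (\<lambda>X Y. Hom C X Y Mod fact_ideal C B X Y),
    Idn = (\<lambda>X. fact_ideal C B X X #>\<^bsub>Hom C X X\<^esub> Idn C X),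
    Cmp = (\<lambda>X Y Z G F. \<Union>g\<in>G. \<Union>f\<in>F. fact_ideal C B X Z #>\<^bsub>Hom C X Z\<^esub> Cmp C X Y Z g f)\<rparr>"

definition quot_fun :: "('o, 'm) acat \<Rightarrow> 'o set \<Rightarrow> ('o, 'm, 'o, 'm set) fctr" where
  "quot_fun C B = \<lparr>FOb = (\<lambda>X. X), FArr = (\<lambda>X Y f. fact_ideal C B X Y #>\<^bsub>Hom C X Y\<^esub> f)\<rparr>"


section \<open>Triangular matrix categories\<close>

text \<open>
  An additive functor \<open>M\<close> on the tensor product category of \<open>U\<close> and \<open>T\<^sup>o\<^sup>p\<close> is given by its values on
  objects and on elementary tensors, i.e. as a functor on \<open>prod_cat U (op_cat T)\<close> that is additive
  in each variable.  The matrix with first column \<open>t, m\<close> and second column \<open>0, u\<close> is the triple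
  \<open>(t, m, u)\<close>.
\<close>

definition tri_mat_cat ::
  "('t, 'a) acat \<Rightarrow> ('s \<times> 't, 'b \<times> 'a, 'c monoid, 'c \<Rightarrow> 'c) fctr \<Rightarrow> ('s, 'b) acat \<Rightarrow>
   ('t \<times> 's, 'a \<times> 'c \<times> 'b) acat" where
  "tri_mat_cat T M U = \<lparr>Ob = Ob T \<times> Ob U,
    Hom = (\<lambda>(T1, U1) (T2, U2). Hom T T1 T2 \<times>\<times> (FOb M (U2, T1) \<times>\<times> Hom U U1 U2)),
    Idn = (\<lambda>(T1, U1). (Idn T T1, \<one>\<^bsub>FOb M (U1, T1)\<^esub>, Idn U U1)),
    Cmp = (\<lambda>(T1, U1) (T2, U2) (T3, U3) (t2, m2, u2) (t1, m1, u1).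
      (Cmp T T1 T2 T3 t2 t1,
       FArr M (U3, T2) (U3, T1) (Idn U U3, t1) m2
         \<otimes>\<^bsub>FOb M (U3, T1)\<^esub> FArr M (U2, T1) (U3, T1) (u2, Idn T T1) m1,
       Cmp U U1 U2 U3 u2 u1))\<rparr>"

text \<open>
  \<open>(U, T) \<mapsto> C(T, U)\<close> and \<open>(u, t) \<mapsto> (m \<mapsto> u \<circ> m \<circ> t)\<close>; the restriction to full subcategories of \<open>C\<close>
  is given by the same data.
\<close>

definition hom_bifun :: "('o, 'm) acat \<Rightarrow> ('o \<times> 'o, 'm \<times> 'm, 'm monoid, 'm \<Rightarrow> 'm) fctr" where
  "hom_bifun C = \<lparr>FOb = (\<lambda>(U, T). Hom C T U),
    FArr = (\<lambda>(U, T) (U', T') (u, t). \<lambda>m\<in>arr C T U. Cmp C T' U U' u (Cmp C T' T U m t))\<rparr>"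

end

theory Submission
  imports Defs "HOL-Algebra.Weak_Morphisms"
begin

text \<open>
  Write \<open>L\<close> for \<open>C/I\<^sub>B \<otimes>\<^sub>C -\<close> and \<open>i\<close> for restriction along \<open>C \<rightarrow> C/I\<^sub>B\<close>; only the adjunction,
  the exactness of \<open>L\<close> and the description of the image of \<open>i\<close> matter, not the tensor product itself.
  Let \<open>f : B\<^sub>0 \<rightarrow> X\<close> be a right \<open>B\<close>-approximation and \<open>K\<close> the kernel of \<open>f\<^sup>* : C(X, -) \<rightarrow> C(B\<^sub>0, -)\<close>.
  Since \<open>L(C(B\<^sub>0, -)) = 0\<close>, exactness makes \<open>L(K) \<rightarrow> L(C(X, -))\<close> an epimorphism, so a map from
  \<open>C(X, -)\<close> to a module vanishing on \<open>B\<close> is zero once it vanishes on \<open>K\<close>.  Applied to the projection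
  onto \<open>C(X, -)/(K + I\<^sub>B(X, -))\<close> this puts \<open>1\<^sub>X\<close> into \<open>K + I\<^sub>B\<close>: there is \<open>e \<in> I\<^sub>B(X, X)\<close> with
  \<open>e f = f\<close>.  Then \<open>e\<close> fixes every morphism \<open>Y \<rightarrow> X\<close> with \<open>Y \<in> B\<close>, hence is idempotent, and splitting
  it yields \<open>X = T \<oplus> U\<close> with \<open>U \<in> B\<close> and \<open>T \<in> B\<^sup>\<bottom>\<close>.  As \<open>C(U, T) = 0\<close> for all such
  \<open>T\<close> and \<open>U\<close>, writing morphisms as matrices is the required equivalence.
\<close>

section \<open>Kernels and exact left adjoints\<close>

context preadditive
begin

lemma hom_add [intro, simp]:
  "\<lbrakk>X \<in> Ob C; Y \<in> Ob C; f \<in> arr C X Y; g \<in> arr C X Y\<rbrakk> \<Longrightarrow> f \<otimes>\<^bsub>Hom C X Y\<^esub> g \<in> arr C X Y"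
  using hom_group[of X Y] by (simp add: comm_group_def group_def monoid.m_closed)

lemma hom_zero [intro, simp]: "\<lbrakk>X \<in> Ob C; Y \<in> Ob C\<rbrakk> \<Longrightarrow> zero_arr C X Y \<in> arr C X Y"
  using hom_group[of X Y] by (simp add: comm_group_def group_def monoid.one_closed)

lemma hom_minus [intro, simp]:
  "\<lbrakk>X \<in> Ob C; Y \<in> Ob C; f \<in> arr C X Y\<rbrakk> \<Longrightarrow> inv\<^bsub>Hom C X Y\<^esub> f \<in> arr C X Y"
  using hom_group[of X Y] by (simp add: comm_group_def group.inv_closed)

lemma hom_zero_add [simp]:
  "\<lbrakk>X \<in> Ob C; Y \<in> Ob C; f \<in> arr C X Y\<rbrakk> \<Longrightarrow> zero_arr C X Y \<otimes>\<^bsub>Hom C X Y\<^esub> f = f"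
  "\<lbrakk>X \<in> Ob C; Y \<in> Ob C; f \<in> arr C X Y\<rbrakk> \<Longrightarrow> f \<otimes>\<^bsub>Hom C X Y\<^esub> zero_arr C X Y = f"
  using hom_group[of X Y] by (simp_all add: comm_group_def group_def monoid.l_one monoid.r_one)

lemma hom_minus_add [simp]:
  "\<lbrakk>X \<in> Ob C; Y \<in> Ob C; f \<in> arr C X Y\<rbrakk> \<Longrightarrow> inv\<^bsub>Hom C X Y\<^esub> f \<otimes>\<^bsub>Hom C X Y\<^esub> f = zero_arr C X Y"
  "\<lbrakk>X \<in> Ob C; Y \<in> Ob C; f \<in> arr C X Y\<rbrakk> \<Longrightarrow> f \<otimes>\<^bsub>Hom C X Y\<^esub> inv\<^bsub>Hom C X Y\<^esub> f = zero_arr C X Y"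
  using hom_group[of X Y] by (simp_all add: comm_group_def group.l_inv group.r_inv)

lemma hom_add_assoc:
  "\<lbrakk>X \<in> Ob C; Y \<in> Ob C; f \<in> arr C X Y; g \<in> arr C X Y; h \<in> arr C X Y\<rbrakk> \<Longrightarrow>
    (f \<otimes>\<^bsub>Hom C X Y\<^esub> g) \<otimes>\<^bsub>Hom C X Y\<^esub> h = f \<otimes>\<^bsub>Hom C X Y\<^esub> (g \<otimes>\<^bsub>Hom C X Y\<^esub> h)"
  using hom_group[of X Y] by (simp add: comm_group_def group_def monoid.m_assoc)

lemma hom_add_comm:
  "\<lbrakk>X \<in> Ob C; Y \<in> Ob C; f \<in> arr C X Y; g \<in> arr C X Y\<rbrakk> \<Longrightarrow>
    f \<otimes>\<^bsub>Hom C X Y\<^esub> g = g \<otimes>\<^bsub>Hom C X Y\<^esub> f"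
  using hom_group[of X Y] by (simp add: comm_group_def comm_monoid.m_comm)

lemma hom_add_lcomm:
  "\<lbrakk>X \<in> Ob C; Y \<in> Ob C; f \<in> arr C X Y; g \<in> arr C X Y; h \<in> arr C X Y\<rbrakk> \<Longrightarrow>
    f \<otimes>\<^bsub>Hom C X Y\<^esub> (g \<otimes>\<^bsub>Hom C X Y\<^esub> h) = g \<otimes>\<^bsub>Hom C X Y\<^esub> (f \<otimes>\<^bsub>Hom C X Y\<^esub> h)"
  using hom_group[of X Y] by (simp add: comm_group_def comm_monoid.m_lcomm)

lemmas hom_ac = hom_add_assoc hom_add_comm hom_add_lcomm

lemma hom_add_cancel:
  "\<lbrakk>X \<in> Ob C; Y \<in> Ob C; f \<in> arr C X Y; g \<in> arr C X Y; h \<in> arr C X Y;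
    f \<otimes>\<^bsub>Hom C X Y\<^esub> g = f \<otimes>\<^bsub>Hom C X Y\<^esub> h\<rbrakk> \<Longrightarrow> g = h"
  using hom_group[of X Y] by (metis comm_group_def group.is_monoid group.Units_eq monoid.Units_l_cancel)

declare id_arr [simp, intro] comp_arr [simp, intro] comp_id_right [simp] comp_id_left [simp]

lemma comp_zero_right [simp]:
  assumes "X \<in> Ob C" "Y \<in> Ob C" "Z \<in> Ob C" "g \<in> arr C Y Z"
  shows "Cmp C X Y Z g (zero_arr C X Y) = zero_arr C X Z"
proof -
  have "Cmp C X Y Z g (zero_arr C X Y) \<otimes>\<^bsub>Hom C X Z\<^esub> Cmp C X Y Z g (zero_arr C X Y)
      = Cmp C X Y Z g (zero_arr C X Y) \<otimes>\<^bsub>Hom C X Z\<^esub> zero_arr C X Z"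
    using comp_add_right[of X Y Z "zero_arr C X Y" "zero_arr C X Y" g] assms by simp
  then show ?thesis
    by (rule hom_add_cancel[rotated 5]) (use assms in auto)
qed

lemma comp_zero_left [simp]:
  assumes "X \<in> Ob C" "Y \<in> Ob C" "Z \<in> Ob C" "f \<in> arr C X Y"
  shows "Cmp C X Y Z (zero_arr C Y Z) f = zero_arr C X Z"
proof -
  have "Cmp C X Y Z (zero_arr C Y Z) f \<otimes>\<^bsub>Hom C X Z\<^esub> Cmp C X Y Z (zero_arr C Y Z) f
      = Cmp C X Y Z (zero_arr C Y Z) f \<otimes>\<^bsub>Hom C X Z\<^esub> zero_arr C X Z"
    using comp_add_left[of X Y Z f "zero_arr C Y Z" "zero_arr C Y Z"] assms by simp
  then show ?thesis
    by (rule hom_add_cancel[rotated 5]) (use assms in auto)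
qed

lemma comp_minus_left:
  assumes "X \<in> Ob C" "Y \<in> Ob C" "Z \<in> Ob C" "f \<in> arr C X Y" "g \<in> arr C Y Z"
  shows "Cmp C X Y Z (inv\<^bsub>Hom C Y Z\<^esub> g) f = inv\<^bsub>Hom C X Z\<^esub> Cmp C X Y Z g f"
proof (rule hom_add_cancel)
  show "Cmp C X Y Z g f \<otimes>\<^bsub>Hom C X Z\<^esub> Cmp C X Y Z (inv\<^bsub>Hom C Y Z\<^esub> g) f
    = Cmp C X Y Z g f \<otimes>\<^bsub>Hom C X Z\<^esub> inv\<^bsub>Hom C X Z\<^esub> Cmp C X Y Z g f"
    using assms by (simp flip: comp_add_left)
qed (use assms in auto)

lemma comp_minus_right:
  assumes "X \<in> Ob C" "Y \<in> Ob C" "Z \<in> Ob C" "f \<in> arr C X Y" "g \<in> arr C Y Z"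
  shows "Cmp C X Y Z g (inv\<^bsub>Hom C X Y\<^esub> f) = inv\<^bsub>Hom C X Z\<^esub> Cmp C X Y Z g f"
proof (rule hom_add_cancel)
  show "Cmp C X Y Z g f \<otimes>\<^bsub>Hom C X Z\<^esub> Cmp C X Y Z g (inv\<^bsub>Hom C X Y\<^esub> f)
    = Cmp C X Y Z g f \<otimes>\<^bsub>Hom C X Z\<^esub> inv\<^bsub>Hom C X Z\<^esub> Cmp C X Y Z g f"
    using assms by (simp flip: comp_add_right)
qed (use assms in auto)

text \<open>Together with \<open>is_zeroD\<close> this reduces being a zero object to one equation,
  which for modules can be read off pointwise.\<close>

lemma is_zeroI:
  assumes "X \<in> Ob C" "Idn C X = zero_arr C X X"
  shows "is_zero C X"
  unfolding is_zero_def
proof (intro conjI ballI assms(1))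
  fix Y assume Y: "Y \<in> Ob C"
  show "\<exists>!f. f \<in> arr C X Y"
  proof (rule ex1I[of _ "zero_arr C X Y"])
    show "f = zero_arr C X Y" if "f \<in> arr C X Y" for f
      using comp_id_right[of X Y f] that assms Y by simp
  qed (use assms Y in simp)
  show "\<exists>!f. f \<in> arr C Y X"
  proof (rule ex1I[of _ "zero_arr C Y X"])
    show "f = zero_arr C Y X" if "f \<in> arr C Y X" for f
      using comp_id_left[of Y X f] that assms Y by simp
  qed (use assms Y in simp)
qed

lemma is_zeroD:
  assumes "is_zero C X"
  shows "Idn C X = zero_arr C X X"
proof -
  have "X \<in> Ob C" "\<exists>!f. f \<in> arr C X X"
    using assms unfolding is_zero_def by simp_all
  with id_arr[of X] hom_zero[of X X] show ?thesis by auto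
qed

lemma isomorphic_refl: "X \<in> Ob C \<Longrightarrow> isomorphic C X X"
  unfolding isomorphic_def is_iso_def by (intro exI[of _ "Idn C X"] conjI bexI[of _ "Idn C X"]) simp_all

lemma is_iso_comp_left_cancel:
  assumes iso: "is_iso C Y Z g" and ob: "X \<in> Ob C" "Y \<in> Ob C" "Z \<in> Ob C"
    and f: "f \<in> arr C X Y" "f' \<in> arr C X Y"
    and eq: "Cmp C X Y Z g f = Cmp C X Y Z g f'"
  shows "f = f'"
proof -
  from iso obtain g' where g: "g \<in> arr C Y Z" and g': "g' \<in> arr C Z Y" "Cmp C Y Z Y g' g = Idn C Y"
    unfolding is_iso_def by (elim conjE bexE)
  have *: "Cmp C X Z Y g' (Cmp C X Y Z g h) = h" if "h \<in> arr C X Y" for h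
    by (subst comp_assoc[OF ob(1,2,3,2) that g g'(1)]) (simp add: g'(2) ob that)
  have "f = Cmp C X Z Y g' (Cmp C X Y Z g f)" using *[OF f(1)] by (rule sym)
  also have "\<dots> = f'" unfolding eq by (rule *[OF f(2)])
  finally show ?thesis .
qed

section \<open>Kernels, cokernels and images\<close>

text \<open>Uniqueness of lifts is traded for \<open>k\<close> being monic: a composite of
  \<open>k\<close> with any morphism is killed by \<open>f\<close>, so it has exactly one lift.
  Existence and uniqueness can then be handled separately, and the form dualises well.\<close>

lemma is_kernel_iff:
  "is_kernel C X Y f K k \<longleftrightarrow> X \<in> Ob C \<and> Y \<in> Ob C \<and> f \<in> arr C X Y \<and> K \<in> Ob C \<and> k \<in> arr C K X \<and>
     Cmp C K X Y f k = zero_arr C K Y \<and>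
     (\<forall>W \<in> Ob C. \<forall>h \<in> arr C W X. Cmp C W X Y f h = zero_arr C W Y \<longrightarrow>
        (\<exists>l \<in> arr C W K. Cmp C W K X k l = h)) \<and> is_mono C K X k"
proof
  assume k: "is_kernel C X Y f K k"
  have "is_mono C K X k"
    unfolding is_mono_def
  proof (intro conjI ballI impI)
    fix W g h assume *: "W \<in> Ob C" "g \<in> arr C W K" "h \<in> arr C W K" "Cmp C W K X k g = Cmp C W K X k h"
    have "Cmp C W X Y f (Cmp C W K X k h) = zero_arr C W Y"
      using k * comp_assoc[of W K X Y h k f] unfolding is_kernel_def by simp
    then have "\<exists>!l. l \<in> arr C W K \<and> Cmp C W K X k l = Cmp C W K X k h"
      using k * unfolding is_kernel_def by (metis comp_arr)
    then show "g = h" using * by metis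
  qed (use k in \<open>simp add: is_kernel_def\<close>)
  with k show "X \<in> Ob C \<and> Y \<in> Ob C \<and> f \<in> arr C X Y \<and> K \<in> Ob C \<and> k \<in> arr C K X \<and>
     Cmp C K X Y f k = zero_arr C K Y \<and>
     (\<forall>W \<in> Ob C. \<forall>h \<in> arr C W X. Cmp C W X Y f h = zero_arr C W Y \<longrightarrow>
        (\<exists>l \<in> arr C W K. Cmp C W K X k l = h)) \<and> is_mono C K X k"
    unfolding is_kernel_def by blast
next
  assume "X \<in> Ob C \<and> Y \<in> Ob C \<and> f \<in> arr C X Y \<and> K \<in> Ob C \<and> k \<in> arr C K X \<and>
     Cmp C K X Y f k = zero_arr C K Y \<and>
     (\<forall>W \<in> Ob C. \<forall>h \<in> arr C W X. Cmp C W X Y f h = zero_arr C W Y \<longrightarrow>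
        (\<exists>l \<in> arr C W K. Cmp C W K X k l = h)) \<and> is_mono C K X k"
  then show "is_kernel C X Y f K k"
    unfolding is_kernel_def is_mono_def by (metis (no_types, lifting))
qed

lemma is_epi_iff:
  "is_epi C X Y f \<longleftrightarrow> f \<in> arr C X Y \<and> (\<forall>W \<in> Ob C. \<forall>g \<in> arr C Y W. \<forall>h \<in> arr C Y W.
     Cmp C X Y W g f = Cmp C X Y W h f \<longrightarrow> g = h)"
  unfolding is_epi_def is_mono_def op_cat_def by simp

text \<open>Makes the facts about kernels available for cokernels.\<close>

lemma preadditive_op: "preadditive (op_cat C)"
  by (rule preadditive.intro)
    (auto simp: op_cat_def hom_group comp_add_left comp_add_right comp_assoc)

lemma is_cokernel_iff:
  "is_cokernel C X Y f Q q \<longleftrightarrow> X \<in> Ob C \<and> Y \<in> Ob C \<and> f \<in> arr C X Y \<and> Q \<in> Ob C \<and> q \<in> arr C Y Q \<and>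
     Cmp C X Y Q q f = zero_arr C X Q \<and>
     (\<forall>W \<in> Ob C. \<forall>h \<in> arr C Y W. Cmp C X Y W h f = zero_arr C X W \<longrightarrow>
        (\<exists>l \<in> arr C Q W. Cmp C Y Q W l q = h)) \<and> is_epi C Y Q q"
  unfolding is_cokernel_def preadditive.is_kernel_iff[OF preadditive_op] is_epi_def
  by (auto simp: op_cat_def)

text \<open>Since \<open>f\<close> kills its kernel, it factors through the cokernel
  \<open>q\<close> of \<open>k\<close>. Hence whatever \<open>q\<close> kills is killed by
  \<open>f\<close> and lifts to \<open>K\<close>.\<close>

lemma kernel_of_cokernel:
  assumes "is_kernel C X Y f K k" "is_cokernel C K X k Q q"
  shows "short_exact C K k X q Q"
proof -
  obtain m where m: "m \<in> arr C Q Y" "Cmp C X Q Y m q = f"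
    using assms unfolding is_kernel_iff is_cokernel_iff by blast
  have "\<exists>l \<in> arr C W K. Cmp C W K X k l = h"
    if h: "W \<in> Ob C" "h \<in> arr C W X" "Cmp C W X Q q h = zero_arr C W Q" for W h
  proof -
    have "Cmp C W X Y f h = Cmp C W Q Y m (Cmp C W X Q q h)"
      using m h assms comp_assoc[of W X Q Y h q m] unfolding is_kernel_iff is_cokernel_iff by simp
    then have "Cmp C W X Y f h = zero_arr C W Y"
      using m h assms unfolding is_kernel_iff is_cokernel_iff by simp
    then show ?thesis
      using h assms unfolding is_kernel_iff by blast
  qed
  then show ?thesis
    using assms unfolding short_exact_def is_kernel_iff is_cokernel_iff by blast
qed

text \<open>The definition of \<open>abelian_cat\<close> makes monos kernels and epis cokernels, but
  that the induced morphism \<open>m\<close> out of the coimage is monic has to be derived. It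
  suffices that \<open>m\<close> kills only zero morphisms \<open>t\<close>; the cokernel
  \<open>s\<close> of such a \<open>t\<close> is shown to be a split mono.\<close>

lemma abelian_image_mono:
  assumes "abelian_cat C"
    and k: "is_kernel C X Y f K k" and q: "is_cokernel C K X k Q q"
    and m: "m \<in> arr C Q Y" "Cmp C X Q Y m q = f"
  shows "is_mono C Q Y m"
proof -
  have ob: "X \<in> Ob C" "Y \<in> Ob C" "K \<in> Ob C" "Q \<in> Ob C" and ar: "f \<in> arr C X Y" "k \<in> arr C K X" "q \<in> arr C X Q"
    using k q unfolding is_kernel_iff is_cokernel_iff by auto
  have zero: "t = zero_arr C W Q"
    if t: "W \<in> Ob C" "t \<in> arr C W Q" "Cmp C W Q Y m t = zero_arr C W Y" for W t
  proof -
    obtain S s where s: "is_cokernel C W Q t S s"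
      using assms(1) t ob unfolding abelian_cat_def by blast
    then have s_ar: "S \<in> Ob C" "s \<in> arr C Q S" unfolding is_cokernel_iff by auto
    obtain m' where m': "m' \<in> arr C S Y" "Cmp C Q S Y m' s = m"
      using s t m ob unfolding is_cokernel_iff by blast
    have epi_q: "is_epi C X Q q" and epi_s: "is_epi C Q S s"
      using q s unfolding is_cokernel_iff by auto
    have "is_epi C X S (Cmp C X Q S s q)"
      unfolding is_epi_iff
    proof (intro conjI ballI impI)
      fix V g h assume gh: "V \<in> Ob C" "g \<in> arr C S V" "h \<in> arr C S V"
        "Cmp C X S V g (Cmp C X Q S s q) = Cmp C X S V h (Cmp C X Q S s q)"
      then have "Cmp C X Q V (Cmp C Q S V g s) q = Cmp C X Q V (Cmp C Q S V h s) q"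
        using ob s_ar ar by (simp add: comp_assoc)
      then have "Cmp C Q S V g s = Cmp C Q S V h s"
        using epi_q gh ob s_ar unfolding is_epi_iff by (meson comp_arr)
      then show "g = h" using epi_s gh unfolding is_epi_iff by blast
    qed (use ob ar s_ar in auto)
    then obtain V w where w: "is_cokernel C V X w S (Cmp C X Q S s q)"
      using assms(1) ob ar s_ar unfolding abelian_cat_def by (meson comp_arr)
    then have w_ar: "V \<in> Ob C" "w \<in> arr C V X" unfolding is_cokernel_iff by auto
    \<comment> \<open>As \<open>f\<close> factors through \<open>s\<close> after \<open>q\<close>,
      it kills \<open>w\<close>. So \<open>w\<close> factors through \<open>K\<close> and
      \<open>q\<close> kills it as well, which makes \<open>q\<close> factor through
      \<open>s\<close> after \<open>q\<close>.\<close>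
    have "Cmp C V X Y f w = Cmp C V S Y m' (Cmp C V X S (Cmp C X Q S s q) w)"
    proof -
      have "f = Cmp C X S Y m' (Cmp C X Q S s q)"
        using m m' ob ar s_ar by (simp add: comp_assoc)
      then show ?thesis using ob ar s_ar w_ar m' comp_assoc[of V X S Y w "Cmp C X Q S s q" m'] by simp
    qed
    also have "\<dots> = zero_arr C V Y"
      using w m' ob s_ar unfolding is_cokernel_iff by simp
    finally obtain w' where w': "w' \<in> arr C V K" "Cmp C V K X k w' = w"
      using k w_ar unfolding is_kernel_iff by blast
    have "Cmp C V X Q q w = Cmp C V K Q (Cmp C K X Q q k) w'"
      using w' ob ar w_ar by (auto simp: comp_assoc)
    also have "\<dots> = zero_arr C V Q"
      using q w' w_ar unfolding is_cokernel_iff by simp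
    finally obtain r where r: "r \<in> arr C S Q" "Cmp C X S Q r (Cmp C X Q S s q) = q"
      using w ob ar unfolding is_cokernel_iff by blast
    then have "Cmp C X Q Q (Cmp C Q S Q r s) q = Cmp C X Q Q (Idn C Q) q"
      using ob ar s_ar by (simp add: comp_assoc)
    then have rs: "Cmp C Q S Q r s = Idn C Q"
      using epi_q ob r s_ar unfolding is_epi_iff by (meson comp_arr id_arr)
    \<comment> \<open>Now \<open>s\<close> has the left inverse \<open>r\<close> but kills
      \<open>t\<close>, so \<open>t\<close> is zero.\<close>
    have "t = Cmp C W Q Q (Cmp C Q S Q r s) t" using rs t ob by simp
    also have "\<dots> = Cmp C W S Q r (Cmp C W Q S s t)" using r s_ar t ob by (simp add: comp_assoc)
    also have "\<dots> = zero_arr C W Q" using s r t ob unfolding is_cokernel_iff by simp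
    finally show ?thesis .
  qed
  show ?thesis
    unfolding is_mono_def
  proof (intro conjI ballI impI m(1))
    fix W g h assume gh: "W \<in> Ob C" "g \<in> arr C W Q" "h \<in> arr C W Q"
      "Cmp C W Q Y m g = Cmp C W Q Y m h"
    then have "Cmp C W Q Y m (inv\<^bsub>Hom C W Q\<^esub> h \<otimes>\<^bsub>Hom C W Q\<^esub> g) = zero_arr C W Y"
      using ob m by (simp add: comp_add_right comp_minus_right)
    then have "inv\<^bsub>Hom C W Q\<^esub> h \<otimes>\<^bsub>Hom C W Q\<^esub> g = inv\<^bsub>Hom C W Q\<^esub> h \<otimes>\<^bsub>Hom C W Q\<^esub> h"
      using zero[of W "inv\<^bsub>Hom C W Q\<^esub> h \<otimes>\<^bsub>Hom C W Q\<^esub> g"] gh ob by simp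
    then show "g = h"
      by (rule hom_add_cancel[rotated 5]) (use gh ob in auto)
  qed
qed

end

text \<open>By adjunction \<open>L\<close> sends \<open>P'\<close> to zero. The image
  \<open>M\<close> of \<open>f\<close> is a subobject of \<open>P'\<close>, so exactness gives
  \<open>L M = 0\<close>, and applying \<open>L\<close> to \<open>K\<close>, \<open>P\<close>,
  \<open>M\<close> shows that \<open>L k\<close> is epi. The transpose of \<open>q\<close> vanishes
  on \<open>L k\<close>, hence is zero.\<close>

lemma exact_left_adjoint_kernel:
  assumes ab: "abelian_cat A" and L: "exact_functor A Q L" and R: "cat_functor Q A R"
    and adj: "adjoint A Q L R"
    and P': "P' \<in> Ob A" "\<And>N h. N \<in> Ob Q \<Longrightarrow> h \<in> arr A P' (FOb R N) \<Longrightarrow> h = zero_arr A P' (FOb R N)"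
    and k: "is_kernel A P P' f K k"
    and q: "N \<in> Ob Q" "q \<in> arr A P (FOb R N)" "Cmp A K P (FOb R N) q k = zero_arr A K (FOb R N)"
  shows "q = zero_arr A P (FOb R N)"
proof -
  interpret L: additive_functor A Q L using L unfolding exact_functor_def by blast
  interpret R: cat_functor Q A R by (rule R)
  obtain \<phi> where \<phi>: "(\<forall>X \<in> Ob A. \<forall>Y \<in> Ob Q. bij_betw (\<phi> X Y) (arr Q (FOb L X) Y) (arr A X (FOb R Y))) \<and>
        (\<forall>X \<in> Ob A. \<forall>X' \<in> Ob A. \<forall>Y \<in> Ob Q. \<forall>Y' \<in> Ob Q.
           \<forall>h \<in> arr A X' X. \<forall>f \<in> arr Q (FOb L X) Y. \<forall>g \<in> arr Q Y Y'.
             \<phi> X' Y' (Cmp Q (FOb L X') Y Y' g (Cmp Q (FOb L X') (FOb L X) Y f (FArr L X' X h)))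
               = Cmp A X' (FOb R Y) (FOb R Y') (FArr R Y Y' g) (Cmp A X' X (FOb R Y) (\<phi> X Y f) h))"
    using adj unfolding adjoint_def by (rule exE)
  note bij = \<phi>[THEN conjunct1, rule_format] and natr = \<phi>[THEN conjunct2, rule_format]
  have \<phi>_arr: "\<phi> X Y g \<in> arr A X (FOb R Y)" if "X \<in> Ob A" "Y \<in> Ob Q" "g \<in> arr Q (FOb L X) Y" for X Y g
    using bij[OF that(1,2)] that(3) by (rule bij_betwE[rule_format])
  have \<phi>_inj: "g = h" if "X \<in> Ob A" "Y \<in> Ob Q" "g \<in> arr Q (FOb L X) Y" "h \<in> arr Q (FOb L X) Y"
    "\<phi> X Y g = \<phi> X Y h" for X Y g h
    using bij[OF that(1,2)] that(3-5) unfolding bij_betw_def by (blast dest: inj_onD)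
  have \<phi>_comp: "\<phi> X' Y (Cmp Q (FOb L X') (FOb L X) Y g (FArr L X' X h)) = Cmp A X' X (FOb R Y) (\<phi> X Y g) h"
    if "X \<in> Ob A" "X' \<in> Ob A" "Y \<in> Ob Q" "h \<in> arr A X' X" "g \<in> arr Q (FOb L X) Y" for X X' Y g h
    using natr[of X X' Y Y h g "Idn Q Y"] that
    by (simp add: R.map_id L.map_ob L.map_arr R.map_ob \<phi>_arr)
  have \<phi>_zero: "\<phi> X Y (zero_arr Q (FOb L X) Y) = zero_arr A X (FOb R Y)" if "X \<in> Ob A" "Y \<in> Ob Q" for X Y
    using \<phi>_comp[of X X Y "zero_arr A X X" "zero_arr Q (FOb L X) Y"] that
    by (simp add: L.map_ob L.map_arr R.map_ob \<phi>_arr)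
  \<comment> \<open>The identity and the zero endomorphism of \<open>L P'\<close> both transpose to
    morphisms from \<open>P'\<close> to an object in the image of \<open>R\<close>, and these are
    all zero.\<close>
  have LP': "Idn Q (FOb L P') = zero_arr Q (FOb L P') (FOb L P')"
    by (rule \<phi>_inj[of P']) (use P' in \<open>auto simp: L.map_ob \<phi>_arr \<phi>_zero\<close>)
  have ob: "P \<in> Ob A" "K \<in> Ob A" "f \<in> arr A P P'" "k \<in> arr A K P"
    using k unfolding L.dom.is_kernel_iff by auto
  \<comment> \<open>\<open>M\<close> is the image of \<open>f\<close>, built as the cokernel of its
    kernel.\<close>
  obtain M p where p: "is_cokernel A K P k M p"
    using ab ob unfolding abelian_cat_def by blast
  then have M: "M \<in> Ob A" "p \<in> arr A P M" unfolding L.dom.is_cokernel_iff by auto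
  obtain m where m: "m \<in> arr A M P'" "Cmp A P M P' m p = f"
    using p k P'(1) unfolding L.dom.is_cokernel_iff L.dom.is_kernel_iff by blast
  have "is_mono A M P' m" by (rule L.dom.abelian_image_mono[OF ab k p m])
  then obtain Z z where "is_kernel A P' Z z M m"
    using ab M P' m unfolding abelian_cat_def by blast
  moreover obtain Z' z' where "is_cokernel A M P' m Z' z'"
    using ab M P' m unfolding abelian_cat_def by blast
  \<comment> \<open>The sequence is completed on the right because \<open>exact_functor\<close>
    speaks only of short exact sequences; its conclusion is needed to see that \<open>L m\<close> is
    monic.\<close>
  ultimately have "short_exact A M m P' z' Z'" by (rule L.dom.kernel_of_cokernel)
  then have "short_exact Q (FOb L M) (FArr L M P' m) (FOb L P') (FArr L P' Z' z') (FOb L Z')"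
    using L unfolding exact_functor_def by blast
  then have mono: "is_mono Q (FOb L M) (FOb L P') (FArr L M P' m)"
    unfolding short_exact_def L.cod.is_kernel_iff by blast
  have "FArr L M P' m = Cmp Q (FOb L M) (FOb L P') (FOb L P') (Idn Q (FOb L P')) (FArr L M P' m)"
    using M P' m by (simp add: L.map_ob L.map_arr)
  also have "\<dots> = zero_arr Q (FOb L M) (FOb L P')"
    unfolding LP' using M P' m by (simp add: L.map_ob L.map_arr)
  finally have Lm: "FArr L M P' m = zero_arr Q (FOb L M) (FOb L P')" .
  have "Cmp Q (FOb L M) (FOb L M) (FOb L P') (FArr L M P' m) (Idn Q (FOb L M))
    = Cmp Q (FOb L M) (FOb L M) (FOb L P') (FArr L M P' m) (zero_arr Q (FOb L M) (FOb L M))"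
    unfolding Lm using M P' by (simp add: L.map_ob)
  \<comment> \<open>\<open>L m\<close> is both monic and zero, so its source is zero.\<close>
  then have LM: "Idn Q (FOb L M) = zero_arr Q (FOb L M) (FOb L M)"
    using mono L.map_ob[OF M(1)] unfolding is_mono_def by (meson L.cod.id_arr L.cod.hom_zero)
  have "short_exact A K k P p M" by (rule L.dom.kernel_of_cokernel[OF k p])
  then have "short_exact Q (FOb L K) (FArr L K P k) (FOb L P) (FArr L P M p) (FOb L M)"
    using L unfolding exact_functor_def by blast
  then have coker: "is_cokernel Q (FOb L K) (FOb L P) (FArr L K P k) (FOb L M) (FArr L P M p)"
    unfolding short_exact_def by blast
  \<comment> \<open>\<open>g\<close> is the transpose of \<open>q\<close>. It kills
    \<open>L k\<close>, so it factors through the cokernel \<open>L M\<close>, which is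
    zero.\<close>
  obtain g where g: "g \<in> arr Q (FOb L P) N" "\<phi> P N g = q"
    using bij_betw_imp_surj_on[OF bij[OF ob(1) q(1)]] q(2) by (metis imageE)
  have "Cmp Q (FOb L K) (FOb L P) N g (FArr L K P k) = zero_arr Q (FOb L K) N"
    by (rule \<phi>_inj[of K]) (use ob q g in \<open>auto simp: L.map_ob L.map_arr \<phi>_comp \<phi>_zero\<close>)
  then obtain l where l: "l \<in> arr Q (FOb L M) N" "Cmp Q (FOb L P) (FOb L M) N l (FArr L P M p) = g"
    using coker q g unfolding L.cod.is_cokernel_iff by blast
  have "l = Cmp Q (FOb L M) (FOb L M) N l (Idn Q (FOb L M))"
    using l M q by (simp add: L.map_ob)
  also have "\<dots> = zero_arr Q (FOb L M) N"
    unfolding LM using l M q by (simp add: L.map_ob)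
  finally have "g = zero_arr Q (FOb L P) N"
    using l M ob q by (auto simp: L.map_ob L.map_arr)
  then show ?thesis using g ob q by (auto simp: \<phi>_zero)
qed

section \<open>Modules presented by congruences\<close>

lemma Ab_cat_simps [simp]:
  "G \<in> Ob Ab_cat \<longleftrightarrow> comm_group G"
  "h \<in> arr Ab_cat G H \<longleftrightarrow> h \<in> hom G H \<and> h \<in> extensional (carrier G)"
  "h \<otimes>\<^bsub>Hom Ab_cat G H\<^esub> k = (\<lambda>x\<in>carrier G. h x \<otimes>\<^bsub>H\<^esub> k x)"
  "zero_arr Ab_cat G H = (\<lambda>x\<in>carrier G. \<one>\<^bsub>H\<^esub>)"
  "Idn Ab_cat G = (\<lambda>x\<in>carrier G. x)"
  "Cmp Ab_cat G H K k h = compose (carrier G) k h"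
  by (simp_all add: Ab_cat_def)

lemma Ab_Hom_comm_group:
  assumes "comm_group G" "comm_group H"
  shows "comm_group (Hom Ab_cat G H)"
proof -
  interpret G: comm_group G by fact
  interpret H: comm_group H by fact
  show ?thesis
  proof (rule comm_groupI)
    fix h assume h: "h \<in> arr Ab_cat G H"
    let ?k = "\<lambda>x\<in>carrier G. inv\<^bsub>H\<^esub> h x"
    have "?k \<in> arr Ab_cat G H"
      using h by (auto simp: hom_def Pi_iff H.inv_mult)
    moreover have "?k \<otimes>\<^bsub>Hom Ab_cat G H\<^esub> h = \<one>\<^bsub>Hom Ab_cat G H\<^esub>"
      using h by (auto simp: hom_def Pi_iff intro!: restrict_ext)
    ultimately show "\<exists>k\<in>arr Ab_cat G H. k \<otimes>\<^bsub>Hom Ab_cat G H\<^esub> h = \<one>\<^bsub>Hom Ab_cat G H\<^esub>"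
      by blast
  next
    fix h k l
    assume "h \<in> arr Ab_cat G H" "k \<in> arr Ab_cat G H" "l \<in> arr Ab_cat G H"
    then show "h \<otimes>\<^bsub>Hom Ab_cat G H\<^esub> k \<otimes>\<^bsub>Hom Ab_cat G H\<^esub> l
      = h \<otimes>\<^bsub>Hom Ab_cat G H\<^esub> (k \<otimes>\<^bsub>Hom Ab_cat G H\<^esub> l)"
      by (auto simp: hom_def Pi_iff H.m_assoc intro!: restrict_ext)
  next
    fix h k
    assume "h \<in> arr Ab_cat G H" "k \<in> arr Ab_cat G H"
    then show "h \<otimes>\<^bsub>Hom Ab_cat G H\<^esub> k = k \<otimes>\<^bsub>Hom Ab_cat G H\<^esub> h"
      by (auto simp: hom_def Pi_iff H.m_comm intro!: restrict_ext)
  next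
    fix h k
    assume "h \<in> arr Ab_cat G H" "k \<in> arr Ab_cat G H"
    then show "h \<otimes>\<^bsub>Hom Ab_cat G H\<^esub> k \<in> arr Ab_cat G H"
      by (auto simp: hom_def Pi_iff H.m_ac)
  next
    fix h
    assume h: "h \<in> arr Ab_cat G H"
    have "(\<one>\<^bsub>Hom Ab_cat G H\<^esub> \<otimes>\<^bsub>Hom Ab_cat G H\<^esub> h) x = h x" for x
      using h by (auto simp: hom_def Pi_iff extensional_def restrict_def)
    then show "\<one>\<^bsub>Hom Ab_cat G H\<^esub> \<otimes>\<^bsub>Hom Ab_cat G H\<^esub> h = h" ..
  qed (auto simp: hom_def)
qed

lemma preadditive_Ab_cat: "preadditive Ab_cat"
proof (rule preadditive.intro)
  fix G H :: "'a monoid" assume "G \<in> Ob Ab_cat" "H \<in> Ob Ab_cat"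
  then show "comm_group (Hom Ab_cat G H)" by (simp add: Ab_Hom_comm_group)
next
  fix G H K :: "'a monoid" and h k
  assume "G \<in> Ob Ab_cat" "h \<in> arr Ab_cat G H" "k \<in> arr Ab_cat H K"
  then show "Cmp Ab_cat G H K k h \<in> arr Ab_cat G K"
    by (auto simp: hom_def Pi_iff compose_def comm_group_def comm_monoid_def monoid.m_closed)
next
  fix G H :: "'a monoid" and h
  assume h: "h \<in> arr Ab_cat G H"
  show "Cmp Ab_cat G G H h (Idn Ab_cat G) = h"
    by (rule ext) (use h in \<open>auto simp: compose_def restrict_def extensional_def\<close>)
  show "Cmp Ab_cat G H H (Idn Ab_cat H) h = h"
    by (rule ext) (use h in \<open>auto simp: compose_def restrict_def extensional_def hom_def Pi_iff\<close>)
qed (auto simp: compose_def hom_def Pi_iff comm_group_def comm_monoid_def monoid.m_closed intro!: restrict_ext)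

lemma compose_eq_iff: "compose U h k = compose U h' k' \<longleftrightarrow> (\<forall>u\<in>U. h (k u) = h' (k' u))"
  by (auto simp: compose_def restrict_def fun_eq_iff)

lemma arr_mod_cat_iff:
  "\<eta> \<in> arr (mod_cat C) F G \<longleftrightarrow> \<eta> \<in> extensional (Ob C) \<and>
     (\<forall>X \<in> Ob C. \<eta> X \<in> hom (FOb F X) (FOb G X) \<and> \<eta> X \<in> extensional (carrier (FOb F X))) \<and>
     (\<forall>X \<in> Ob C. \<forall>Y \<in> Ob C. \<forall>f \<in> arr C X Y. \<forall>u \<in> carrier (FOb F X).
        \<eta> Y (FArr F X Y f u) = FArr G X Y f (\<eta> X u))"
  by (simp add: mod_cat_def fun_cat_def nat_trans_def compose_eq_iff)

lemma mod_cat_simps: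
  "F \<in> Ob (mod_cat C) \<longleftrightarrow> additive_functor C Ab_cat F"
  "zero_arr (mod_cat C) F G = (\<lambda>X\<in>Ob C. \<lambda>u\<in>carrier (FOb F X). \<one>\<^bsub>FOb G X\<^esub>)"
  "Idn (mod_cat C) F = (\<lambda>X\<in>Ob C. \<lambda>u\<in>carrier (FOb F X). u)"
  "Cmp (mod_cat C) F G H \<theta> \<eta> = (\<lambda>X\<in>Ob C. \<lambda>u\<in>carrier (FOb F X). \<theta> X (\<eta> X u))"
  by (simp_all add: mod_cat_def fun_cat_def compose_def)

text \<open>
  The quotient of \<open>C(A, -)\<close> by the congruence \<open>r X x = r X y\<close>.  Its elements are the values of \<open>r\<close>,
  so that they can be chosen in \<open>'u\<close>.
\<close>

definition hom_quot :: "('o, 'm) acat \<Rightarrow> 'o \<Rightarrow> ('o \<Rightarrow> 'm \<Rightarrow> 'u) \<Rightarrow> ('o, 'm, 'u) modl" where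
  "hom_quot C A r = \<lparr>FOb = (\<lambda>X. image_group (r X) (Hom C A X)),
    FArr = (\<lambda>X Y f. \<lambda>u\<in>r X ` arr C A X. r Y (Cmp C A X Y f (inv_into (arr C A X) (r X) u)))\<rparr>"

text \<open>Only the fibres of \<open>r X\<close> carry information: they must be compatible with
  addition and with postcomposition. An injective \<open>r\<close> produces a copy of the
  representable functor itself, with elements in \<open>'u\<close>.\<close>

locale hom_congruence = preadditive C for C :: "('o, 'm) acat" +
  fixes A :: 'o and r :: "'o \<Rightarrow> 'm \<Rightarrow> 'u"
  assumes A_ob [simp]: "A \<in> Ob C"
    and cong_add: "\<lbrakk>X \<in> Ob C; x \<in> arr C A X; x' \<in> arr C A X; y \<in> arr C A X; y' \<in> arr C A X;
      r X x = r X x'; r X y = r X y'\<rbrakk> \<Longrightarrow> r X (x \<otimes>\<^bsub>Hom C A X\<^esub> y) = r X (x' \<otimes>\<^bsub>Hom C A X\<^esub> y')"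
    and cong_comp: "\<lbrakk>X \<in> Ob C; Y \<in> Ob C; f \<in> arr C X Y; x \<in> arr C A X; x' \<in> arr C A X; r X x = r X x'\<rbrakk>
      \<Longrightarrow> r Y (Cmp C A X Y f x) = r Y (Cmp C A X Y f x')"
begin

lemma rep: "x \<in> arr C A X \<Longrightarrow> inv_into (arr C A X) (r X) (r X x) \<in> arr C A X"
  "x \<in> arr C A X \<Longrightarrow> r X (inv_into (arr C A X) (r X) (r X x)) = r X x"
  by (auto intro: inv_into_into f_inv_into_f)

lemma carrier_hom_quot: "carrier (FOb (hom_quot C A r) X) = r X ` arr C A X"
  by (simp add: hom_quot_def image_group_def)

lemma one_hom_quot: "\<one>\<^bsub>FOb (hom_quot C A r) X\<^esub> = r X (zero_arr C A X)"
  by (simp add: hom_quot_def image_group_def)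

lemma mult_hom_quot:
  "\<lbrakk>X \<in> Ob C; x \<in> arr C A X; y \<in> arr C A X\<rbrakk> \<Longrightarrow>
    r X x \<otimes>\<^bsub>FOb (hom_quot C A r) X\<^esub> r X y = r X (x \<otimes>\<^bsub>Hom C A X\<^esub> y)"
  by (simp add: hom_quot_def image_group_def) (intro cong_add rep; assumption)

lemma FArr_hom_quot:
  "\<lbrakk>X \<in> Ob C; Y \<in> Ob C; f \<in> arr C X Y; x \<in> arr C A X\<rbrakk> \<Longrightarrow>
    FArr (hom_quot C A r) X Y f (r X x) = r Y (Cmp C A X Y f x)"
  by (simp add: hom_quot_def) (intro cong_comp rep; assumption)

lemma FArr_hom_quot_ext: "FArr (hom_quot C A r) X Y f \<in> extensional (r X ` arr C A X)"
  by (simp add: hom_quot_def)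

lemma comm_group_hom_quot:
  assumes "X \<in> Ob C"
  shows "comm_group (FOb (hom_quot C A r) X)"
proof (rule comm_groupI; (unfold carrier_hom_quot one_hom_quot)?)
  fix u assume "u \<in> r X ` arr C A X"
  then obtain x where x: "u = r X x" "x \<in> arr C A X" by blast
  show "\<exists>v \<in> r X ` arr C A X. v \<otimes>\<^bsub>FOb (hom_quot C A r) X\<^esub> u = r X (zero_arr C A X)"
    by (rule bexI[of _ "r X (inv\<^bsub>Hom C A X\<^esub> x)"]) (use x assms in \<open>auto simp: mult_hom_quot\<close>)
qed (use assms in \<open>auto simp: mult_hom_quot hom_ac\<close>)

text \<open>The values of the functor on morphisms are extensional, so every law needs checking only
  on elements \<open>r X x\<close>, where it reduces to a law of composition.\<close>

lemma hom_quot_additive: "additive_functor C Ab_cat (hom_quot C A r)"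
proof -
  let ?M = "hom_quot C A r"
  have hom: "FArr ?M X Y f \<in> arr Ab_cat (FOb ?M X) (FOb ?M Y)"
    if "X \<in> Ob C" "Y \<in> Ob C" "f \<in> arr C X Y" for X Y f
    using that FArr_hom_quot_ext
    by (auto simp: hom_def carrier_hom_quot FArr_hom_quot mult_hom_quot comp_add_right)
  show ?thesis
  proof (intro additive_functor.intro cat_functor.intro cat_functor_axioms.intro
      additive_functor_axioms.intro preadditive_Ab_cat preadditive_axioms)
    fix X assume X: "X \<in> Ob C"
    then show "FOb ?M X \<in> Ob Ab_cat" by (simp add: comm_group_hom_quot)
    show "FArr ?M X X (Idn C X) = Idn Ab_cat (FOb ?M X)"
      by (rule extensionalityI[OF FArr_hom_quot_ext])
        (use X in \<open>auto simp: carrier_hom_quot FArr_hom_quot\<close>)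
  next
    fix X Y f assume "X \<in> Ob C" "Y \<in> Ob C" "f \<in> arr C X Y"
    then show "FArr ?M X Y f \<in> arr Ab_cat (FOb ?M X) (FOb ?M Y)" by (rule hom)
  next
    fix X Y Z f g assume *: "X \<in> Ob C" "Y \<in> Ob C" "Z \<in> Ob C" "f \<in> arr C X Y" "g \<in> arr C Y Z"
    show "FArr ?M X Z (Cmp C X Y Z g f)
      = Cmp Ab_cat (FOb ?M X) (FOb ?M Y) (FOb ?M Z) (FArr ?M Y Z g) (FArr ?M X Y f)"
      by (rule extensionalityI[OF FArr_hom_quot_ext])
        (use * in \<open>auto simp: carrier_hom_quot FArr_hom_quot compose_def comp_assoc\<close>)
  next
    fix X Y assume *: "X \<in> Ob C" "Y \<in> Ob C"
    show "FArr ?M X Y \<in> hom (Hom C X Y) (Hom Ab_cat (FOb ?M X) (FOb ?M Y))"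
    proof (rule homI)
      fix f g assume fg: "f \<in> arr C X Y" "g \<in> arr C X Y"
      show "FArr ?M X Y (f \<otimes>\<^bsub>Hom C X Y\<^esub> g)
        = FArr ?M X Y f \<otimes>\<^bsub>Hom Ab_cat (FOb ?M X) (FOb ?M Y)\<^esub> FArr ?M X Y g"
        by (rule extensionalityI[OF FArr_hom_quot_ext])
          (use * fg in \<open>auto simp: carrier_hom_quot FArr_hom_quot mult_hom_quot comp_add_left\<close>)
    qed (use * in \<open>rule hom\<close>)
  qed
qed

text \<open>The Yoneda morphism of \<open>a\<close>, passed to the quotients. The hypothesis
  \<open>cong\<close> says exactly that the value does not depend on the representative that
  \<open>inv_into\<close> picks.\<close>

lemma precompose_hom_quot:
  assumes "hom_congruence C A' r'" and a: "a \<in> arr C A' A"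
    and cong: "\<And>X x y. \<lbrakk>X \<in> Ob C; x \<in> arr C A X; y \<in> arr C A X; r X x = r X y\<rbrakk> \<Longrightarrow>
      r' X (Cmp C A' A X x a) = r' X (Cmp C A' A X y a)"
  obtains \<eta> where "\<eta> \<in> arr (mod_cat C) (hom_quot C A r) (hom_quot C A' r')"
    "\<And>X x. \<lbrakk>X \<in> Ob C; x \<in> arr C A X\<rbrakk> \<Longrightarrow> \<eta> X (r X x) = r' X (Cmp C A' A X x a)"
proof -
  interpret A': hom_congruence C A' r' by fact
  define \<eta> where "\<eta> = (\<lambda>X\<in>Ob C. \<lambda>u\<in>r X ` arr C A X. r' X (Cmp C A' A X (inv_into (arr C A X) (r X) u) a))"
  have \<eta>: "\<eta> X (r X x) = r' X (Cmp C A' A X x a)" if "X \<in> Ob C" "x \<in> arr C A X" for X x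
    using that unfolding \<eta>_def by simp (intro cong rep; assumption)
  have "\<eta> \<in> arr (mod_cat C) (hom_quot C A r) (hom_quot C A' r')"
    unfolding arr_mod_cat_iff
  proof (intro conjI ballI)
    show "\<eta> \<in> extensional (Ob C)" by (simp add: \<eta>_def)
  next
    fix X assume X: "X \<in> Ob C"
    show "\<eta> X \<in> hom (FOb (hom_quot C A r) X) (FOb (hom_quot C A' r') X)"
      using X a by (auto simp: hom_def \<eta> carrier_hom_quot A'.carrier_hom_quot mult_hom_quot
          A'.mult_hom_quot comp_add_left)
    show "\<eta> X \<in> extensional (carrier (FOb (hom_quot C A r) X))"
      using X by (simp add: \<eta>_def carrier_hom_quot)
  next
    fix X Y f u
    assume *: "X \<in> Ob C" "Y \<in> Ob C" "f \<in> arr C X Y" "u \<in> carrier (FOb (hom_quot C A r) X)"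
    then obtain x where "u = r X x" "x \<in> arr C A X" by (auto simp: carrier_hom_quot)
    then show "\<eta> Y (FArr (hom_quot C A r) X Y f u) = FArr (hom_quot C A' r') X Y f (\<eta> X u)"
      using * a by (simp add: \<eta> FArr_hom_quot A'.FArr_hom_quot comp_assoc)
  qed
  then show ?thesis using \<eta> that by blast
qed

end

section \<open>Embedding Hom groups into the universe\<close>

text \<open>An element of \<open>S\<close> is sent to the code of its indicator function, with
  \<open>undefined\<close> and some other value \<open>a\<close> of \<open>'u\<close> in the roles
  of 0 and 1.\<close>

lemma small_set_inj:
  fixes S :: "'a set"
  assumes "small_set TYPE('u) S" "infinite (UNIV :: 'u set)"
  shows "\<exists>e :: 'a \<Rightarrow> 'u. inj_on e S"
proof -
  obtain e :: "('a \<Rightarrow> 'u) \<Rightarrow> 'u" where e: "inj_on e (S \<rightarrow>\<^sub>E UNIV)"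
    using assms(1) unfolding small_set_def by blast
  have "infinite (UNIV - {undefined :: 'u})" using assms(2) by simp
  then obtain a where a: "a \<noteq> (undefined :: 'u)"
    using infinite_imp_nonempty by blast
  have "inj_on (\<lambda>x. e (\<lambda>y\<in>S. if y = x then a else undefined)) S"
  proof (rule inj_onI)
    fix x x' assume x: "x \<in> S" "x' \<in> S"
      and eq: "e (\<lambda>y\<in>S. if y = x then a else undefined) = e (\<lambda>y\<in>S. if y = x' then a else undefined)"
    have "(\<lambda>y\<in>S. if y = x then a else undefined) = (\<lambda>y\<in>S. if y = x' then a else undefined)"
      by (rule inj_onD[OF e, OF eq]) auto
    from fun_cong[OF this, of x] show "x = x'" using x a by (auto split: if_splits)
  qed
  then show ?thesis by blast
qed

text \<open>Conjugation with isomorphisms to representatives \<open>X'\<close> and \<open>Y'\<close>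
  carries \<open>arr C X Y\<close> injectively into \<open>arr C X' Y'\<close>, whose morphisms
  belong to the small set of triples.\<close>

lemma skeletally_small_inj:
  assumes "preadditive C" "skeletally_small TYPE('u) C" and XY: "X \<in> Ob C" "Y \<in> Ob C"
  shows "\<exists>e :: 'm \<Rightarrow> 'u. inj_on e (arr (C :: ('o, 'm) acat) X Y)"
proof -
  interpret preadditive C by fact
  from assms(2) have inf: "infinite (UNIV :: 'u set)"
    unfolding skeletally_small_def by (rule conjunct1)
  from assms(2) obtain S where S: "S \<subseteq> Ob C" "\<forall>X \<in> Ob C. \<exists>Y \<in> S. isomorphic C X Y"
    and small: "small_set TYPE('u) {(X, Y, f). X \<in> S \<and> Y \<in> S \<and> f \<in> arr C X Y}"
    unfolding skeletally_small_def by (elim conjE exE)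
  obtain e :: "'o \<times> 'o \<times> 'm \<Rightarrow> 'u" where e: "inj_on e {(X, Y, f). X \<in> S \<and> Y \<in> S \<and> f \<in> arr C X Y}"
    using small_set_inj[OF small inf] by blast
  obtain X' a a' where a: "X' \<in> S" "a \<in> arr C X X'" "a' \<in> arr C X' X" "Cmp C X X' X a' a = Idn C X"
    using bspec[OF S(2) XY(1)] unfolding isomorphic_def is_iso_def by (elim bexE exE conjE)
  obtain Y' b b' where b: "Y' \<in> S" "b \<in> arr C Y Y'" "b' \<in> arr C Y' Y" "Cmp C Y Y' Y b' b = Idn C Y"
    using bspec[OF S(2) XY(2)] unfolding isomorphic_def is_iso_def by (elim bexE exE conjE)
  define h where "h f = Cmp C X' X Y' (Cmp C X Y Y' b f) a'" for f
  have ob: "X' \<in> Ob C" "Y' \<in> Ob C" using S a b by auto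
  have h_arr: "h f \<in> arr C X' Y'" if "f \<in> arr C X Y" for f
    unfolding h_def by (intro comp_arr; fact)
  have h_inv: "Cmp C X Y' Y b' (Cmp C X X' Y' (h f) a) = f" if f: "f \<in> arr C X Y" for f
  proof -
    have bf: "Cmp C X Y Y' b f \<in> arr C X Y'" using f XY ob b by simp
    have "Cmp C X X' Y' (h f) a = Cmp C X Y Y' b f"
      unfolding h_def comp_assoc[OF XY(1) ob(1) XY(1) ob(2) a(2,3) bf, symmetric] a(4)
      using XY ob bf by simp
    also have "Cmp C X Y' Y b' (Cmp C X Y Y' b f) = f"
      unfolding comp_assoc[OF XY ob(2) XY(2) f b(2,3)] b(4) using XY f by simp
    finally show ?thesis .
  qed
  have "inj_on (\<lambda>f. e (X', Y', h f)) (arr C X Y)"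
  proof (rule inj_onI)
    fix f g assume fg: "f \<in> arr C X Y" "g \<in> arr C X Y" "e (X', Y', h f) = e (X', Y', h g)"
    have "(X', Y', h f) = (X', Y', h g)"
      by (rule inj_onD[OF e, OF fg(3)]) (use a b h_arr fg in auto)
    then have hfg: "h f = h g" by blast
    show "f = g" by (rule trans[OF sym h_inv[OF fg(2)]]) (rule h_inv[OF fg(1), unfolded hfg])
  qed
  then show ?thesis by blast
qed

section \<open>Biproducts and morphisms factoring through a subcategory\<close>

text \<open>The two-term direct sum with its structure morphisms exposed: \<open>i\<close> and
  \<open>p\<close> belong to \<open>T\<close>, \<open>j\<close> and \<open>s\<close> to
  \<open>U\<close>. The predicate \<open>is_direct_sum\<close> hides them behind existential
  quantifiers.\<close>

definition biproduct ::
  "('o, 'm) acat \<Rightarrow> 'o \<Rightarrow> 'o \<Rightarrow> 'o \<Rightarrow> 'm \<Rightarrow> 'm \<Rightarrow> 'm \<Rightarrow> 'm \<Rightarrow> bool" where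
  "biproduct C T U X i p j s \<longleftrightarrow> T \<in> Ob C \<and> U \<in> Ob C \<and> X \<in> Ob C \<and>
     i \<in> arr C T X \<and> p \<in> arr C X T \<and> j \<in> arr C U X \<and> s \<in> arr C X U \<and>
     Cmp C T X T p i = Idn C T \<and> Cmp C U X U s j = Idn C U \<and>
     Cmp C T X U s i = zero_arr C T U \<and> Cmp C U X T p j = zero_arr C U T \<and>
     Cmp C X T X i p \<otimes>\<^bsub>Hom C X X\<^esub> Cmp C X U X j s = Idn C X"

lemma full_sub_simps [simp]:
  "Ob (full_sub C S) = S" "Hom (full_sub C S) = Hom C"
  "Idn (full_sub C S) = Idn C" "Cmp (full_sub C S) = Cmp C"
  by (simp_all add: full_sub_def)

lemma (in preadditive) preadditive_full_sub:
  assumes "S \<subseteq> Ob C"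
  shows "preadditive (full_sub C S)"
  by (rule preadditive.intro)
    (use assms in \<open>auto simp: subset_iff hom_group comp_assoc comp_add_left comp_add_right\<close>)

context preadditive
begin

lemma finprod_two:
  assumes "X \<in> Ob C" "g (0::nat) \<in> arr C X X" "g 1 \<in> arr C X X"
  shows "finprod (Hom C X X) g {..<2} = g 0 \<otimes>\<^bsub>Hom C X X\<^esub> g 1"
proof -
  interpret H: comm_group "Hom C X X" by (rule hom_group[OF assms(1,1)])
  have "{..<2::nat} = {0, 1}" by auto
  then show ?thesis using assms by (simp add: Pi_iff)
qed

lemma is_direct_sum_2_iff:
  "is_direct_sum C 2 A X \<longleftrightarrow> (\<exists>i p j s. biproduct C (A 0) (A 1) X i p j s)"
proof
  assume "is_direct_sum C 2 A X"
  then obtain i p where X: "X \<in> Ob C" and A: "\<forall>k<2. A k \<in> Ob C"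
    and ar: "\<forall>k<2. i k \<in> arr C (A k) X \<and> p k \<in> arr C X (A k)"
    and orth: "\<forall>k<2. \<forall>l<2. Cmp C (A k) X (A l) (p l) (i k)
      = (if k = l then Idn C (A k) else zero_arr C (A k) (A l))"
    and sum: "finprod (Hom C X X) (\<lambda>k. Cmp C X (A k) X (i k) (p k)) {..<2} = Idn C X"
    unfolding is_direct_sum_def by (elim conjE exE)
  have ob: "A 0 \<in> Ob C" "A 1 \<in> Ob C" using A by simp_all
  have ar': "i 0 \<in> arr C (A 0) X" "p 0 \<in> arr C X (A 0)" "i 1 \<in> arr C (A 1) X" "p 1 \<in> arr C X (A 1)"
    using ar by simp_all
  have "Cmp C X (A 0) X (i 0) (p 0) \<otimes>\<^bsub>Hom C X X\<^esub> Cmp C X (A 1) X (i 1) (p 1) = Idn C X"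
    using sum X ob ar' by (subst (asm) finprod_two) (auto simp del: One_nat_def)
  moreover have "Cmp C (A 0) X (A 0) (p 0) (i 0) = Idn C (A 0)"
    "Cmp C (A 1) X (A 1) (p 1) (i 1) = Idn C (A 1)"
    "Cmp C (A 0) X (A 1) (p 1) (i 0) = zero_arr C (A 0) (A 1)"
    "Cmp C (A 1) X (A 0) (p 0) (i 1) = zero_arr C (A 1) (A 0)"
    using orth by simp_all
  ultimately have "biproduct C (A 0) (A 1) X (i 0) (p 0) (i 1) (p 1)"
    unfolding biproduct_def using X ob ar' by blast
  then show "\<exists>i p j s. biproduct C (A 0) (A 1) X i p j s" by blast
next
  assume "\<exists>i p j s. biproduct C (A 0) (A 1) X i p j s"
  then obtain i p j s where bp: "biproduct C (A 0) (A 1) X i p j s" by blast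
  have *: "(\<forall>k<2. Q k) \<longleftrightarrow> Q 0 \<and> Q 1" for Q :: "nat \<Rightarrow> bool"
    by (auto simp: less_2_cases_iff)
  let ?i = "\<lambda>k::nat. if k = 0 then i else j" and ?p = "\<lambda>k::nat. if k = 0 then p else s"
  have "finprod (Hom C X X) (\<lambda>k. Cmp C X (A k) X (?i k) (?p k)) {..<2} = Idn C X"
    using bp unfolding biproduct_def by (subst finprod_two) auto
  then show "is_direct_sum C 2 A X"
    unfolding is_direct_sum_def *
    using bp unfolding biproduct_def
    by (intro conjI exI[of _ ?i] exI[of _ ?p]) (simp_all del: One_nat_def)
qed

lemma additive_biproduct:
  assumes "additive_cat C" "T \<in> Ob C" "U \<in> Ob C"
  obtains X i p j s where "biproduct C T U X i p j s"
proof -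
  have "\<exists>X. is_direct_sum C 2 (\<lambda>k. if k = 0 then T else U) X"
    by (rule assms(1)[unfolded additive_cat_def, THEN conjunct2, rule_format]) (use assms in simp)
  then show ?thesis using that unfolding is_direct_sum_2_iff by auto
qed

text \<open>Passing to a full subcategory changes only the set of objects, so a direct sum formed in
  \<open>B\<close> is one in \<open>C\<close>, with the same structure morphisms.\<close>

lemma full_sub_biproduct:
  assumes "B \<subseteq> Ob C" "additive_cat (full_sub C B)" "Z \<in> B" "Z' \<in> B"
  obtains W i p j s where "W \<in> B" "biproduct C Z Z' W i p j s"
proof -
  interpret B: preadditive "full_sub C B" by (rule preadditive_full_sub[OF assms(1)])
  obtain W i p j s where "biproduct (full_sub C B) Z Z' W i p j s"
    by (rule B.additive_biproduct[OF assms(2), of Z Z']) (simp_all add: assms(3,4))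
  then have "W \<in> B" "biproduct C Z Z' W i p j s"
    using assms(1) unfolding biproduct_def by auto
  then show ?thesis by (rule that)
qed

lemma fact_idealI:
  "\<lbrakk>B \<subseteq> Ob C; X \<in> Ob C; Y \<in> Ob C; Z \<in> B; g \<in> arr C X Z; h \<in> arr C Z Y\<rbrakk>
    \<Longrightarrow> Cmp C X Z Y h g \<in> fact_ideal C B X Y"
  unfolding fact_ideal_def by auto

lemma fact_idealE:
  assumes "b \<in> fact_ideal C B X Y"
  obtains Z g h where "Z \<in> B" "g \<in> arr C X Z" "h \<in> arr C Z Y" "b = Cmp C X Z Y h g"
  using assms unfolding fact_ideal_def by auto

lemma fact_ideal_arr: "b \<in> fact_ideal C B X Y \<Longrightarrow> b \<in> arr C X Y"
  unfolding fact_ideal_def by simp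

lemma fact_ideal_zero:
  assumes "B \<subseteq> Ob C" "X \<in> Ob C" "Y \<in> Ob C" "Z \<in> B"
  shows "zero_arr C X Y \<in> fact_ideal C B X Y"
  using fact_idealI[OF assms, of "zero_arr C X Z" "zero_arr C Z Y"] assms by auto

lemma fact_ideal_minus:
  assumes "B \<subseteq> Ob C" "X \<in> Ob C" "Y \<in> Ob C" "b \<in> fact_ideal C B X Y"
  shows "inv\<^bsub>Hom C X Y\<^esub> b \<in> fact_ideal C B X Y"
  using assms(4)
proof (rule fact_idealE)
  fix Z g h assume *: "Z \<in> B" "g \<in> arr C X Z" "h \<in> arr C Z Y" "b = Cmp C X Z Y h g"
  have "inv\<^bsub>Hom C X Y\<^esub> b = Cmp C X Z Y (inv\<^bsub>Hom C Z Y\<^esub> h) g"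
    unfolding * using * assms by (subst comp_minus_left) auto
  then show ?thesis using * assms by (auto intro!: fact_idealI)
qed

lemma fact_ideal_comp:
  assumes "B \<subseteq> Ob C" "X \<in> Ob C" "Y \<in> Ob C" "Y' \<in> Ob C" "b \<in> fact_ideal C B X Y" "y \<in> arr C Y Y'"
  shows "Cmp C X Y Y' y b \<in> fact_ideal C B X Y'"
  using assms(5)
proof (rule fact_idealE)
  fix Z g h assume *: "Z \<in> B" "g \<in> arr C X Z" "h \<in> arr C Z Y" "b = Cmp C X Z Y h g"
  have "Cmp C X Y Y' y b = Cmp C X Z Y' (Cmp C Z Y Y' y h) g"
    unfolding * using * assms by (subst comp_assoc) auto
  then show ?thesis using * assms by (auto intro!: fact_idealI)
qed

text \<open>The sum \<open>h g + h' g'\<close> factors through the direct sum \<open>W\<close> of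
  \<open>Z\<close> and \<open>Z'\<close>, which lies in \<open>B\<close>.\<close>

lemma fact_ideal_add:
  assumes B: "B \<subseteq> Ob C" "additive_cat (full_sub C B)" and X: "X \<in> Ob C" and Y: "Y \<in> Ob C"
    and b: "b \<in> fact_ideal C B X Y" "b' \<in> fact_ideal C B X Y"
  shows "b \<otimes>\<^bsub>Hom C X Y\<^esub> b' \<in> fact_ideal C B X Y"
proof -
  obtain Z g h where Z: "Z \<in> B" "g \<in> arr C X Z" "h \<in> arr C Z Y" "b = Cmp C X Z Y h g"
    using b(1) by (rule fact_idealE)
  obtain Z' g' h' where Z': "Z' \<in> B" "g' \<in> arr C X Z'" "h' \<in> arr C Z' Y" "b' = Cmp C X Z' Y h' g'"
    using b(2) by (rule fact_idealE)
  obtain W i p j s where W: "W \<in> B" and bp: "biproduct C Z Z' W i p j s"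
    using full_sub_biproduct[OF B Z(1) Z'(1)] .
  note ob = X Y subsetD[OF B(1) Z(1)] subsetD[OF B(1) Z'(1)] subsetD[OF B(1) W]
  have ar: "i \<in> arr C Z W" "p \<in> arr C W Z" "j \<in> arr C Z' W" "s \<in> arr C W Z'"
    and orth: "Cmp C Z W Z p i = Idn C Z" "Cmp C Z' W Z' s j = Idn C Z'"
      "Cmp C Z W Z' s i = zero_arr C Z Z'" "Cmp C Z' W Z p j = zero_arr C Z' Z"
    using bp unfolding biproduct_def by auto
  \<comment> \<open>The morphism into \<open>W\<close> with components \<open>g\<close> and
    \<open>g'\<close>.\<close>
  let ?g = "Cmp C X Z W i g \<otimes>\<^bsub>Hom C X W\<^esub> Cmp C X Z' W j g'"
  have g: "?g \<in> arr C X W" using Z Z' ob ar by auto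
  have "Cmp C X W Z p ?g = Cmp C X Z Z (Cmp C Z W Z p i) g \<otimes>\<^bsub>Hom C X Z\<^esub> Cmp C X Z' Z (Cmp C Z' W Z p j) g'"
    using Z Z' ob ar by (simp add: comp_add_right comp_assoc del: comp_id_left comp_zero_left)
  then have pg: "Cmp C X W Z p ?g = g" unfolding orth using Z Z' ob ar by simp
  have "Cmp C X W Z' s ?g = Cmp C X Z Z' (Cmp C Z W Z' s i) g \<otimes>\<^bsub>Hom C X Z'\<^esub> Cmp C X Z' Z' (Cmp C Z' W Z' s j) g'"
    using Z Z' ob ar by (simp add: comp_add_right comp_assoc del: comp_id_left comp_zero_left)
  then have sg: "Cmp C X W Z' s ?g = g'" unfolding orth using Z Z' ob ar by simp
  have "Cmp C X W Y (Cmp C W Z Y h p \<otimes>\<^bsub>Hom C W Y\<^esub> Cmp C W Z' Y h' s) ?g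
    = Cmp C X Z Y h (Cmp C X W Z p ?g) \<otimes>\<^bsub>Hom C X Y\<^esub> Cmp C X Z' Y h' (Cmp C X W Z' s ?g)"
    using Z Z' ob ar g by (simp add: comp_add_left comp_assoc)
  also have "\<dots> = b \<otimes>\<^bsub>Hom C X Y\<^esub> b'" unfolding pg sg Z(4) Z'(4) ..
  finally show ?thesis
    using fact_idealI[OF B(1) X Y W g, of "Cmp C W Z Y h p \<otimes>\<^bsub>Hom C W Y\<^esub> Cmp C W Z' Y h' s"]
      Z Z' ob ar by auto
qed

end

section \<open>Approximations\<close>

text \<open>
  The kernel \<open>K\<close> of \<open>f\<^sup>* : C(X, -) \<rightarrow> C(B\<^sub>0, -)\<close> and the ideal generate a submodule of \<open>C(X, -)\<close>; here
  \<open>x\<close> and \<open>y\<close> are congruent modulo it iff \<open>x - y \<in> K + I\<^sub>B\<close>.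
\<close>

definition approx_cong :: "('o, 'm) acat \<Rightarrow> 'o set \<Rightarrow> 'o \<Rightarrow> 'o \<Rightarrow> 'm \<Rightarrow> 'o \<Rightarrow> 'm \<Rightarrow> 'm \<Rightarrow> bool" where
  "approx_cong C B B0 X f Y x y \<longleftrightarrow>
     (\<exists>b \<in> fact_ideal C B X Y. Cmp C B0 X Y (x \<otimes>\<^bsub>Hom C X Y\<^esub> b) f = Cmp C B0 X Y y f)"

context preadditive
begin

context
  fixes B B0 X f
  assumes B: "B \<subseteq> Ob C" "additive_cat (full_sub C B)" and B0: "B0 \<in> B" and X: "X \<in> Ob C"
    and f: "f \<in> arr C B0 X"
begin

lemma B0_ob: "B0 \<in> Ob C" using B0 B by blast

text \<open>More than reflexivity: \<open>x\<close> and \<open>y\<close> are congruent as soon as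
  they agree after \<open>f\<close>, that is, when their difference lies in \<open>K\<close>. The
  witness is zero, which factors through \<open>B0\<close>.\<close>

lemma approx_cong_refl: "Y \<in> Ob C \<Longrightarrow> Cmp C B0 X Y x f = Cmp C B0 X Y y f \<Longrightarrow> x \<in> arr C X Y \<Longrightarrow> approx_cong C B B0 X f Y x y"
  unfolding approx_cong_def using fact_ideal_zero[OF B(1) X _ B0]
  by (intro bexI[of _ "zero_arr C X Y"]) (use X in auto)

text \<open>The witness changes its sign.\<close>

lemma approx_cong_sym:
  assumes Y: "Y \<in> Ob C" and xy: "x \<in> arr C X Y" "y \<in> arr C X Y" and "approx_cong C B B0 X f Y x y"
  shows "approx_cong C B B0 X f Y y x"
proof -
  obtain b where b: "b \<in> fact_ideal C B X Y" "Cmp C B0 X Y (x \<otimes>\<^bsub>Hom C X Y\<^esub> b) f = Cmp C B0 X Y y f"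
    using assms(4) unfolding approx_cong_def by (rule bexE)
  note ba = fact_ideal_arr[OF b(1)]
  have "Cmp C B0 X Y (y \<otimes>\<^bsub>Hom C X Y\<^esub> inv\<^bsub>Hom C X Y\<^esub> b) f
    = Cmp C B0 X Y y f \<otimes>\<^bsub>Hom C B0 Y\<^esub> Cmp C B0 X Y (inv\<^bsub>Hom C X Y\<^esub> b) f"
    using X Y f xy B0_ob ba by (intro comp_add_left) auto
  also have "\<dots> = Cmp C B0 X Y (x \<otimes>\<^bsub>Hom C X Y\<^esub> b \<otimes>\<^bsub>Hom C X Y\<^esub> inv\<^bsub>Hom C X Y\<^esub> b) f"
    unfolding b(2)[symmetric] using X Y f xy B0_ob ba by (intro comp_add_left[symmetric]) auto
  also have "x \<otimes>\<^bsub>Hom C X Y\<^esub> b \<otimes>\<^bsub>Hom C X Y\<^esub> inv\<^bsub>Hom C X Y\<^esub> b = x"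
    using X Y xy ba by (simp add: hom_add_assoc)
  finally show ?thesis
    unfolding approx_cong_def using fact_ideal_minus[OF B(1) X Y b(1)] by blast
qed

text \<open>The witnesses add up; this is where closure of \<open>B\<close> under direct sums
  enters.\<close>

lemma approx_cong_add:
  assumes Y: "Y \<in> Ob C" and xy: "x \<in> arr C X Y" "y \<in> arr C X Y" "x' \<in> arr C X Y" "y' \<in> arr C X Y"
    and cg: "approx_cong C B B0 X f Y x y" "approx_cong C B B0 X f Y x' y'"
  shows "approx_cong C B B0 X f Y (x \<otimes>\<^bsub>Hom C X Y\<^esub> x') (y \<otimes>\<^bsub>Hom C X Y\<^esub> y')"
proof -
  obtain b where b: "b \<in> fact_ideal C B X Y" "Cmp C B0 X Y (x \<otimes>\<^bsub>Hom C X Y\<^esub> b) f = Cmp C B0 X Y y f"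
    using cg(1) unfolding approx_cong_def by (rule bexE)
  obtain b' where b': "b' \<in> fact_ideal C B X Y" "Cmp C B0 X Y (x' \<otimes>\<^bsub>Hom C X Y\<^esub> b') f = Cmp C B0 X Y y' f"
    using cg(2) unfolding approx_cong_def by (rule bexE)
  note ba = fact_ideal_arr[OF b(1)] fact_ideal_arr[OF b'(1)]
  have "Cmp C B0 X Y ((x \<otimes>\<^bsub>Hom C X Y\<^esub> x') \<otimes>\<^bsub>Hom C X Y\<^esub> (b \<otimes>\<^bsub>Hom C X Y\<^esub> b')) f
    = Cmp C B0 X Y ((x \<otimes>\<^bsub>Hom C X Y\<^esub> b) \<otimes>\<^bsub>Hom C X Y\<^esub> (x' \<otimes>\<^bsub>Hom C X Y\<^esub> b')) f"
    using X Y xy ba by (simp add: hom_ac)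
  also have "\<dots> = Cmp C B0 X Y (x \<otimes>\<^bsub>Hom C X Y\<^esub> b) f \<otimes>\<^bsub>Hom C B0 Y\<^esub> Cmp C B0 X Y (x' \<otimes>\<^bsub>Hom C X Y\<^esub> b') f"
    using X Y f xy B0_ob ba by (intro comp_add_left) auto
  also have "\<dots> = Cmp C B0 X Y (y \<otimes>\<^bsub>Hom C X Y\<^esub> y') f"
    unfolding b(2) b'(2) using X Y f xy B0_ob by (intro comp_add_left[symmetric]) auto
  finally show ?thesis
    unfolding approx_cong_def using fact_ideal_add[OF B X Y b(1) b'(1)] by blast
qed

lemma approx_cong_comp:
  assumes Y: "Y \<in> Ob C" "Y' \<in> Ob C" and xy: "x \<in> arr C X Y" "y \<in> arr C X Y" and g: "g \<in> arr C Y Y'"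
    and cg: "approx_cong C B B0 X f Y x y"
  shows "approx_cong C B B0 X f Y' (Cmp C X Y Y' g x) (Cmp C X Y Y' g y)"
proof -
  obtain b where b: "b \<in> fact_ideal C B X Y" "Cmp C B0 X Y (x \<otimes>\<^bsub>Hom C X Y\<^esub> b) f = Cmp C B0 X Y y f"
    using cg unfolding approx_cong_def by (rule bexE)
  note ba = fact_ideal_arr[OF b(1)]
  have "Cmp C B0 X Y' (Cmp C X Y Y' g x \<otimes>\<^bsub>Hom C X Y'\<^esub> Cmp C X Y Y' g b) f
    = Cmp C B0 X Y' (Cmp C X Y Y' g (x \<otimes>\<^bsub>Hom C X Y\<^esub> b)) f"
    using X Y xy ba g by (simp add: comp_add_right)
  also have "\<dots> = Cmp C B0 Y Y' g (Cmp C B0 X Y (x \<otimes>\<^bsub>Hom C X Y\<^esub> b) f)"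
    using X Y xy ba g f B0_ob by (intro comp_assoc[symmetric]) auto
  also have "\<dots> = Cmp C B0 X Y' (Cmp C X Y Y' g y) f"
    unfolding b(2) using X Y xy g f B0_ob by (intro comp_assoc) auto
  finally show ?thesis
    unfolding approx_cong_def using fact_ideal_comp[OF B(1) X Y b(1) g] by blast
qed

text \<open>Follows from compatibility with addition: add the two congruences and then cancel
  \<open>y\<close> by adding its negative on both sides.\<close>

lemma approx_cong_trans:
  assumes Y: "Y \<in> Ob C" and xy: "x \<in> arr C X Y" "y \<in> arr C X Y" "z \<in> arr C X Y"
    and cg: "approx_cong C B B0 X f Y x y" "approx_cong C B B0 X f Y y z"
  shows "approx_cong C B B0 X f Y x z"
proof -
  have "approx_cong C B B0 X f Y (x \<otimes>\<^bsub>Hom C X Y\<^esub> y) (y \<otimes>\<^bsub>Hom C X Y\<^esub> z)"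
    by (rule approx_cong_add[OF Y xy(1,2,2,3) cg])
  moreover have "approx_cong C B B0 X f Y (inv\<^bsub>Hom C X Y\<^esub> y) (inv\<^bsub>Hom C X Y\<^esub> y)"
    using xy Y X by (intro approx_cong_refl) auto
  ultimately have "approx_cong C B B0 X f Y (x \<otimes>\<^bsub>Hom C X Y\<^esub> y \<otimes>\<^bsub>Hom C X Y\<^esub> inv\<^bsub>Hom C X Y\<^esub> y)
      (y \<otimes>\<^bsub>Hom C X Y\<^esub> z \<otimes>\<^bsub>Hom C X Y\<^esub> inv\<^bsub>Hom C X Y\<^esub> y)"
    using approx_cong_add[OF Y, of "x \<otimes>\<^bsub>Hom C X Y\<^esub> y" "y \<otimes>\<^bsub>Hom C X Y\<^esub> z"
        "inv\<^bsub>Hom C X Y\<^esub> y" "inv\<^bsub>Hom C X Y\<^esub> y"] xy Y X by simp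
  moreover have "x \<otimes>\<^bsub>Hom C X Y\<^esub> y \<otimes>\<^bsub>Hom C X Y\<^esub> inv\<^bsub>Hom C X Y\<^esub> y = x"
    using xy Y X by (simp add: hom_add_assoc)
  moreover have "y \<otimes>\<^bsub>Hom C X Y\<^esub> z \<otimes>\<^bsub>Hom C X Y\<^esub> inv\<^bsub>Hom C X Y\<^esub> y = z"
    using xy Y X by (simp add: hom_add_comm[of X Y y z] hom_add_assoc)
  ultimately show ?thesis by simp
qed

text \<open>Each class gets a chosen representative, which \<open>e\<close> then encodes in
  \<open>'u\<close>. Congruent elements define the same predicate for the choice, so they share
  their representative.\<close>

lemma approx_cong_representatives:
  fixes e :: "'o \<Rightarrow> 'm \<Rightarrow> 'u"
  assumes e: "\<And>Y. Y \<in> Ob C \<Longrightarrow> inj_on (e Y) (arr C X Y)"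
  obtains r :: "'o \<Rightarrow> 'm \<Rightarrow> 'u" where
    "\<And>Y x y. \<lbrakk>Y \<in> Ob C; x \<in> arr C X Y; y \<in> arr C X Y\<rbrakk> \<Longrightarrow> r Y x = r Y y \<longleftrightarrow> approx_cong C B B0 X f Y x y"
proof
  fix Y x y assume *: "Y \<in> Ob C" "x \<in> arr C X Y" "y \<in> arr C X Y"
  define s where "s x = (SOME z. z \<in> arr C X Y \<and> approx_cong C B B0 X f Y x z)" for x
  have s: "s x \<in> arr C X Y \<and> approx_cong C B B0 X f Y x (s x)" if "x \<in> arr C X Y" for x
    unfolding s_def by (rule someI[of _ x]) (use that * in \<open>auto intro: approx_cong_refl\<close>)
  have "e Y (s x) = e Y (s y) \<longleftrightarrow> s x = s y"
    by (rule inj_on_eq_iff[OF e[OF *(1)]]) (use s * in blast)+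
  also have "\<dots> \<longleftrightarrow> approx_cong C B B0 X f Y x y"
  proof
    assume eq: "s x = s y"
    have "approx_cong C B B0 X f Y (s y) y" by (rule approx_cong_sym[OF *(1,3)]) (use s[OF *(3)] in simp_all)
    then show "approx_cong C B B0 X f Y x y"
      by (rule approx_cong_trans[OF *(1,2) _ *(3), of "s y", rotated 2]) (use s[OF *(2)] in \<open>simp_all add: eq\<close>)
  next
    assume xy: "approx_cong C B B0 X f Y x y"
    have "approx_cong C B B0 X f Y x z \<longleftrightarrow> approx_cong C B B0 X f Y y z" if z: "z \<in> arr C X Y" for z
      using approx_cong_trans[OF *(1,2,3) z xy] approx_cong_trans[OF *(1,3,2) z approx_cong_sym[OF * xy]] by (rule iffI[rotated])
    then have "(\<lambda>z. z \<in> arr C X Y \<and> approx_cong C B B0 X f Y x z) = (\<lambda>z. z \<in> arr C X Y \<and> approx_cong C B B0 X f Y y z)" by blast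
    then show "s x = s y" unfolding s_def by simp
  qed
  \<comment> \<open>The choice is written out because \<open>s\<close> was defined for one fixed
    \<open>Y\<close>, whereas the function supplied for \<open>r\<close> takes \<open>Y\<close> as
    an argument.\<close>
  finally show "e Y (SOME z. z \<in> arr C X Y \<and> approx_cong C B B0 X f Y x z) = e Y (SOME z. z \<in> arr C X Y \<and> approx_cong C B B0 X f Y y z)
    \<longleftrightarrow> approx_cong C B B0 X f Y x y"
    unfolding s_def .
qed

end

lemma hom_congruence_inj:
  assumes "A \<in> Ob C" "\<And>Y. Y \<in> Ob C \<Longrightarrow> inj_on (r Y) (arr C A Y)"
  shows "hom_congruence C A r"
proof
  fix Y x x' y y'
  assume "Y \<in> Ob C" "x \<in> arr C A Y" "x' \<in> arr C A Y" "y \<in> arr C A Y" "y' \<in> arr C A Y"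
    "r Y x = r Y x'" "r Y y = r Y y'"
  then have "x = x'" "y = y'" using assms(2) by (meson inj_onD)+
  then show "r Y (x \<otimes>\<^bsub>Hom C A Y\<^esub> y) = r Y (x' \<otimes>\<^bsub>Hom C A Y\<^esub> y')" by simp
next
  fix Y Z f x x'
  assume "Y \<in> Ob C" "x \<in> arr C A Y" "x' \<in> arr C A Y" "r Y x = r Y x'"
  then have "x = x'" using assms(2) by (meson inj_onD)
  then show "r Z (Cmp C A Y Z f x) = r Z (Cmp C A Y Z f x')" by simp
qed (rule assms(1))

end

section \<open>The idempotent attached to an approximation\<close>

text \<open>In the application \<open>Q\<close> is \<open>Mod(C/I_B)\<close>, and \<open>L\<close>
  and \<open>R\<close> are induction and restriction along the quotient functor. Idempotency is
  implied by the conclusion: \<open>e\<close> factors as \<open>h g\<close> with the source of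
  \<open>h\<close> in \<open>B\<close>, so \<open>e h = h\<close>.\<close>

lemma approximation_idempotent:
  fixes C :: "('o, 'm) acat" and Q :: "('q, 'n) acat"
    and L :: "(('o, 'm, 'u) modl, 'o \<Rightarrow> 'u \<Rightarrow> 'u, 'q, 'n) fctr"
  assumes C: "preadditive C" "skeletally_small TYPE('u) C"
    and B: "B \<subseteq> Ob C" "additive_cat (full_sub C B)" "contravariantly_finite C B"
    and rec: "recollement Q (mod_cat C) (mod_cat (full_sub C B)) L R i3 j1 (res (full_sub C B) id_fun) j3"
    and L: "exact_functor (mod_cat C) Q L"
    and X: "X \<in> Ob C"
  shows "\<exists>e \<in> fact_ideal C B X X. \<forall>Y \<in> B. \<forall>y \<in> arr C Y X. Cmp C Y X X e y = y"
proof -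
  interpret preadditive C by fact
  let ?M = "mod_cat C :: (('o, 'm, 'u) modl, 'o \<Rightarrow> 'u \<Rightarrow> 'u) acat" and ?j = "res (full_sub C B) id_fun"
  let ?MB = "mod_cat (full_sub C B) :: (('o, 'm, 'u) modl, 'o \<Rightarrow> 'u \<Rightarrow> 'u) acat"
  note rec' = rec[unfolded recollement_def]
  have ab: "abelian_cat ?M" using rec' by (elim conjE)
  have R: "additive_functor Q ?M R" using rec' by (elim conjE)
  have j: "additive_functor ?M ?MB ?j" using rec' by (elim conjE)
  have adj: "adjoint ?M Q L R" using rec' by (elim conjE)
  have "\<forall>M \<in> Ob ?M. is_zero ?MB (FOb ?j M) \<longleftrightarrow> (\<exists>N \<in> Ob Q. isomorphic ?M M (FOb R N))"
    using rec' by (elim conjE)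
  note ker_j = bspec[OF this]
  interpret R: additive_functor Q ?M R by (rule R)
  interpret j: additive_functor ?M ?MB ?j by (rule j)

  obtain B0 f where B0: "B0 \<in> B" and f: "f \<in> arr C B0 X"
    and approx: "\<forall>Y\<in>B. \<forall>y\<in>arr C Y X. \<exists>g \<in> arr C Y B0. y = Cmp C Y B0 X f g"
    using bspec[OF B(3)[unfolded contravariantly_finite_def] X] by (elim bexE)
  have B0_ob: "B0 \<in> Ob C" using B0 B(1) by blast

  have inj: "\<exists>e :: 'm \<Rightarrow> 'u. inj_on e (arr C Y Z)" if "Y \<in> Ob C" "Z \<in> Ob C" for Y Z
    by (rule skeletally_small_inj[OF C that])
  have "\<forall>Y. \<exists>e :: 'm \<Rightarrow> 'u. Y \<in> Ob C \<longrightarrow> inj_on e (arr C X Y)"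
    using inj[OF X] by blast
  then obtain r1 :: "'o \<Rightarrow> 'm \<Rightarrow> 'u" where r1: "Y \<in> Ob C \<Longrightarrow> inj_on (r1 Y) (arr C X Y)" for Y
    using choice[of "\<lambda>Y e. Y \<in> Ob C \<longrightarrow> inj_on e (arr C X Y)"] by blast
  have "\<forall>Y. \<exists>e :: 'm \<Rightarrow> 'u. Y \<in> Ob C \<longrightarrow> inj_on e (arr C B0 Y)"
    using inj[OF B0_ob] by blast
  then obtain r0 :: "'o \<Rightarrow> 'm \<Rightarrow> 'u" where r0: "Y \<in> Ob C \<Longrightarrow> inj_on (r0 Y) (arr C B0 Y)" for Y
    using choice[of "\<lambda>Y e. Y \<in> Ob C \<longrightarrow> inj_on e (arr C B0 Y)"] by blast
  let ?cg = "approx_cong C B B0 X f"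
  obtain r2 :: "'o \<Rightarrow> 'm \<Rightarrow> 'u" where
    r2: "\<And>Y x y. \<lbrakk>Y \<in> Ob C; x \<in> arr C X Y; y \<in> arr C X Y\<rbrakk> \<Longrightarrow> r2 Y x = r2 Y y \<longleftrightarrow> ?cg Y x y"
    using approx_cong_representatives[OF B(1,2) B0 X f r1] by blast

  interpret P: hom_congruence C X r1 by (rule hom_congruence_inj[OF X r1])
  interpret P0: hom_congruence C B0 r0 by (rule hom_congruence_inj[OF B0_ob r0])
  interpret N: hom_congruence C X r2
  proof
    fix Y x x' y y'
    assume Y: "Y \<in> Ob C" and xy: "x \<in> arr C X Y" "x' \<in> arr C X Y" "y \<in> arr C X Y" "y' \<in> arr C X Y"
      and "r2 Y x = r2 Y x'" "r2 Y y = r2 Y y'"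
    then have "?cg Y x x'" "?cg Y y y'" using r2 by simp_all
    from approx_cong_add[OF B(1,2) B0 X f Y xy this]
    show "r2 Y (x \<otimes>\<^bsub>Hom C X Y\<^esub> y) = r2 Y (x' \<otimes>\<^bsub>Hom C X Y\<^esub> y')"
      using r2 Y xy X by simp
  next
    fix Y Z g x x'
    assume Y: "Y \<in> Ob C" "Z \<in> Ob C" and g: "g \<in> arr C Y Z" and x: "x \<in> arr C X Y" "x' \<in> arr C X Y"
      and "r2 Y x = r2 Y x'"
    then have "?cg Y x x'" using r2 by simp
    from approx_cong_comp[OF B(1,2) B0 X f Y x g this]
    show "r2 Z (Cmp C X Y Z g x) = r2 Z (Cmp C X Y Z g x')"
      using r2 Y x g X by simp
  qed (rule X)
  \<comment> \<open>\<open>?P\<close> and \<open>?PB\<close> are copies of \<open>C(X, -)\<close>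
    and \<open>C(B0, -)\<close>, as \<open>r1\<close> and \<open>r0\<close> are injective;
    \<open>?N\<close> is the quotient of \<open>C(X, -)\<close> by \<open>K\<close> and the
    ideal.\<close>
  let ?P = "hom_quot C X r1" and ?PB = "hom_quot C B0 r0" and ?N = "hom_quot C X r2"
  have ob: "?P \<in> Ob ?M" "?PB \<in> Ob ?M" "?N \<in> Ob ?M"
    by (simp_all add: mod_cat_simps P.hom_quot_additive P0.hom_quot_additive N.hom_quot_additive)
  have r1_eq: "x = y" if "Y \<in> Ob C" "x \<in> arr C X Y" "y \<in> arr C X Y" "r1 Y x = r1 Y y" for Y x y
    using inj_onD[OF r1[OF that(1)], OF that(4,2,3)] .

  \<comment> \<open>\<open>\<eta>\<close> is precomposition with \<open>f\<close>.\<close>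
  obtain \<eta> where \<eta>: "\<eta> \<in> arr ?M ?P ?PB"
    "\<And>Y x. \<lbrakk>Y \<in> Ob C; x \<in> arr C X Y\<rbrakk> \<Longrightarrow> \<eta> Y (r1 Y x) = r0 Y (Cmp C B0 X Y x f)"
  proof (rule P.precompose_hom_quot[OF P0.hom_congruence_axioms f])
    show "r0 Y (Cmp C B0 X Y x f) = r0 Y (Cmp C B0 X Y y f)"
      if "Y \<in> Ob C" "x \<in> arr C X Y" "y \<in> arr C X Y" "r1 Y x = r1 Y y" for Y x y
      using r1_eq[OF that] by simp
  qed (rule that)
  \<comment> \<open>\<open>q\<close> is the projection onto the quotient, obtained as precomposition
    with the identity.\<close>
  obtain q where q: "q \<in> arr ?M ?P ?N"
    "\<And>Y x. \<lbrakk>Y \<in> Ob C; x \<in> arr C X Y\<rbrakk> \<Longrightarrow> q Y (r1 Y x) = r2 Y (Cmp C X X Y x (Idn C X))"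
  proof (rule P.precompose_hom_quot[OF N.hom_congruence_axioms id_arr[OF X]])
    show "r2 Y (Cmp C X X Y x (Idn C X)) = r2 Y (Cmp C X X Y y (Idn C X))"
      if "Y \<in> Ob C" "x \<in> arr C X Y" "y \<in> arr C X Y" "r1 Y x = r1 Y y" for Y x y
      using r1_eq[OF that] by simp
  qed (rule that)
  have q_val: "q Y (r1 Y x) = r2 Y x" if "Y \<in> Ob C" "x \<in> arr C X Y" for Y x
    using q(2)[OF that] that X by simp

  have FOb_j: "FOb (FOb ?j M) Y = FOb M Y" for M :: "('o, 'm, 'u) modl" and Y
    by (simp add: res_def fcomp_def id_fun_def)
  \<comment> \<open>By Yoneda, a morphism out of \<open>C(B0, -)\<close> is determined by its value
    at the identity of \<open>B0\<close>, and modules in the image of \<open>R\<close> vanish at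
    \<open>B0\<close>.\<close>
  have from_P0: "h = zero_arr ?M ?PB (FOb R N)" if N: "N \<in> Ob Q" and h: "h \<in> arr ?M ?PB (FOb R N)" for N h
  proof -
    have RN: "FOb R N \<in> Ob ?M" using N by (rule R.map_ob)
    then interpret RN: additive_functor C Ab_cat "FOb R N" unfolding mod_cat_simps .
    have grp: "group (FOb ?PB Y)" "group (FOb (FOb R N) Y)" if "Y \<in> Ob C" for Y
      using P0.comm_group_hom_quot[OF that] RN.map_ob[OF that] by (simp_all add: comm_group_def)
    have triv_B0: "u = \<one>\<^bsub>FOb (FOb R N) B0\<^esub>" if "u \<in> carrier (FOb (FOb R N) B0)" for u
    proof -
      have "is_zero ?MB (FOb ?j (FOb R N))"
        using ker_j[OF RN] R.cod.isomorphic_refl[OF RN] N by blast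
      then have "Idn ?MB (FOb ?j (FOb R N)) = zero_arr ?MB (FOb ?j (FOb R N)) (FOb ?j (FOb R N))"
        by (rule j.cod.is_zeroD)
      \<comment> \<open>The identity of the restricted module equals its zero endomorphism;
        comparing the two at \<open>B0\<close> and \<open>u\<close> gives the claim.\<close>
      from fun_cong[OF fun_cong[OF this, of B0], of u] show ?thesis
        using B0 that by (simp add: mod_cat_simps FOb_j)
    qed
    have h': "h \<in> extensional (Ob C)"
      "\<And>Y. Y \<in> Ob C \<Longrightarrow> h Y \<in> hom (FOb ?PB Y) (FOb (FOb R N) Y) \<and> h Y \<in> extensional (r0 Y ` arr C B0 Y)"
      "\<And>Y Z g u. \<lbrakk>Y \<in> Ob C; Z \<in> Ob C; g \<in> arr C Y Z; u \<in> r0 Y ` arr C B0 Y\<rbrakk> \<Longrightarrow>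
        h Z (FArr ?PB Y Z g u) = FArr (FOb R N) Y Z g (h Y u)"
      using h unfolding arr_mod_cat_iff P0.carrier_hom_quot by blast+
    have "h Y (r0 Y x) = \<one>\<^bsub>FOb (FOb R N) Y\<^esub>" if Y: "Y \<in> Ob C" and x: "x \<in> arr C B0 Y" for Y x
    proof -
      have id: "r0 B0 (Idn C B0) \<in> r0 B0 ` arr C B0 B0" using B0_ob by blast
      have "h B0 (r0 B0 (Idn C B0)) \<in> carrier (FOb (FOb R N) B0)"
        using h'(2)[OF B0_ob] id by (auto simp: P0.carrier_hom_quot dest!: hom_in_carrier)
      then have one: "h B0 (r0 B0 (Idn C B0)) = \<one>\<^bsub>FOb (FOb R N) B0\<^esub>" by (rule triv_B0)
      have "h Y (r0 Y x) = h Y (FArr ?PB B0 Y x (r0 B0 (Idn C B0)))"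
        using x Y B0_ob by (simp add: P0.FArr_hom_quot)
      also have "\<dots> = FArr (FOb R N) B0 Y x (\<one>\<^bsub>FOb (FOb R N) B0\<^esub>)"
        unfolding one[symmetric] by (rule h'(3)[OF B0_ob Y x id])
      also have "\<dots> = \<one>\<^bsub>FOb (FOb R N) Y\<^esub>"
        using RN.map_arr[OF B0_ob Y x] grp[OF B0_ob] grp[OF Y] by (simp add: hom_one)
      finally show ?thesis .
    qed
    then have "h Y = (\<lambda>u\<in>r0 Y ` arr C B0 Y. \<one>\<^bsub>FOb (FOb R N) Y\<^esub>)" if "Y \<in> Ob C" for Y
      by (intro extensionalityI[of _ "r0 Y ` arr C B0 Y"]) (use h'(2) that in auto)
    then show ?thesis
      unfolding mod_cat_simps P0.carrier_hom_quot
      by (intro extensionalityI[OF h'(1)]) auto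
  qed
  have "is_zero ?MB (FOb ?j ?N)"
  proof (rule j.cod.is_zeroI[OF j.map_ob[OF ob(3)]])
    have triv: "u = r2 Y (zero_arr C X Y)" if Y: "Y \<in> B" and u: "u \<in> r2 Y ` arr C X Y" for Y u
    proof -
      have Y_ob: "Y \<in> Ob C" using Y B(1) by blast
      obtain x where x: "u = r2 Y x" "x \<in> arr C X Y" using u by blast
      \<comment> \<open>Any morphism into an object of \<open>B\<close> factors through that object,
        so minus \<open>x\<close> witnesses that \<open>x\<close> is congruent to zero.\<close>
      have "inv\<^bsub>Hom C X Y\<^esub> x \<in> fact_ideal C B X Y"
        using fact_idealI[OF B(1) X Y_ob Y, of "inv\<^bsub>Hom C X Y\<^esub> x" "Idn C Y"] x X Y_ob by simp
      moreover have "x \<otimes>\<^bsub>Hom C X Y\<^esub> inv\<^bsub>Hom C X Y\<^esub> x = zero_arr C X Y"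
        using x X Y_ob by simp
      ultimately have "?cg Y x (zero_arr C X Y)"
        unfolding approx_cong_def by metis
      then show ?thesis using r2[OF Y_ob x(2) hom_zero[OF X Y_ob]] x(1) by simp
    qed
    show "Idn ?MB (FOb ?j ?N) = zero_arr ?MB (FOb ?j ?N) (FOb ?j ?N)"
      unfolding mod_cat_simps FOb_j N.carrier_hom_quot N.one_hom_quot full_sub_simps
      by (intro restrict_ext triv)
  qed
  \<comment> \<open>Here the description of the image of \<open>R\<close> is used in the other
    direction: \<open>?N\<close> vanishes on \<open>B\<close>, so it is isomorphic to some
    \<open>FOb R N\<close>.\<close>
  then obtain N \<psi> where N: "N \<in> Ob Q" and \<psi>: "is_iso ?M ?N (FOb R N) \<psi>"
    using ker_j[OF ob(3)] unfolding isomorphic_def by blast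
  have RN: "FOb R N \<in> Ob ?M" using N by (rule R.map_ob)
  have \<psi>_arr: "\<psi> \<in> arr ?M ?N (FOb R N)" using \<psi> unfolding is_iso_def by blast

  obtain K k where k: "is_kernel ?M ?P ?PB \<eta> K k"
    using ab \<eta>(1) ob unfolding abelian_cat_def by blast
  have k': "K \<in> Ob ?M" "k \<in> arr ?M K ?P" "Cmp ?M K ?P ?PB \<eta> k = zero_arr ?M K ?PB"
    using k unfolding is_kernel_def by blast+
  have \<psi>q: "Cmp ?M ?P ?N (FOb R N) \<psi> q \<in> arr ?M ?P (FOb R N)"
    using ob RN q(1) \<psi>_arr by (intro R.cod.comp_arr)
  \<comment> \<open>An element of the kernel corresponds to a morphism \<open>x\<close> with
    \<open>x f = 0\<close>, which is congruent to zero with zero witness.\<close>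
  have qk: "q Y (k Y u) = \<one>\<^bsub>FOb ?N Y\<^esub>" if Y: "Y \<in> Ob C" and u: "u \<in> carrier (FOb K Y)" for Y u
  proof -
    have "k Y u \<in> carrier (FOb ?P Y)"
      using k'(2) Y u unfolding arr_mod_cat_iff by (auto dest: hom_in_carrier)
    then obtain x where x: "k Y u = r1 Y x" "x \<in> arr C X Y" unfolding P.carrier_hom_quot by blast
    have "\<eta> Y (k Y u) = \<one>\<^bsub>FOb ?PB Y\<^esub>"
      using fun_cong[OF fun_cong[OF k'(3), of Y], of u] Y u by (simp add: mod_cat_simps)
    then have "r0 Y (Cmp C B0 X Y x f) = r0 Y (zero_arr C B0 Y)"
      unfolding x(1) \<eta>(2)[OF Y x(2)] P0.one_hom_quot .
    then have "Cmp C B0 X Y x f = zero_arr C B0 Y"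
      by (rule inj_onD[OF r0[OF Y]]) (use x f X Y B0_ob in auto)
    then have "?cg Y x (zero_arr C X Y)"
      by (intro approx_cong_refl[OF B(1,2) B0 X f]) (use x X Y f B0_ob in simp_all)
    then show ?thesis
      unfolding x(1) q_val[OF Y x(2)] N.one_hom_quot using r2 Y x X by simp
  qed
  have "Cmp ?M K ?P (FOb R N) (Cmp ?M ?P ?N (FOb R N) \<psi> q) k = Cmp ?M K ?N (FOb R N) \<psi> (Cmp ?M K ?P ?N q k)"
    using k' ob RN q(1) \<psi>_arr by (intro R.cod.comp_assoc[symmetric])
  also have "Cmp ?M K ?P ?N q k = zero_arr ?M K ?N"
    unfolding mod_cat_simps by (intro restrict_ext qk)
  also have "Cmp ?M K ?N (FOb R N) \<psi> (zero_arr ?M K ?N) = zero_arr ?M K (FOb R N)"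
    using k' ob RN \<psi>_arr by (intro R.cod.comp_zero_right)
  finally have "Cmp ?M ?P ?N (FOb R N) \<psi> q = zero_arr ?M ?P (FOb R N)"
    by (rule exact_left_adjoint_kernel[OF ab L R.cat_functor_axioms adj ob(2) _ k N \<psi>q, rotated])
      (rule from_P0)
  also have "\<dots> = Cmp ?M ?P ?N (FOb R N) \<psi> (zero_arr ?M ?P ?N)"
    using ob RN \<psi>_arr by (intro R.cod.comp_zero_right[symmetric])
  finally have "q = zero_arr ?M ?P ?N"
    by (rule R.cod.is_iso_comp_left_cancel[OF \<psi> ob(1,3) RN q(1) R.cod.hom_zero[OF ob(1,3)]])
  \<comment> \<open>The projection is zero; evaluated at the identity of \<open>X\<close>, this puts
    the identity into the congruence class of zero.\<close>
  then have "q X (r1 X (Idn C X)) = r2 X (zero_arr C X X)"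
    using X by (simp add: mod_cat_simps P.carrier_hom_quot N.one_hom_quot)
  then have "?cg X (Idn C X) (zero_arr C X X)"
    unfolding q_val[OF X id_arr[OF X]] using r2[OF X id_arr[OF X] hom_zero[OF X X]] by simp
  \<comment> \<open>The congruence reads \<open>(1 + b) f = 0\<close>, so the desired
    \<open>e\<close> is minus \<open>b\<close>.\<close>
  then obtain b where b: "b \<in> fact_ideal C B X X"
    "Cmp C B0 X X (Idn C X \<otimes>\<^bsub>Hom C X X\<^esub> b) f = Cmp C B0 X X (zero_arr C X X) f"
    unfolding approx_cong_def by (rule bexE)
  note ba = fact_ideal_arr[OF b(1)]
  have bf: "Cmp C B0 X X b f \<in> arr C B0 X" using ba X B0_ob f by simp
  have "f \<otimes>\<^bsub>Hom C B0 X\<^esub> Cmp C B0 X X b f = zero_arr C B0 X"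
    using b(2) comp_add_left[of B0 X X f "Idn C X" b] ba X B0_ob f by simp
  then have "Cmp C B0 X X b f \<otimes>\<^bsub>Hom C B0 X\<^esub> f
    = Cmp C B0 X X b f \<otimes>\<^bsub>Hom C B0 X\<^esub> inv\<^bsub>Hom C B0 X\<^esub> Cmp C B0 X X b f"
    unfolding hom_add_comm[OF B0_ob X f bf] hom_minus_add(2)[OF B0_ob X bf] .
  then have "f = inv\<^bsub>Hom C B0 X\<^esub> Cmp C B0 X X b f"
    by (rule hom_add_cancel[OF B0_ob X bf f hom_minus[OF B0_ob X bf]])
  then have ef: "f = Cmp C B0 X X (inv\<^bsub>Hom C X X\<^esub> b) f"
    unfolding comp_minus_left[OF B0_ob X X f ba] .
  show ?thesis
  proof (intro bexI ballI)
    show "inv\<^bsub>Hom C X X\<^esub> b \<in> fact_ideal C B X X"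
      by (rule fact_ideal_minus[OF B(1) X X b(1)])
    fix Y y assume Y: "Y \<in> B" and y: "y \<in> arr C Y X"
    have Y_ob: "Y \<in> Ob C" using Y B(1) by blast
    \<comment> \<open>Every \<open>y\<close> from an object of \<open>B\<close> is
      \<open>f g\<close> for some \<open>g\<close>, so \<open>e f = f\<close> yields
      \<open>e y = y\<close>.\<close>
    obtain g where g: "g \<in> arr C Y B0" "y = Cmp C Y B0 X f g" using bspec[OF bspec[OF approx Y] y] by (rule bexE)
    have "Cmp C Y X X (inv\<^bsub>Hom C X X\<^esub> b) (Cmp C Y B0 X f g)
      = Cmp C Y B0 X (Cmp C B0 X X (inv\<^bsub>Hom C X X\<^esub> b) f) g"
      using ba X Y_ob B0_ob f g(1) by (intro comp_assoc) auto
    then show "Cmp C Y X X (inv\<^bsub>Hom C X X\<^esub> b) y = y"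
      unfolding g(2) ef[symmetric] .
  qed
qed

section \<open>Decomposition of objects\<close>

context preadditive
begin

lemma hom_minus_zero: "\<lbrakk>X \<in> Ob C; Y \<in> Ob C\<rbrakk> \<Longrightarrow> inv\<^bsub>Hom C X Y\<^esub> zero_arr C X Y = zero_arr C X Y"
  using hom_group[of X Y] by (simp add: comm_group_def group_def monoid.inv_one)

lemma biproduct_swap:
  assumes "biproduct C T U X i p j s"
  shows "biproduct C U T X j s i p"
proof -
  have "Cmp C X T X i p \<in> arr C X X" "Cmp C X U X j s \<in> arr C X X"
    using assms unfolding biproduct_def by auto
  then show ?thesis
    using assms hom_add_comm[of X X "Cmp C X T X i p" "Cmp C X U X j s"] unfolding biproduct_def by metis
qed

lemma comp_complement:
  assumes "X \<in> Ob C" "e \<in> arr C X X" "Cmp C X X X e e = e"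
  shows "Cmp C X X X e (Idn C X \<otimes>\<^bsub>Hom C X X\<^esub> inv\<^bsub>Hom C X X\<^esub> e) = zero_arr C X X"
    "Cmp C X X X (Idn C X \<otimes>\<^bsub>Hom C X X\<^esub> inv\<^bsub>Hom C X X\<^esub> e) e = zero_arr C X X"
  using assms by (simp_all add: comp_add_left comp_add_right comp_minus_left comp_minus_right)

text \<open>Expanding only the second factor gives \<open>d d = d - d e\<close>, and
  \<open>d e = 0\<close>.\<close>

lemma complement_idem:
  assumes X: "X \<in> Ob C" and e: "e \<in> arr C X X" "Cmp C X X X e e = e"
    and d_def: "d = Idn C X \<otimes>\<^bsub>Hom C X X\<^esub> inv\<^bsub>Hom C X X\<^esub> e"
  shows "Cmp C X X X d d = d"
proof -
  have d: "d \<in> arr C X X" unfolding d_def using X e by auto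
  have de: "Cmp C X X X d e = zero_arr C X X" unfolding d_def by (rule comp_complement(2)[OF X e])
  have "Cmp C X X X d d = Cmp C X X X d (Idn C X \<otimes>\<^bsub>Hom C X X\<^esub> inv\<^bsub>Hom C X X\<^esub> e)"
    by (simp only: d_def)
  also have "\<dots> = d \<otimes>\<^bsub>Hom C X X\<^esub> inv\<^bsub>Hom C X X\<^esub> Cmp C X X X d e"
    using X d e by (simp add: comp_add_right comp_minus_right)
  also have "\<dots> = d" unfolding de using X d by (simp add: hom_minus_zero)
  finally show ?thesis .
qed

text \<open>The kernel of \<open>1 - e\<close> is the image of \<open>e\<close>: since
  \<open>(1 - e) e = 0\<close>, the morphism \<open>e\<close> lifts along \<open>j\<close> to some
  \<open>s\<close>. Conversely \<open>e j = j\<close>, so \<open>j s j = j\<close>, and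
  \<open>j\<close> can be cancelled as a mono.\<close>

lemma kernel_of_complement:
  assumes X: "X \<in> Ob C" and e: "e \<in> arr C X X" "Cmp C X X X e e = e"
    and k: "is_kernel C X X (Idn C X \<otimes>\<^bsub>Hom C X X\<^esub> inv\<^bsub>Hom C X X\<^esub> e) U j"
  obtains s where "U \<in> Ob C" "j \<in> arr C U X" "s \<in> arr C X U"
    "Cmp C U X U s j = Idn C U" "Cmp C X U X j s = e"
proof -
  let ?d = "Idn C X \<otimes>\<^bsub>Hom C X X\<^esub> inv\<^bsub>Hom C X X\<^esub> e"
  note k' = k[unfolded is_kernel_iff]
  have U: "U \<in> Ob C" using k' by (elim conjE)
  have j: "j \<in> arr C U X" using k' by (elim conjE)
  have dj: "Cmp C U X X ?d j = zero_arr C U X" using k' by (elim conjE)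
  have univ: "\<forall>W \<in> Ob C. \<forall>h \<in> arr C W X. Cmp C W X X ?d h = zero_arr C W X \<longrightarrow>
        (\<exists>l \<in> arr C W U. Cmp C W U X j l = h)" using k' by (elim conjE)
  have mono: "is_mono C U X j" using k' by (elim conjE)
  obtain s where s: "s \<in> arr C X U" "Cmp C X U X j s = e"
    using bspec[OF bspec[OF univ X] e(1), rule_format, OF comp_complement(2)[OF X e]] by (rule bexE)
  have ej: "Cmp C U X X e j = j"
  proof -
    have "j = Cmp C U X X (?d \<otimes>\<^bsub>Hom C X X\<^esub> e) j"
      using X e U j by (simp add: hom_add_assoc)
    also have "\<dots> = Cmp C U X X ?d j \<otimes>\<^bsub>Hom C U X\<^esub> Cmp C U X X e j"
      using X e U j by (intro comp_add_left) auto
    also have "\<dots> = Cmp C U X X e j" unfolding dj using X U e j by simp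
    finally show ?thesis by (rule sym)
  qed
  have "Cmp C U U X j (Cmp C U X U s j) = Cmp C U X X (Cmp C X U X j s) j"
    using X U s(1) j by (intro comp_assoc) auto
  also have "\<dots> = Cmp C U U X j (Idn C U)"
    unfolding s(2) ej using U X j by simp
  finally have "Cmp C U X U s j = Idn C U"
    using mono U X s(1) j unfolding is_mono_def by (meson comp_arr id_arr)
  then show ?thesis using that U j s by blast
qed

text \<open>The hypothesis provides kernels of idempotents only, so it is applied to the
  complementary idempotent.\<close>

lemma split_idempotent:
  assumes "idempotents_split C" and X: "X \<in> Ob C" and e: "e \<in> arr C X X" "Cmp C X X X e e = e"
  obtains U j s where "U \<in> Ob C" "j \<in> arr C U X" "s \<in> arr C X U"
    "Cmp C U X U s j = Idn C U" "Cmp C X U X j s = e"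
proof -
  have "Idn C X \<otimes>\<^bsub>Hom C X X\<^esub> inv\<^bsub>Hom C X X\<^esub> e \<in> arr C X X" using X e by auto
  then obtain U j where "is_kernel C X X (Idn C X \<otimes>\<^bsub>Hom C X X\<^esub> inv\<^bsub>Hom C X X\<^esub> e) U j"
    using assms(1) X complement_idem[OF X e refl] unfolding idempotents_split_def by blast
  from kernel_of_complement[OF X e this] that show ?thesis by blast
qed

text \<open>The second summand \<open>T\<close> comes from splitting \<open>d = 1 - e\<close>, where
  \<open>e = j s\<close>. The mixed composites vanish because each structure morphism absorbs its
  own idempotent and \<open>e d = d e = 0\<close>.\<close>

lemma retract_biproduct:
  assumes split: "idempotents_split C" and X: "X \<in> Ob C" and U: "U \<in> Ob C"
    and j: "j \<in> arr C U X" and s: "s \<in> arr C X U" and sj: "Cmp C U X U s j = Idn C U"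
  obtains T i p where "biproduct C T U X i p j s"
proof -
  define e where "e = Cmp C X U X j s"
  define d where "d = Idn C X \<otimes>\<^bsub>Hom C X X\<^esub> inv\<^bsub>Hom C X X\<^esub> e"
  have e: "e \<in> arr C X X" unfolding e_def using X U j s by auto
  have ej: "Cmp C U X X e j = j"
    unfolding e_def comp_assoc[OF U X U X j s j, symmetric] sj using U X j by simp
  have se: "Cmp C X X U s e = s"
    unfolding e_def comp_assoc[OF X U X U s j s] sj using U X s by simp
  have ee: "Cmp C X X X e e = e"
    \<comment> \<open>The left factor stays folded, so that \<open>ej\<close> applies after
      reassociation.\<close>
    by (subst (2 3) e_def) (simp add: comp_assoc[OF X U X X s j e] ej)
  have d: "d \<in> arr C X X" unfolding d_def using X e by auto
  have dd: "Cmp C X X X d d = d" by (rule complement_idem[OF X e ee d_def])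
  obtain T i p where T: "T \<in> Ob C" and i: "i \<in> arr C T X" and p: "p \<in> arr C X T"
    and pi: "Cmp C T X T p i = Idn C T" and ip: "Cmp C X T X i p = d"
    using split_idempotent[OF split X d dd] .
  have ed: "Cmp C X X X e d = zero_arr C X X" "Cmp C X X X d e = zero_arr C X X"
    unfolding d_def by (rule comp_complement[OF X e ee])+
  have di: "Cmp C T X X d i = i"
    unfolding ip[symmetric] comp_assoc[OF T X T X i p i, symmetric] pi using T X i by simp
  have pd: "Cmp C X X T p d = p"
    unfolding ip[symmetric] comp_assoc[OF X T X T p i p] pi using T X p by simp
  have "Cmp C T X U s i = Cmp C T X U (Cmp C X X U s e) (Cmp C T X X d i)"
    unfolding se di ..
  also have "\<dots> = Cmp C T X U s (Cmp C T X X (Cmp C X X X e d) i)"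
    using T X U s e d i by (simp add: comp_assoc)
  finally have si: "Cmp C T X U s i = zero_arr C T U"
    unfolding ed using T X U s i by simp
  have "Cmp C U X T p j = Cmp C U X T (Cmp C X X T p d) (Cmp C U X X e j)"
    unfolding pd ej ..
  also have "\<dots> = Cmp C U X T p (Cmp C U X X (Cmp C X X X d e) j)"
    using T X U p e d j by (simp add: comp_assoc)
  finally have pj: "Cmp C U X T p j = zero_arr C U T"
    unfolding ed using T X U p j by simp
  have "Cmp C X T X i p \<otimes>\<^bsub>Hom C X X\<^esub> Cmp C X U X j s = Idn C X"
    unfolding ip e_def[symmetric] unfolding d_def using X e by (simp add: hom_add_assoc)
  then show ?thesis
    using that[unfolded biproduct_def] T U X i j p s pi sj si pj by blast
qed

text \<open>\<open>U\<close> is a direct summand of \<open>Z\<close>, which counts as a direct sum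
  with one term. The swap is there because \<open>direct_summand\<close> expects the summand in
  first position.\<close>

lemma retract_in_add_closure:
  assumes "idempotents_split C" "B \<subseteq> Ob C" and Z: "Z \<in> B" and U: "U \<in> Ob C"
    and j: "j \<in> arr C U Z" and s: "s \<in> arr C Z U" and sj: "Cmp C U Z U s j = Idn C U"
  shows "U \<in> add_closure C B"
proof -
  have Z_ob: "Z \<in> Ob C" using Z assms(2) by blast
  obtain T i p where "biproduct C T U Z i p j s"
    using retract_biproduct[OF assms(1) Z_ob U j s sj] .
  then have "biproduct C U T Z j s i p" by (rule biproduct_swap)
  then have "is_direct_sum C 2 (\<lambda>k. if k = 0 then U else T) Z"
    unfolding is_direct_sum_2_iff by auto
  then have "direct_summand C U Z"
    unfolding direct_summand_def by blast
  moreover have "is_direct_sum C 1 (\<lambda>_. Z) Z"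
  proof -
    interpret H: comm_group "Hom C Z Z" by (rule hom_group[OF Z_ob Z_ob])
    have "finprod (Hom C Z Z) (\<lambda>k::nat. Cmp C Z Z Z (Idn C Z) (Idn C Z)) {..<1} = Idn C Z"
      using Z_ob by (simp add: lessThan_Suc)
    then show ?thesis
      unfolding is_direct_sum_def using Z_ob
      by (intro conjI exI[of _ "\<lambda>_. Idn C Z"]) simp_all
  qed
  ultimately show ?thesis
    unfolding add_closure_def using Z
    by (intro CollectI exI[of _ 1] exI[of _ "\<lambda>_. Z"] exI[of _ Z]) simp
qed

text \<open>Factor \<open>e = h g\<close> through \<open>Z\<close> in \<open>B\<close>. Since
  \<open>e\<close> fixes \<open>h\<close>, it is idempotent and splits as \<open>j s\<close>. The
  image \<open>U\<close> is a retract of \<open>Z\<close> and so belongs to \<open>B\<close>; the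
  complement \<open>T\<close> receives no nonzero morphism from \<open>B\<close>.\<close>

lemma perp_decomposition:
  assumes split: "idempotents_split C" and B: "B \<subseteq> Ob C" "add_closure C B = B" and X: "X \<in> Ob C"
    and e: "e \<in> fact_ideal C B X X"
    and e_fix: "\<forall>Y \<in> B. \<forall>y \<in> arr C Y X. Cmp C Y X X e y = y"
  obtains T U i p j s where "T \<in> perp0 C B" "U \<in> B" "biproduct C T U X i p j s"
proof -
  note e_id = bspec[OF bspec[OF e_fix]]
  obtain Z g h where Z: "Z \<in> B" and g: "g \<in> arr C X Z" and h: "h \<in> arr C Z X" and e_def: "e = Cmp C X Z X h g"
    using e by (rule fact_idealE)
  have Z_ob: "Z \<in> Ob C" using Z B(1) by blast
  note ea = fact_ideal_arr[OF e]
  have eh: "Cmp C Z X X e h = h" by (rule e_id[OF Z h])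
  have ee: "Cmp C X X X e e = e"
    by (subst (2 3) e_def) (simp add: comp_assoc[OF X Z_ob X X g h ea] eh)
  obtain U j s where U: "U \<in> Ob C" and j: "j \<in> arr C U X" and s: "s \<in> arr C X U"
    and sj: "Cmp C U X U s j = Idn C U" and js: "Cmp C X U X j s = e"
    using split_idempotent[OF split X ea ee] .
  \<comment> \<open>The retraction consists of \<open>g j\<close> from \<open>U\<close> to
    \<open>Z\<close> and \<open>s h\<close> back:
    \<open>s h g j = s e j = s j s j = 1\<close>.\<close>
  have "Cmp C U Z U (Cmp C Z X U s h) (Cmp C U X Z g j) = Cmp C U X U s (Cmp C U X X (Cmp C X Z X h g) j)"
    using U X Z_ob j s g h by (simp add: comp_assoc)
  also have "\<dots> = Cmp C U X U s (Cmp C U U X j (Cmp C U X U s j))"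
    unfolding e_def[symmetric] js[symmetric] comp_assoc[OF U X U X j s j] ..
  also have "\<dots> = Idn C U"
    unfolding sj using U X j s by (simp add: sj)
  finally have "U \<in> add_closure C B"
    by (intro retract_in_add_closure[OF split B(1) Z U, of "Cmp C U X Z g j" "Cmp C Z X U s h"])
      (use U X Z_ob j s g h in auto)
  then have UB: "U \<in> B" unfolding B(2) .
  obtain T i p where bp: "biproduct C T U X i p j s"
    using retract_biproduct[OF split X U j s sj] .
  then have T: "T \<in> Ob C" and i: "i \<in> arr C T X" and p: "p \<in> arr C X T"
    and pi: "Cmp C T X T p i = Idn C T" and pj: "Cmp C U X T p j = zero_arr C U T"
    unfolding biproduct_def by auto
  have "t = zero_arr C Y T" if Y: "Y \<in> B" and t: "t \<in> arr C Y T" for Y t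
  proof -
    have Y_ob: "Y \<in> Ob C" using Y B(1) by blast
    have it: "Cmp C Y T X i t \<in> arr C Y X" using Y_ob T X i t by auto
    \<comment> \<open>Because \<open>i t\<close> starts in \<open>B\<close>, it is fixed by
      \<open>e = j s\<close>; hence \<open>t = p i t = p j s i t\<close>, and
      \<open>p j = 0\<close>.\<close>
    have "t = Cmp C Y X T p (Cmp C Y T X i t)"
      unfolding comp_assoc[OF Y_ob T X T t i p] pi using Y_ob T t by simp
    also have "\<dots> = Cmp C Y X T p (Cmp C Y X X e (Cmp C Y T X i t))"
      unfolding e_id[OF Y it] ..
    also have "\<dots> = Cmp C Y U T (Cmp C U X T p j) (Cmp C Y X U s (Cmp C Y T X i t))"
      unfolding js[symmetric] using Y_ob T U X it s j p i t by (simp add: comp_assoc)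
    also have "\<dots> = zero_arr C Y T"
      unfolding pj using Y_ob T U X it s by auto
    finally show ?thesis .
  qed
  then have "T \<in> perp0 C B"
    unfolding perp0_def using T B(1) by auto
  then show ?thesis using that UB bp by blast
qed

end

section \<open>Equivalences from full faithfulness and essential surjectivity\<close>

lemma fully_faithful_ess_surj_equivalence:
  assumes F: "cat_functor C D F" and ff: "fully_faithful C D F"
    and es: "\<And>Y. Y \<in> Ob D \<Longrightarrow> \<exists>X \<in> Ob C. isomorphic D (FOb F X) Y"
  shows "is_equivalence C D F"
proof -
  interpret F: cat_functor C D F by (rule F)
  \<comment> \<open>The guard \<open>Y \<in> Ob D\<close> makes the statement total, as
    \<open>choice\<close> quantifies over the whole type; the inverse isomorphisms are chosen along
    with the isomorphisms.\<close>
  let ?Q = "\<lambda>Y X \<epsilon> \<epsilon>'. Y \<in> Ob D \<longrightarrow> X \<in> Ob C \<and> \<epsilon> \<in> arr D (FOb F X) Y \<and> \<epsilon>' \<in> arr D Y (FOb F X) \<and>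
      Cmp D (FOb F X) Y (FOb F X) \<epsilon>' \<epsilon> = Idn D (FOb F X) \<and> Cmp D Y (FOb F X) Y \<epsilon> \<epsilon>' = Idn D Y"
  have "\<forall>Y. \<exists>X \<epsilon> \<epsilon>'. ?Q Y X \<epsilon> \<epsilon>'"
    using es unfolding isomorphic_def is_iso_def by meson
  from choice[OF this] obtain g where "\<forall>Y. \<exists>\<epsilon> \<epsilon>'. ?Q Y (g Y) \<epsilon> \<epsilon>'" by (rule exE)
  from choice[OF this] obtain \<epsilon> where "\<forall>Y. \<exists>\<epsilon>'. ?Q Y (g Y) (\<epsilon> Y) \<epsilon>'" by (rule exE)
  from choice[OF this] obtain \<epsilon>' where *: "\<forall>Y. ?Q Y (g Y) (\<epsilon> Y) (\<epsilon>' Y)" by (rule exE)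
  have g [simp]: "g Y \<in> Ob C" if "Y \<in> Ob D" for Y
    using *[rule_format, OF that] by (elim conjE)
  have e [simp]: "\<epsilon> Y \<in> arr D (FOb F (g Y)) Y" if "Y \<in> Ob D" for Y
    using *[rule_format, OF that] by (elim conjE)
  have e' [simp]: "\<epsilon>' Y \<in> arr D Y (FOb F (g Y))" if "Y \<in> Ob D" for Y
    using *[rule_format, OF that] by (elim conjE)
  have e_inv [simp]: "Cmp D (FOb F (g Y)) Y (FOb F (g Y)) (\<epsilon>' Y) (\<epsilon> Y) = Idn D (FOb F (g Y))"
    if "Y \<in> Ob D" for Y
    using *[rule_format, OF that] by (elim conjE)
  have e_inv' [simp]: "Cmp D Y (FOb F (g Y)) Y (\<epsilon> Y) (\<epsilon>' Y) = Idn D Y" if "Y \<in> Ob D" for Y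
    using *[rule_format, OF that] by (elim conjE)
  note [simp] = F.map_ob F.map_arr F.map_id F.map_comp
  \<comment> \<open>Rewriting with \<open>comp_assoc\<close> nests composites to the left, where
    \<open>e_inv\<close> and \<open>e_inv'\<close> no longer match. These two rules cancel the
    inverse pairs in that form.\<close>
  have e_canc [simp]: "Cmp D (FOb F (g Y)) Y Z (Cmp D Y (FOb F (g Y)) Z x (\<epsilon>' Y)) (\<epsilon> Y) = x"
    if "Y \<in> Ob D" "Z \<in> Ob D" "x \<in> arr D (FOb F (g Y)) Z" for Y Z x
    using that F.cod.comp_assoc[of "FOb F (g Y)" Y "FOb F (g Y)" Z "\<epsilon> Y" "\<epsilon>' Y" x, symmetric] by simp
  have e_canc' [simp]: "Cmp D Y (FOb F (g Y)) Z (Cmp D (FOb F (g Y)) Y Z x (\<epsilon> Y)) (\<epsilon>' Y) = x"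
    if "Y \<in> Ob D" "Z \<in> Ob D" "x \<in> arr D Y Z" for Y Z x
    using that F.cod.comp_assoc[of Y "FOb F (g Y)" Y Z "\<epsilon>' Y" "\<epsilon> Y" x, symmetric] by simp
  \<comment> \<open>\<open>r\<close> inverts \<open>F\<close> on morphisms. Together with
    \<open>inj\<close> it allows equations in \<open>C\<close> to be verified after applying
    \<open>F\<close>.\<close>
  define r where "r A B k = inv_into (arr C A B) (FArr F A B) k" for A B k
  have r: "r A B k \<in> arr C A B" "FArr F A B (r A B k) = k"
    if "A \<in> Ob C" "B \<in> Ob C" "k \<in> arr D (FOb F A) (FOb F B)" for A B k
  proof -
    have "k \<in> FArr F A B ` arr C A B"
      using ff that bij_betw_imp_surj_on[of "FArr F A B"] unfolding fully_faithful_def by blast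
    then show "r A B k \<in> arr C A B" "FArr F A B (r A B k) = k"
      unfolding r_def by (auto intro: inv_into_into f_inv_into_f)
  qed
  note [simp] = r
  have inj: "f = f'" if "FArr F A B f = FArr F A B f'" "A \<in> Ob C" "B \<in> Ob C" "f \<in> arr C A B" "f' \<in> arr C A B" for A B f f'
  proof (rule inj_onD[of "FArr F A B" "arr C A B"])
    show "inj_on (FArr F A B) (arr C A B)"
      using ff that(2,3) bij_betw_imp_inj_on unfolding fully_faithful_def by blast
  qed (use that in auto)
  \<comment> \<open>On morphisms, \<open>G\<close> conjugates with the chosen isomorphisms and then
    lifts along \<open>F\<close>.\<close>
  define G where "G = \<lparr>FOb = g, FArr = (\<lambda>Y Y' h. r (g Y) (g Y')
    (Cmp D (FOb F (g Y)) Y (FOb F (g Y')) (Cmp D Y Y' (FOb F (g Y')) (\<epsilon>' Y') h) (\<epsilon> Y)))\<rparr>"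
  have GOb [simp]: "FOb G Y = g Y" for Y by (simp add: G_def)
  have GArr: "FArr G Y Y' h = r (g Y) (g Y')
    (Cmp D (FOb F (g Y)) Y (FOb F (g Y')) (Cmp D Y Y' (FOb F (g Y')) (\<epsilon>' Y') h) (\<epsilon> Y))" for Y Y' h
    by (simp add: G_def)
  have G: "cat_functor D C G"
  proof (intro cat_functor.intro cat_functor_axioms.intro F.cod.preadditive_axioms F.dom.preadditive_axioms)
    fix Y assume "Y \<in> Ob D"
    then show "FArr G Y Y (Idn D Y) = Idn C (FOb G Y)"
      by (intro inj[of "g Y" "g Y"]) (auto simp: GArr)
  next
    fix X Y Z f h assume "X \<in> Ob D" "Y \<in> Ob D" "Z \<in> Ob D" "f \<in> arr D X Y" "h \<in> arr D Y Z"
    then show "FArr G X Z (Cmp D X Y Z h f)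
      = Cmp C (FOb G X) (FOb G Y) (FOb G Z) (FArr G Y Z h) (FArr G X Y f)"
      by (intro inj[of "g X" "g Z"]) (auto simp: GArr F.cod.comp_assoc)
  qed (auto simp: GArr)
  have "nat_iso D D (fcomp F G) id_fun"
    unfolding nat_iso_def nat_trans_def is_iso_def
  proof (intro exI[of _ "restrict \<epsilon> (Ob D)"] conjI ballI)
    fix Y assume "Y \<in> Ob D"
    then show "\<exists>k\<in>arr D (FOb id_fun Y) (FOb (fcomp F G) Y).
        Cmp D (FOb (fcomp F G) Y) (FOb id_fun Y) (FOb (fcomp F G) Y) k (restrict \<epsilon> (Ob D) Y)
          = Idn D (FOb (fcomp F G) Y) \<and>
        Cmp D (FOb id_fun Y) (FOb (fcomp F G) Y) (FOb id_fun Y) (restrict \<epsilon> (Ob D) Y) k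
          = Idn D (FOb id_fun Y)"
      by (intro bexI[of _ "\<epsilon>' Y"]) (auto simp: fcomp_def id_fun_def)
  qed (auto simp: fcomp_def id_fun_def GArr F.cod.comp_assoc)
  moreover have "nat_iso C C (fcomp G F) id_fun"
    unfolding nat_iso_def nat_trans_def is_iso_def
  \<comment> \<open>The component at \<open>X\<close> is the lift along \<open>F\<close> of the
    chosen isomorphism for the object \<open>F X\<close>.\<close>
  proof (intro exI[of _ "\<lambda>X\<in>Ob C. r (g (FOb F X)) X (\<epsilon> (FOb F X))"] conjI ballI)
    fix X assume X: "X \<in> Ob C"
    let ?k = "r X (g (FOb F X)) (\<epsilon>' (FOb F X))" and ?l = "r (g (FOb F X)) X (\<epsilon> (FOb F X))"
    have "Cmp C (g (FOb F X)) X (g (FOb F X)) ?k ?l = Idn C (g (FOb F X))"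
      using X by (intro inj[of "g (FOb F X)" "g (FOb F X)"]) auto
    moreover have "Cmp C X (g (FOb F X)) X ?l ?k = Idn C X"
      using X by (intro inj[of X X]) auto
    ultimately show "\<exists>k\<in>arr C (FOb id_fun X) (FOb (fcomp G F) X).
        Cmp C (FOb (fcomp G F) X) (FOb id_fun X) (FOb (fcomp G F) X) k ((\<lambda>X\<in>Ob C. r (g (FOb F X)) X (\<epsilon> (FOb F X))) X)
          = Idn C (FOb (fcomp G F) X) \<and>
        Cmp C (FOb id_fun X) (FOb (fcomp G F) X) (FOb id_fun X) ((\<lambda>X\<in>Ob C. r (g (FOb F X)) X (\<epsilon> (FOb F X))) X) k
          = Idn C (FOb id_fun X)"
      using X by (intro bexI[of _ ?k]) (auto simp: fcomp_def id_fun_def)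
  next
    fix X Y f assume "X \<in> Ob C" "Y \<in> Ob C" "f \<in> arr C X Y"
    then show "Cmp C (FOb (fcomp G F) X) (FOb (fcomp G F) Y) (FOb id_fun Y)
        ((\<lambda>X\<in>Ob C. r (g (FOb F X)) X (\<epsilon> (FOb F X))) Y) (FArr (fcomp G F) X Y f)
      = Cmp C (FOb (fcomp G F) X) (FOb id_fun X) (FOb id_fun Y) (FArr id_fun X Y f)
        ((\<lambda>X\<in>Ob C. r (g (FOb F X)) X (\<epsilon> (FOb F X))) X)"
      by (intro inj[of "g (FOb F X)" Y]) (auto simp: fcomp_def id_fun_def GArr F.cod.comp_assoc)
  qed (auto simp: fcomp_def id_fun_def)
  ultimately show ?thesis
    unfolding is_equivalence_def using F G by blast
qed

section \<open>Triangular matrices\<close>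

lemma comm_group_DirProd:
  assumes "comm_group G" "comm_group H"
  shows "comm_group (G \<times>\<times> H)"
proof -
  interpret G: comm_group G by fact
  interpret H: comm_group H by fact
  interpret GH: group "G \<times>\<times> H" by (rule DirProd_group) unfold_locales
  show ?thesis
    by (rule GH.group_comm_groupI) (auto simp: G.m_comm H.m_comm)
qed

text \<open>The category of the theorem, with an arbitrary set \<open>S\<close> in place of
  \<open>perp0 C B\<close>.\<close>

abbreviation hom_tri :: "('o, 'm) acat \<Rightarrow> 'o set \<Rightarrow> 'o set \<Rightarrow> ('o \<times> 'o, 'm \<times> 'm \<times> 'm) acat" where
  "hom_tri C S B \<equiv> tri_mat_cat (full_sub C S) (hom_bifun C) (full_sub C B)"

lemma hom_tri_simps [simp]:
  "Ob (hom_tri C S B) = S \<times> B"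
  "Hom (hom_tri C S B) (T1, U1) (T2, U2) = Hom C T1 T2 \<times>\<times> (Hom C T1 U2 \<times>\<times> Hom C U1 U2)"
  "Idn (hom_tri C S B) (T1, U1) = (Idn C T1, zero_arr C T1 U1, Idn C U1)"
  by (simp_all add: tri_mat_cat_def hom_bifun_def)

context preadditive
begin

text \<open>The bifunctor acts on both sides at once, with an identity on one of them. The typing
  assumptions let these identities cancel and the restricted functions be evaluated.\<close>

lemma hom_tri_Cmp [simp]:
  assumes "T1 \<in> Ob C" "T2 \<in> Ob C" "U1 \<in> Ob C" "U2 \<in> Ob C" "U3 \<in> Ob C"
    and "t1 \<in> arr C T1 T2" "m1 \<in> arr C T1 U2" "u1 \<in> arr C U1 U2"
    and "t2 \<in> arr C T2 T3" "m2 \<in> arr C T2 U3" "u2 \<in> arr C U2 U3"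
  shows "Cmp (hom_tri C S B) (T1, U1) (T2, U2) (T3, U3) (t2, m2, u2) (t1, m1, u1)
    = (Cmp C T1 T2 T3 t2 t1, Cmp C T1 T2 U3 m2 t1 \<otimes>\<^bsub>Hom C T1 U3\<^esub> Cmp C T1 U2 U3 u2 m1,
       Cmp C U1 U2 U3 u2 u1)"
  using assms by (simp add: tri_mat_cat_def hom_bifun_def)

lemma preadditive_hom_tri:
  assumes S: "S \<subseteq> Ob C" and B: "B \<subseteq> Ob C"
  shows "preadditive (hom_tri C S B)"
proof -
  have [simp]: "T \<in> S \<Longrightarrow> T \<in> Ob C" "U \<in> B \<Longrightarrow> U \<in> Ob C" for T U using S B by auto
  show ?thesis
  proof (rule preadditive.intro)
    fix X Y assume "X \<in> Ob (hom_tri C S B)" "Y \<in> Ob (hom_tri C S B)"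
    then show "comm_group (Hom (hom_tri C S B) X Y)"
      by (auto intro!: comm_group_DirProd hom_group)
  qed (auto simp: comp_assoc comp_add_left comp_add_right hom_ac)
qed

text \<open>Inserts \<open>1 = i p + j s\<close> between \<open>h\<close> and
  \<open>a\<close>.\<close>

lemma biproduct_expand:
  assumes bp: "biproduct C T U X i p j s" and V: "V \<in> Ob C" and W: "W \<in> Ob C"
    and a: "a \<in> arr C V X" and h: "h \<in> arr C X W"
  shows "Cmp C V X W h a = Cmp C V T W (Cmp C T X W h i) (Cmp C V X T p a)
    \<otimes>\<^bsub>Hom C V W\<^esub> Cmp C V U W (Cmp C U X W h j) (Cmp C V X U s a)"
proof -
  have ob: "T \<in> Ob C" "U \<in> Ob C" "X \<in> Ob C"
    and ar: "i \<in> arr C T X" "p \<in> arr C X T" "j \<in> arr C U X" "s \<in> arr C X U"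
    and sum: "Cmp C X T X i p \<otimes>\<^bsub>Hom C X X\<^esub> Cmp C X U X j s = Idn C X"
    using bp unfolding biproduct_def by simp_all
  have "Cmp C V X W h a = Cmp C V X W (Cmp C X X W h (Idn C X)) a"
    using ob V W a h by simp
  also have "\<dots> = Cmp C V T W (Cmp C T X W h i) (Cmp C V X T p a)
    \<otimes>\<^bsub>Hom C V W\<^esub> Cmp C V U W (Cmp C U X W h j) (Cmp C V X U s a)"
    unfolding sum[symmetric] using ob ar V W a h by (simp add: comp_add_left comp_add_right comp_assoc)
  finally show ?thesis .
qed

end

section \<open>Matrices of morphisms with respect to decompositions\<close>

text \<open>The entries are \<open>p' f i\<close>, \<open>s' f i\<close> and \<open>s' f j\<close>.
  The fourth entry \<open>p' f j\<close> goes from \<open>U\<close> to \<open>T'\<close>, where only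
  the zero morphism exists in the intended situation.\<close>

fun decomp_matrix :: "('o, 'm) acat \<Rightarrow> 'o \<Rightarrow> 'o \<times> 'o \<times> 'm \<times> 'm \<times> 'm \<times> 'm \<Rightarrow>
    'o \<Rightarrow> 'o \<times> 'o \<times> 'm \<times> 'm \<times> 'm \<times> 'm \<Rightarrow> 'm \<Rightarrow> 'm \<times> 'm \<times> 'm" where
  "decomp_matrix C X (T, U, i, p, j, s) Y (T', U', i', p', j', s') f =
    (Cmp C T Y T' p' (Cmp C T X Y f i), Cmp C T Y U' s' (Cmp C T X Y f i), Cmp C U Y U' s' (Cmp C U X Y f j))"

text \<open>All data of a decomposition sit in one tuple, so that a decomposition of every object
  can be picked by a single choice function.\<close>

fun decomposition :: "('o, 'm) acat \<Rightarrow> 'o set \<Rightarrow> 'o set \<Rightarrow> 'o \<Rightarrow> 'o \<times> 'o \<times> 'm \<times> 'm \<times> 'm \<times> 'm \<Rightarrow> bool" where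
  "decomposition C S B X (T, U, i, p, j, s) \<longleftrightarrow> T \<in> S \<and> U \<in> B \<and> biproduct C T U X i p j s"

definition parts :: "'o \<times> 'o \<times> 'm \<times> 'm \<times> 'm \<times> 'm \<Rightarrow> 'o \<times> 'o" where
  "parts = (\<lambda>(T, U, i, p, j, s). (T, U))"

lemma parts_simp [simp]: "parts (T, U, i, p, j, s) = (T, U)"
  by (simp add: parts_def)

text \<open>Isolates what the matrix calculus needs of \<open>S = perp0 C B\<close>: there are no
  nonzero morphisms from \<open>B\<close> to \<open>S\<close>, so matrices are lower
  triangular.\<close>

locale hom_orthogonal = preadditive C for C :: "('o, 'm) acat" +
  fixes S B :: "'o set"
  assumes S: "S \<subseteq> Ob C" and B: "B \<subseteq> Ob C"
    and orth: "\<lbrakk>T \<in> S; U \<in> B; x \<in> arr C U T\<rbrakk> \<Longrightarrow> x = zero_arr C U T"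
begin

abbreviation "D \<equiv> hom_tri C S B"

lemma decompositionE:
  assumes "decomposition C S B X d"
  obtains T U i p j s where "d = (T, U, i, p, j, s)" "T \<in> S" "U \<in> B" "T \<in> Ob C" "U \<in> Ob C" "X \<in> Ob C"
    "i \<in> arr C T X" "p \<in> arr C X T" "j \<in> arr C U X" "s \<in> arr C X U" "biproduct C T U X i p j s"
proof -
  obtain T U i p j s where d: "d = (T, U, i, p, j, s)" by (cases d)
  have *: "T \<in> S" "U \<in> B" "biproduct C T U X i p j s" using assms unfolding d by simp_all
  show ?thesis
    by (rule that[OF d *(1,2) _ _ _ _ _ _ _ *(3)]) (use *(3) in \<open>simp_all add: biproduct_def\<close>)
qed

lemma parts_ob: "decomposition C S B X d \<Longrightarrow> parts d \<in> Ob D"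
  by (erule decompositionE) simp

lemma decomp_matrix_arr:
  assumes "decomposition C S B X d" "decomposition C S B Y d'" "f \<in> arr C X Y"
  shows "decomp_matrix C X d Y d' f \<in> arr D (parts d) (parts d')"
  using assms(1)
proof (rule decompositionE)
  fix T U i p j s
  assume d: "d = (T, U, i, p, j, s)" "T \<in> Ob C" "U \<in> Ob C" "X \<in> Ob C" "i \<in> arr C T X" "j \<in> arr C U X"
  show ?thesis
    using assms(2) by (rule decompositionE) (use d assms(3) in auto)
qed

lemma decomp_matrix_id:
  assumes "decomposition C S B X d"
  shows "decomp_matrix C X d X d (Idn C X) = Idn D (parts d)"
  using assms
proof (rule decompositionE)
  fix T U i p j s
  assume d: "d = (T, U, i, p, j, s)" and bp: "biproduct C T U X i p j s"
  show ?thesis using bp unfolding d biproduct_def by simp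
qed

text \<open>Each entry of the composite is expanded over the decomposition of the middle object
  \<open>Y\<close>. Orthogonality removes one of the two terms on the diagonal; the lower left entry
  keeps both, as in the matrix product.\<close>

lemma decomp_matrix_comp:
  assumes d: "decomposition C S B X d" and d': "decomposition C S B Y d'" and d'': "decomposition C S B Z d''"
    and f: "f \<in> arr C X Y" and g: "g \<in> arr C Y Z"
  shows "decomp_matrix C X d Z d'' (Cmp C X Y Z g f)
    = Cmp D (parts d) (parts d') (parts d'') (decomp_matrix C Y d' Z d'' g) (decomp_matrix C X d Y d' f)"
proof -
  obtain T U i p j s where d: "d = (T, U, i, p, j, s)" and dS: "T \<in> S" "U \<in> B"
    and dob: "T \<in> Ob C" "U \<in> Ob C" "X \<in> Ob C" and ij: "i \<in> arr C T X" "j \<in> arr C U X"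
    using d by (rule decompositionE)
  obtain T' U' i' p' j' s' where d': "d' = (T', U', i', p', j', s')" and dS': "T' \<in> S" "U' \<in> B"
    and dob': "T' \<in> Ob C" "U' \<in> Ob C" "Y \<in> Ob C" and ar': "i' \<in> arr C T' Y" "p' \<in> arr C Y T'"
      "j' \<in> arr C U' Y" "s' \<in> arr C Y U'" and bp: "biproduct C T' U' Y i' p' j' s'"
    using d' by (rule decompositionE)
  obtain T'' U'' i'' p'' j'' s'' where d'': "d'' = (T'', U'', i'', p'', j'', s'')" and dS'': "T'' \<in> S" "U'' \<in> B"
    and dob'': "T'' \<in> Ob C" "U'' \<in> Ob C" "Z \<in> Ob C" and ps: "p'' \<in> arr C Z T''" "s'' \<in> arr C Z U''"
    using d'' by (rule decompositionE)
  note ob = dob dob' dob''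
  have fi: "Cmp C T X Y f i \<in> arr C T Y" and fj: "Cmp C U X Y f j \<in> arr C U Y"
    and pg: "Cmp C Y Z T'' p'' g \<in> arr C Y T''" and sg: "Cmp C Y Z U'' s'' g \<in> arr C Y U''"
    using ob ij ps f g by auto
  have z1: "Cmp C U' Y T'' (Cmp C Y Z T'' p'' g) j' = zero_arr C U' T''"
    by (rule orth[OF dS''(1) dS'(2)]) (use ob pg ar' in auto)
  \<comment> \<open>\<open>z1\<close> is the upper right entry of \<open>g\<close> and
    \<open>z2\<close> that of \<open>f\<close>.\<close>
  have z2: "Cmp C U Y T' p' (Cmp C U X Y f j) = zero_arr C U T'"
    by (rule orth[OF dS'(1) dS(2)]) (use ob fj ar' in auto)
  have "Cmp C T Z T'' p'' (Cmp C T X Z (Cmp C X Y Z g f) i)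
    = Cmp C T Y T'' (Cmp C Y Z T'' p'' g) (Cmp C T X Y f i)"
    using ob ij ps f g by (simp add: comp_assoc)
  also have "\<dots> = Cmp C T T' T'' (Cmp C T' Z T'' p'' (Cmp C T' Y Z g i')) (Cmp C T Y T' p' (Cmp C T X Y f i))"
    unfolding biproduct_expand[OF bp ob(1) dob''(1) fi pg] z1
    using ob ij ps f g ar' fi by (simp add: comp_assoc)
  finally have 1: "Cmp C T Z T'' p'' (Cmp C T X Z (Cmp C X Y Z g f) i)
    = Cmp C T T' T'' (Cmp C T' Z T'' p'' (Cmp C T' Y Z g i')) (Cmp C T Y T' p' (Cmp C T X Y f i))" .
  have "Cmp C T Z U'' s'' (Cmp C T X Z (Cmp C X Y Z g f) i)
    = Cmp C T Y U'' (Cmp C Y Z U'' s'' g) (Cmp C T X Y f i)"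
    using ob ij ps f g by (simp add: comp_assoc)
  also have "\<dots> = Cmp C T T' U'' (Cmp C T' Z U'' s'' (Cmp C T' Y Z g i')) (Cmp C T Y T' p' (Cmp C T X Y f i))
    \<otimes>\<^bsub>Hom C T U''\<^esub> Cmp C T U' U'' (Cmp C U' Z U'' s'' (Cmp C U' Y Z g j')) (Cmp C T Y U' s' (Cmp C T X Y f i))"
    unfolding biproduct_expand[OF bp ob(1) dob''(2) fi sg]
    using ob ij ps f g ar' fi by (simp add: comp_assoc)
  finally have 2: "Cmp C T Z U'' s'' (Cmp C T X Z (Cmp C X Y Z g f) i)
    = Cmp C T T' U'' (Cmp C T' Z U'' s'' (Cmp C T' Y Z g i')) (Cmp C T Y T' p' (Cmp C T X Y f i))
    \<otimes>\<^bsub>Hom C T U''\<^esub> Cmp C T U' U'' (Cmp C U' Z U'' s'' (Cmp C U' Y Z g j')) (Cmp C T Y U' s' (Cmp C T X Y f i))" .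
  have "Cmp C U Z U'' s'' (Cmp C U X Z (Cmp C X Y Z g f) j)
    = Cmp C U Y U'' (Cmp C Y Z U'' s'' g) (Cmp C U X Y f j)"
    using ob ij ps f g by (simp add: comp_assoc)
  also have "\<dots> = Cmp C U U' U'' (Cmp C U' Z U'' s'' (Cmp C U' Y Z g j')) (Cmp C U Y U' s' (Cmp C U X Y f j))"
    unfolding biproduct_expand[OF bp ob(2) dob''(2) fj sg] z2
    using ob ij ps f g ar' fi by (simp add: comp_assoc)
  finally have 3: "Cmp C U Z U'' s'' (Cmp C U X Z (Cmp C X Y Z g f) j)
    = Cmp C U U' U'' (Cmp C U' Z U'' s'' (Cmp C U' Y Z g j')) (Cmp C U Y U' s' (Cmp C U X Y f j))" .
  show ?thesis
    unfolding d d' d'' decomp_matrix.simps parts_simp 1 2 3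
    by (rule hom_tri_Cmp[symmetric]) (use ob ij ps f g ar' in auto)
qed

text \<open>The inverse \<open>n\<close> reassembles a morphism from its entries as
  \<open>(i' t + j' m) p + j' u s\<close>. Recovering \<open>f\<close> uses that its upper right
  entry is zero.\<close>

lemma decomp_matrix_bij:
  assumes d: "decomposition C S B X d" and d': "decomposition C S B Y d'"
  shows "bij_betw (decomp_matrix C X d Y d') (arr C X Y) (arr D (parts d) (parts d'))"
proof -
  obtain T U i p j s where d_eq: "d = (T, U, i, p, j, s)" and dS: "T \<in> S" "U \<in> B"
    and ob: "T \<in> Ob C" "U \<in> Ob C" "X \<in> Ob C" and ar: "i \<in> arr C T X" "p \<in> arr C X T" "j \<in> arr C U X"
      "s \<in> arr C X U" and bp: "biproduct C T U X i p j s"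
    using d by (rule decompositionE)
  obtain T' U' i' p' j' s' where d'_eq: "d' = (T', U', i', p', j', s')" and dS': "T' \<in> S" "U' \<in> B"
    and ob': "T' \<in> Ob C" "U' \<in> Ob C" "Y \<in> Ob C" and ar': "i' \<in> arr C T' Y" "p' \<in> arr C Y T'"
      "j' \<in> arr C U' Y" "s' \<in> arr C Y U'" and bp': "biproduct C T' U' Y i' p' j' s'"
    using d' by (rule decompositionE)
  have pi: "Cmp C T X T p i = Idn C T" "Cmp C U X U s j = Idn C U"
      "Cmp C T X U s i = zero_arr C T U" "Cmp C U X T p j = zero_arr C U T"
    using bp unfolding biproduct_def by simp_all
  have pi': "Cmp C T' Y T' p' i' = Idn C T'" "Cmp C U' Y U' s' j' = Idn C U'"
      "Cmp C T' Y U' s' i' = zero_arr C T' U'" "Cmp C U' Y T' p' j' = zero_arr C U' T'"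
    using bp' unfolding biproduct_def by simp_all
  define n where "n = (\<lambda>(t, m, u). Cmp C X T Y (Cmp C T T' Y i' t \<otimes>\<^bsub>Hom C T Y\<^esub> Cmp C T U' Y j' m) p
    \<otimes>\<^bsub>Hom C X Y\<^esub> Cmp C X U Y (Cmp C U U' Y j' u) s)"
  show ?thesis
  proof (rule bij_betw_byWitness[where f' = n])
    show "\<forall>f\<in>arr C X Y. n (decomp_matrix C X d Y d' f) = f"
    proof
      fix f assume f: "f \<in> arr C X Y"
      have fi: "Cmp C T X Y f i \<in> arr C T Y" and fj: "Cmp C U X Y f j \<in> arr C U Y"
        using ob ob' ar f by auto
      have z: "Cmp C U Y T' p' (Cmp C U X Y f j) = zero_arr C U T'"
        by (rule orth[OF dS'(1) dS(2)]) (use ob ob' fj ar' in auto)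
      have 1: "Cmp C T T' Y i' (Cmp C T Y T' p' (Cmp C T X Y f i))
        \<otimes>\<^bsub>Hom C T Y\<^esub> Cmp C T U' Y j' (Cmp C T Y U' s' (Cmp C T X Y f i)) = Cmp C T X Y f i"
        using biproduct_expand[OF bp' ob(1) ob'(3) fi id_arr[OF ob'(3)]] ob ob' ar' fi by simp
      have 2: "Cmp C U U' Y j' (Cmp C U Y U' s' (Cmp C U X Y f j)) = Cmp C U X Y f j"
        using biproduct_expand[OF bp' ob(2) ob'(3) fj id_arr[OF ob'(3)]] ob ob' ar' fj unfolding z by simp
      show "n (decomp_matrix C X d Y d' f) = f"
        unfolding n_def d_eq d'_eq decomp_matrix.simps prod.case 1 2
        using biproduct_expand[OF bp ob(3) ob'(3) id_arr[OF ob(3)] f] ob ob' ar f by simp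
    qed
    show "\<forall>x\<in>arr D (parts d) (parts d'). decomp_matrix C X d Y d' (n x) = x"
    proof
      fix x assume "x \<in> arr D (parts d) (parts d')"
      then obtain t m u where x: "x = (t, m, u)" and tmu: "t \<in> arr C T T'" "m \<in> arr C T U'" "u \<in> arr C U U'"
        unfolding d_eq d'_eq by auto
      let ?a = "Cmp C T T' Y i' t \<otimes>\<^bsub>Hom C T Y\<^esub> Cmp C T U' Y j' m" and ?b = "Cmp C U U' Y j' u"
      have a: "?a \<in> arr C T Y" and b: "?b \<in> arr C U Y" using ob ob' ar' tmu by auto
      have ap: "Cmp C X T Y ?a p \<in> arr C X Y" and bs: "Cmp C X U Y ?b s \<in> arr C X Y"
        using ob ob'(3) ar a b by (auto simp del: hom_add)
      have n: "n x = Cmp C X T Y ?a p \<otimes>\<^bsub>Hom C X Y\<^esub> Cmp C X U Y ?b s" unfolding n_def x by simp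
      \<comment> \<open>A reassembled morphism restricts along \<open>i\<close> to its first column
        and along \<open>j\<close> to its second.\<close>
      have ni: "Cmp C T X Y (n x) i = ?a"
      proof -
        have "Cmp C T X Y (n x) i = Cmp C T T Y ?a (Cmp C T X T p i) \<otimes>\<^bsub>Hom C T Y\<^esub> Cmp C T U Y ?b (Cmp C T X U s i)"
          unfolding n comp_add_left[OF ob(1,3) ob'(3) ar(1) ap bs]
            comp_assoc[OF ob(1,3,1) ob'(3) ar(1,2) a]
            comp_assoc[OF ob(1,3,2) ob'(3) ar(1,4) b] ..
        then show ?thesis unfolding pi using ob ob' a b by simp
      qed
      have nj: "Cmp C U X Y (n x) j = ?b"
      proof -
        have "Cmp C U X Y (n x) j = Cmp C U T Y ?a (Cmp C U X T p j) \<otimes>\<^bsub>Hom C U Y\<^esub> Cmp C U U Y ?b (Cmp C U X U s j)"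
          unfolding n comp_add_left[OF ob(2,3) ob'(3) ar(3) ap bs]
            comp_assoc[OF ob(2,3,1) ob'(3) ar(3,2) a]
            comp_assoc[OF ob(2,3,2) ob'(3) ar(3,4) b] ..
        then show ?thesis unfolding pi using ob ob' a b by simp
      qed
      have "Cmp C T Y T' p' ?a = Cmp C T T' T' (Cmp C T' Y T' p' i') t \<otimes>\<^bsub>Hom C T T'\<^esub> Cmp C T U' T' (Cmp C U' Y T' p' j') m"
        using ob ob' ar' tmu by (simp add: comp_add_right comp_assoc)
      then have 1: "Cmp C T Y T' p' ?a = t" unfolding pi' using ob ob' tmu by simp
      have "Cmp C T Y U' s' ?a = Cmp C T T' U' (Cmp C T' Y U' s' i') t \<otimes>\<^bsub>Hom C T U'\<^esub> Cmp C T U' U' (Cmp C U' Y U' s' j') m"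
        using ob ob' ar' tmu by (simp add: comp_add_right comp_assoc)
      then have 2: "Cmp C T Y U' s' ?a = m" unfolding pi' using ob ob' tmu by simp
      have "Cmp C U Y U' s' ?b = Cmp C U U' U' (Cmp C U' Y U' s' j') u"
        using ob ob' ar' tmu by (simp add: comp_assoc)
      then have 3: "Cmp C U Y U' s' ?b = u" unfolding pi' using ob ob' tmu by simp
      show "decomp_matrix C X d Y d' (n x) = x"
        unfolding d_eq d'_eq decomp_matrix.simps ni nj 1 2 3 by (rule x[symmetric])
    qed
    show "decomp_matrix C X d Y d' ` arr C X Y \<subseteq> arr D (parts d) (parts d')"
      using decomp_matrix_arr[OF d d'] by blast
    show "n ` arr D (parts d) (parts d') \<subseteq> arr C X Y"
      unfolding n_def d_eq d'_eq using ob ob' ar ar' by auto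
  qed
qed

text \<open>For essential surjectivity, let \<open>X\<close> be a direct sum of given
  \<open>T\<close> and \<open>U\<close>. The decomposition \<open>d X\<close> selected beforehand
  may differ from this one, but the matrix of the identity of \<open>X\<close> between the two is an
  isomorphism.\<close>

lemma decompositions_equivalence:
  assumes add: "additive_cat C" and dec: "\<And>X. X \<in> Ob C \<Longrightarrow> decomposition C S B X (d X)"
  shows "is_equivalence C D \<lparr>FOb = (\<lambda>X. parts (d X)), FArr = (\<lambda>X Y. decomp_matrix C X (d X) Y (d Y))\<rparr>"
proof (rule fully_faithful_ess_surj_equivalence)
  let ?F = "\<lparr>FOb = (\<lambda>X. parts (d X)), FArr = (\<lambda>X Y. decomp_matrix C X (d X) Y (d Y))\<rparr>"
  show "cat_functor C D ?F"
    by (intro cat_functor.intro cat_functor_axioms.intro preadditive_axioms preadditive_hom_tri[OF S B])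
      (simp_all del: hom_tri_simps add: dec parts_ob[OF dec] decomp_matrix_arr decomp_matrix_id decomp_matrix_comp)
  show "fully_faithful C D ?F"
    unfolding fully_faithful_def by (simp del: hom_tri_simps add: dec decomp_matrix_bij)
  fix Y assume "Y \<in> Ob D"
  then obtain T U where Y: "Y = (T, U)" "T \<in> S" "U \<in> B" by auto
  have TU: "T \<in> Ob C" "U \<in> Ob C" using Y S B by auto
  obtain X i p j s where bp: "biproduct C T U X i p j s"
    using additive_biproduct[OF add TU] .
  define d' where "d' = (T, U, i, p, j, s)"
  have X: "X \<in> Ob C" using bp unfolding biproduct_def by blast
  have d': "decomposition C S B X d'" "parts d' = Y" unfolding d'_def using Y bp by simp_all
  note dX = dec[OF X]
  have "is_iso D (parts (d X)) (parts d') (decomp_matrix C X (d X) X d' (Idn C X))"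
    unfolding is_iso_def
  proof (intro conjI bexI[of _ "decomp_matrix C X d' X (d X) (Idn C X)"])
    show "decomp_matrix C X (d X) X d' (Idn C X) \<in> arr D (parts (d X)) (parts d')"
      by (rule decomp_matrix_arr[OF dX d'(1) id_arr[OF X]])
    show "decomp_matrix C X d' X (d X) (Idn C X) \<in> arr D (parts d') (parts (d X))"
      by (rule decomp_matrix_arr[OF d'(1) dX id_arr[OF X]])
    show "Cmp D (parts (d X)) (parts d') (parts (d X)) (decomp_matrix C X d' X (d X) (Idn C X))
        (decomp_matrix C X (d X) X d' (Idn C X)) = Idn D (parts (d X))"
      \<comment> \<open>Read from right to left, \<open>decomp_matrix_comp\<close> turns the product
        of the two matrices into the matrix of the identity.\<close>
      using X by (simp del: hom_tri_simps hom_tri_Cmp flip: decomp_matrix_comp[OF dX d'(1) dX] decomp_matrix_id[OF dX])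
    show "Cmp D (parts d') (parts (d X)) (parts d') (decomp_matrix C X (d X) X d' (Idn C X))
        (decomp_matrix C X d' X (d X) (Idn C X)) = Idn D (parts d')"
      using X by (simp del: hom_tri_simps hom_tri_Cmp flip: decomp_matrix_comp[OF d'(1) dX d'(1)] decomp_matrix_id[OF d'(1)])
  qed
  then show "\<exists>X\<in>Ob C. isomorphic D (FOb ?F X) Y"
    unfolding isomorphic_def d'(2) by (intro bexI[OF _ X] exI) simp
qed

end

theorem theorem5p5:
  fixes C :: "('o, 'm) acat" and B :: "'o set"
    and TC TB :: "('o, 'm, 'u) tensor"
  assumes "additive_cat C"
    and "skeletally_small TYPE('u) C"
    and "krull_schmidt C"
    and "idempotents_split C"
    and "B \<subseteq> Ob C" and "additive_cat (full_sub C B)" and "add_closure C B = B"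
    and "is_tensor C TC" and "is_tensor (full_sub C B) TB"
    and "recollement
      (mod_cat (quot_cat C B) :: (('o, 'm set, 'u) modl, 'o \<Rightarrow> 'u \<Rightarrow> 'u) acat)
      (mod_cat C)
      (mod_cat (full_sub C B))
      (induct_mod TC C (quot_cat C B) (quot_fun C B))
      (res C (quot_fun C B))
      (coinduct_mod C (quot_cat C B) (quot_fun C B))
      (induct_mod TB (full_sub C B) C id_fun)
      (res (full_sub C B) id_fun)
      (coinduct_mod (full_sub C B) C id_fun)"
    and "exact_functor (mod_cat C) (mod_cat (quot_cat C B))
      (induct_mod TC C (quot_cat C B) (quot_fun C B))"
    and "contravariantly_finite C B"
  shows "\<exists>\<Xi>. is_equivalence C
    (tri_mat_cat (full_sub C (perp0 C B)) (hom_bifun C) (full_sub C B)) \<Xi>"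
proof -
  have C: "preadditive C" using assms(1) unfolding additive_cat_def by (rule conjunct1)
  then interpret preadditive C .
  \<comment> \<open>Orthogonality is the defining property of \<open>perp0\<close>.\<close>
  interpret hom_orthogonal C "perp0 C B" B
    by unfold_locales (use assms(5) in \<open>auto simp: perp0_def\<close>)
  have "\<exists>d. decomposition C (perp0 C B) B X d" if X: "X \<in> Ob C" for X
  proof -
    obtain e where e: "e \<in> fact_ideal C B X X" "\<forall>Y \<in> B. \<forall>y \<in> arr C Y X. Cmp C Y X X e y = y"
      \<comment> \<open>The abstract left adjoint is now induction to \<open>C/I_B\<close>;
        exactness and the recollement are supplied by the hypotheses.\<close>
      using approximation_idempotent[OF C assms(2,5,6,12,10,11) X] by (rule bexE)
    obtain T U i p j s where "T \<in> perp0 C B" "U \<in> B" "biproduct C T U X i p j s"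
      using perp_decomposition[OF assms(4,5,7) X e] .
    then have "decomposition C (perp0 C B) B X (T, U, i, p, j, s)" by simp
    then show ?thesis by (rule exI)
  qed
  then obtain d where "\<And>X. X \<in> Ob C \<Longrightarrow> decomposition C (perp0 C B) B X (d X)"
    by metis
  from decompositions_equivalence[OF assms(1) this] show ?thesis by (rule exI)
qed

end
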